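(* Let $M$ be a Polish space, $\pi\in\mathcal P(M)$, let $\{W_n\}_{n\in\mathbb N}$ be a stable sequence of symmetric measurable functions $W_n:M^n\to(-\infty,\infty]$, and let $W:\mathcal P(M)\to(-\infty,\infty]$ be a measurable function. Let $\{\beta_n\}_{n\in\mathbb N}$ be a sequence of positive numbers converging to some $\beta\in(0,\infty]$. If $\beta<\infty$, suppose that $W$ is the positive temperature macroscopic limit of $\{W_n\}$. If $\beta=\infty$, suppose that $W$ is the zero temperature macroscopic limit of $\{W_n\}$ and that $\{W_n\}$ is a confining sequence. Let $d\gamma_n=e^{-n\beta_nW_n}\,d\pi^{\otimes n}$, let $F=W+\frac1\beta D(\cdot\|\pi)$ (with the convention $0\times\infty=0$, so that $F=W$ if $\beta=\infty$), and $Z_n=\gamma_n(M^n)$ (which is finite since $W_n$ is bounded from below). Suppose $Z_n>0$ for every $n$ and define the probability measures $\mathbb P_n$ on $M^n$ by $d\mathbb P_n=\frac1{Z_n}d\gamma_n$. Then the sequence of pushforward measures $\{i_n(\mathbb P_n)\}_{n\in\mathbb N}$ satisfies a large deviation principle with speed $n\beta_n$ and rate function $I=F-\inf F$; that is, for every open set $A\subset\mathcal P(M)$, $$\liminf_{n\to\infty}\frac1{n\beta_n}\log\mathbb P_n(i_n^{-1}(A))\ge-\inf_{\mu\in A}I(\mu),$$ and for every closed set $C\subset\mathcal P(M)$, $$\limsup_{n\to\infty}\frac1{n\beta_n}\log\mathbb P_n(i_n^{-1}(C))\le-\inf_{\mu\in C}I(\mu).$$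
   Context: $M$ carries its Borel $\sigma$-algebra; $\mathcal P(M)$ is the space of Borel probability measures on $M$ with the weak topology. $i_n:M^n\to\mathcal P(M)$ is $i_n(x_1,\dots,x_n)=\frac1n\sum_{i=1}^n\delta_{x_i}$. $D(\mu\|\nu)=\int_M\frac{d\mu}{d\nu}\log\frac{d\mu}{d\nu}\,d\nu$ if $\mu\ll\nu$ and $D(\mu\|\nu)=\infty$ otherwise. For symmetric measurable $W_n:M^n\to(-\infty,\infty]$ define $\tilde W_n:\mathcal P(M)\to(-\infty,\infty]$ by $\tilde W_n(\mu)=W_n(x_1,\dots,x_n)$ if $\mu=\frac1n\sum_{i=1}^n\delta_{x_i}$ for some $(x_1,\dots,x_n)\in M^n$, and $\tilde W_n(\mu)=\infty$ otherwise. Stable sequence: there is $C\in\mathbb R$ with $W_n\ge C$ for all $n$. Confining sequence: for every increasing sequence $\{n_j\}$ of natural numbers and every sequence $\{\mu_j\}$ in $\mathcal P(M)$, if there is a real constant $A$ with $\tilde W_{n_j}(\mu_j)\le A$ for all $j$, then $\{\mu_j\}$ is relatively compact in $\mathcal P(M)$. Lower limit assumption (A1): whenever $\mu_n\to\mu$ in $\mathcal P(M)$, $\liminf_{n\to\infty}\tilde W_n(\mu_n)\ge W(\mu)$. Upper limit assumption (A2): for each $\mu\in\mathcal P(M)$, $\limsup_{n\to\infty}\mathbb E_{\mu^{\otimes n}}[W_n]\le W(\mu)$. Regularity assumption (A2'): let $\mathcal N=\{\mu\in\mathcal P(M):D(\mu\|\pi)<\infty\text{ and }\limsup_{n\to\infty}\mathbb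 E_{\mu^{\otimes n}}[W_n]\le W(\mu)\}$; for every $\mu\in\mathcal P(M)$ with $W(\mu)<\infty$ there is a sequence $\{\mu_n\}$ in $\mathcal N$ with $\mu_n\to\mu$ and $\limsup_{n\to\infty}W(\mu_n)\le W(\mu)$. For a stable sequence $\{W_n\}$, a measurable $W:\mathcal P(M)\to(-\infty,\infty]$ is the positive temperature macroscopic limit of $\{W_n\}$ if (A1) and (A2) hold, and the zero temperature macroscopic limit if (A1) and (A2') hold.
   Formalization: The formal theorem additionally assumes inf F < ∞; otherwise I = F − inf F reads ∞ − ∞ and is undefined, as for W_n = n, β_n = 1, W = ∞ identically, which meets every stated hypothesis. *)

theory Defs
  imports "HOL-Probability.Probability"
begin

abbreviation borel_probs :: "'a::topological_space measure set" where
  "borel_probs \<equiv> space (prob_algebra borel)"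

definition weak_topology :: "'a::topological_space measure topology" where
  "weak_topology = topology_generated_by
     {{\<mu> \<in> borel_probs. (\<integral>x. f x \<partial>\<mu>) \<in> U} | (f :: 'a \<Rightarrow> real) U.
        continuous_on UNIV f \<and> bounded (range f) \<and> open U}"

lemma topspace_weak_topology [simp]:
  "topspace (weak_topology :: 'a::topological_space measure topology) = borel_probs"
proof -
  have "\<exists>(f :: 'a \<Rightarrow> real) U. borel_probs = {\<mu> \<in> borel_probs. (\<integral>x. f x \<partial>\<mu>) \<in> U} \<and>
      continuous_on UNIV f \<and> bounded (range f) \<and> open U"
    by (rule exI[of _ "\<lambda>_. 0"], rule exI[of _ UNIV]) auto
  then show ?thesis
    unfolding weak_topology_def topology_generated_by_topspace by blast
qed

definition borel_of_topology :: "'b topology \<Rightarrow> 'b measure" where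
  "borel_of_topology T = sigma (topspace T) {U. openin T U}"

text \<open>The power \<open>M\<^sup>n\<close> is the set of extensional functions on \<open>{..<n}\<close>. Its Borel
  \<open>\<sigma>\<close>-algebra is the product one, as Polish spaces are second countable.\<close>

abbreviation power_borel :: "nat \<Rightarrow> (nat \<Rightarrow> 'a::topological_space) measure" where
  "power_borel n \<equiv> PiM {..<n} (\<lambda>_. borel)"

abbreviation power_measure :: "nat \<Rightarrow> 'a measure \<Rightarrow> (nat \<Rightarrow> 'a) measure" where
  "power_measure n \<mu> \<equiv> PiM {..<n} (\<lambda>_. \<mu>)"

definition empirical :: "nat \<Rightarrow> (nat \<Rightarrow> 'a::topological_space) \<Rightarrow> 'a measure" where
  "empirical n x = measure_of UNIV (sets borel)
     (\<lambda>A. (\<Sum>i<n. emeasure (return borel (x i)) A) / of_nat n)"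

text \<open>The difference of the integrals of the positive and the negative part
  (\<^const>\<open>e2ennreal\<close> truncates at \<open>0\<close>). It is only used for functions whose negative part
  has a finite integral.\<close>

definition ereal_integral :: "'b measure \<Rightarrow> ('b \<Rightarrow> ereal) \<Rightarrow> ereal" where
  "ereal_integral M f =
     enn2ereal (\<integral>\<^sup>+x. e2ennreal (f x) \<partial>M) - enn2ereal (\<integral>\<^sup>+x. e2ennreal (- f x) \<partial>M)"

text \<open>The library's \<^const>\<open>KL_divergence\<close> is real-valued; here the value \<open>\<infinity>\<close> is needed.
  Note that \<open>ln 0 = 0\<close>, so the integrand is \<open>0\<close> where the density vanishes.\<close>

definition relative_entropy :: "'b measure \<Rightarrow> 'b measure \<Rightarrow> ereal" where
  "relative_entropy \<mu> \<nu> =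
     (if absolutely_continuous \<nu> \<mu>
      then ereal_integral \<nu>
        (\<lambda>x. ereal (enn2real (RN_deriv \<nu> \<mu> x) * ln (enn2real (RN_deriv \<nu> \<mu> x))))
      else \<infinity>)"

text \<open>Below, \<open>Wn\<close> is the sequence of energies, with \<open>Wn n\<close> a function on \<open>M\<^sup>n\<close>. Sequences are
  indexed by \<open>n \<ge> 1\<close>; the value at \<open>0\<close> is irrelevant.\<close>

definition symmetric_on_power :: "nat \<Rightarrow> ((nat \<Rightarrow> 'a) \<Rightarrow> 'b) \<Rightarrow> bool" where
  "symmetric_on_power n w \<longleftrightarrow>
     (\<forall>p x. p permutes {..<n} \<longrightarrow> x \<in> extensional {..<n} \<longrightarrow> w (x \<circ> p) = w x)"

definition energy_sequence :: "(nat \<Rightarrow> (nat \<Rightarrow> 'a::topological_space) \<Rightarrow> ereal) \<Rightarrow> bool" where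
  "energy_sequence Wn \<longleftrightarrow>
     (\<forall>n\<ge>1. Wn n \<in> borel_measurable (power_borel n) \<and>
        (\<forall>x\<in>space (power_borel n). Wn n x \<noteq> -\<infinity>) \<and> symmetric_on_power n (Wn n))"

definition stable_sequence :: "(nat \<Rightarrow> (nat \<Rightarrow> 'a::topological_space) \<Rightarrow> ereal) \<Rightarrow> bool" where
  "stable_sequence Wn \<longleftrightarrow>
     (\<exists>C::real. \<forall>n\<ge>1. \<forall>x\<in>space (power_borel n). ereal C \<le> Wn n x)"

text \<open>By symmetry the choice of \<open>x\<close> does not matter, see \<open>energy_on_probs_empirical\<close>.\<close>

definition energy_on_probs ::
    "nat \<Rightarrow> ((nat \<Rightarrow> 'a::topological_space) \<Rightarrow> ereal) \<Rightarrow> 'a measure \<Rightarrow> ereal" where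
  "energy_on_probs n w \<mu> =
     (if \<exists>x\<in>space (power_borel n). \<mu> = empirical n x
      then w (SOME x. x \<in> space (power_borel n) \<and> \<mu> = empirical n x)
      else \<infinity>)"

definition confining_sequence ::
    "(nat \<Rightarrow> (nat \<Rightarrow> 'a::topological_space) \<Rightarrow> ereal) \<Rightarrow> bool" where
  "confining_sequence Wn \<longleftrightarrow>
     (\<forall>r \<mu>. strict_mono r \<longrightarrow> (\<forall>j. 1 \<le> r j) \<longrightarrow> (\<forall>j::nat. \<mu> j \<in> borel_probs) \<longrightarrow>
        (\<exists>A::real. \<forall>j. energy_on_probs (r j) (Wn (r j)) (\<mu> j) \<le> ereal A) \<longrightarrow>
        compactin weak_topology (weak_topology closure_of range \<mu>))"

definition lower_limit_assumption ::
    "(nat \<Rightarrow> (nat \<Rightarrow> 'a::topological_space) \<Rightarrow> ereal) \<Rightarrow> ('a measure \<Rightarrow> ereal) \<Rightarrow> bool" where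
  "lower_limit_assumption Wn W \<longleftrightarrow>
     (\<forall>\<mu> \<mu>'. (\<forall>n. \<mu> n \<in> borel_probs) \<longrightarrow> limitin weak_topology \<mu> \<mu>' sequentially \<longrightarrow>
        liminf (\<lambda>n. energy_on_probs n (Wn n) (\<mu> n)) \<ge> W \<mu>')"

definition upper_limit_at ::
    "(nat \<Rightarrow> (nat \<Rightarrow> 'a::topological_space) \<Rightarrow> ereal) \<Rightarrow> ('a measure \<Rightarrow> ereal) \<Rightarrow> 'a measure \<Rightarrow> bool"
  where
  "upper_limit_at Wn W \<mu> \<longleftrightarrow>
     limsup (\<lambda>n. ereal_integral (power_measure n \<mu>) (Wn n)) \<le> W \<mu>"

definition upper_limit_assumption ::
    "(nat \<Rightarrow> (nat \<Rightarrow> 'a::topological_space) \<Rightarrow> ereal) \<Rightarrow> ('a measure \<Rightarrow> ereal) \<Rightarrow> bool" where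
  "upper_limit_assumption Wn W \<longleftrightarrow> (\<forall>\<mu>\<in>borel_probs. upper_limit_at Wn W \<mu>)"

definition regularity_assumption ::
    "'a::topological_space measure \<Rightarrow> (nat \<Rightarrow> (nat \<Rightarrow> 'a) \<Rightarrow> ereal) \<Rightarrow> ('a measure \<Rightarrow> ereal) \<Rightarrow> bool"
  where
  "regularity_assumption \<pi> Wn W \<longleftrightarrow>
     (\<forall>\<mu>'\<in>borel_probs. W \<mu>' < \<infinity> \<longrightarrow>
        (\<exists>\<mu>. (\<forall>n. \<mu> n \<in> {\<nu> \<in> borel_probs. relative_entropy \<nu> \<pi> < \<infinity> \<and> upper_limit_at Wn W \<nu>}) \<and>
             limitin weak_topology \<mu> \<mu>' sequentially \<and> limsup (\<lambda>n. W (\<mu> n)) \<le> W \<mu>'))"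

definition positive_temperature_limit ::
    "(nat \<Rightarrow> (nat \<Rightarrow> 'a::topological_space) \<Rightarrow> ereal) \<Rightarrow> ('a measure \<Rightarrow> ereal) \<Rightarrow> bool" where
  "positive_temperature_limit Wn W \<longleftrightarrow>
     lower_limit_assumption Wn W \<and> upper_limit_assumption Wn W"

definition zero_temperature_limit ::
    "'a::topological_space measure \<Rightarrow> (nat \<Rightarrow> (nat \<Rightarrow> 'a) \<Rightarrow> ereal) \<Rightarrow> ('a measure \<Rightarrow> ereal) \<Rightarrow> bool"
  where
  "zero_temperature_limit \<pi> Wn W \<longleftrightarrow>
     lower_limit_assumption Wn W \<and> regularity_assumption \<pi> Wn W"

definition exp_ereal :: "ereal \<Rightarrow> ennreal" where
  "exp_ereal t = (case t of ereal r \<Rightarrow> ennreal (exp r) | PInfty \<Rightarrow> \<infinity> | MInfty \<Rightarrow> 0)"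

definition ln_ennreal :: "ennreal \<Rightarrow> ereal" where
  "ln_ennreal t = (if t = 0 then -\<infinity> else if t = \<infinity> then \<infinity> else ereal (ln (enn2real t)))"

definition gibbs_measure ::
    "'a measure \<Rightarrow> (nat \<Rightarrow> (nat \<Rightarrow> 'a) \<Rightarrow> ereal) \<Rightarrow> (nat \<Rightarrow> real) \<Rightarrow> nat \<Rightarrow> (nat \<Rightarrow> 'a) measure" where
  "gibbs_measure \<pi> Wn b n =
     density (power_measure n \<pi>) (\<lambda>x. exp_ereal (- (ereal (real n * b n) * Wn n x)))"

definition partition_function ::
    "'a measure \<Rightarrow> (nat \<Rightarrow> (nat \<Rightarrow> 'a) \<Rightarrow> ereal) \<Rightarrow> (nat \<Rightarrow> real) \<Rightarrow> nat \<Rightarrow> ennreal" where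
  "partition_function \<pi> Wn b n = emeasure (gibbs_measure \<pi> Wn b n) (space (gibbs_measure \<pi> Wn b n))"

definition gibbs_prob ::
    "'a measure \<Rightarrow> (nat \<Rightarrow> (nat \<Rightarrow> 'a) \<Rightarrow> ereal) \<Rightarrow> (nat \<Rightarrow> real) \<Rightarrow> nat \<Rightarrow> (nat \<Rightarrow> 'a) measure" where
  "gibbs_prob \<pi> Wn b n = scale_measure (1 / partition_function \<pi> Wn b n) (gibbs_measure \<pi> Wn b n)"

text \<open>In \<^typ>\<open>ereal\<close>, \<open>1 / \<infinity> = 0\<close> and \<open>0 * \<infinity> = 0\<close>, so that this is \<open>W\<close> for \<open>\<beta> = \<infinity>\<close>.\<close>

definition free_energy ::
    "'a measure \<Rightarrow> ('a measure \<Rightarrow> ereal) \<Rightarrow> ereal \<Rightarrow> 'a measure \<Rightarrow> ereal" where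
  "free_energy \<pi> W \<beta> \<mu> = W \<mu> + 1 / \<beta> * relative_entropy \<mu> \<pi>"

definition large_deviation_principle ::
    "'b topology \<Rightarrow> (nat \<Rightarrow> real) \<Rightarrow> (nat \<Rightarrow> 'b measure) \<Rightarrow> ('b \<Rightarrow> ereal) \<Rightarrow> bool" where
  "large_deviation_principle T v Q I \<longleftrightarrow>
     (\<forall>A. openin T A \<longrightarrow>
        liminf (\<lambda>n. ereal (1 / v n) * ln_ennreal (emeasure (Q n) A)) \<ge> - (INF \<mu>\<in>A. I \<mu>)) \<and>
     (\<forall>C. closedin T C \<longrightarrow>
        limsup (\<lambda>n. ereal (1 / v n) * ln_ennreal (emeasure (Q n) C)) \<le> - (INF \<mu>\<in>C. I \<mu>))"

lemma emeasure_empirical: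
  assumes "A \<in> sets borel"
  shows "emeasure (empirical n x) A = (\<Sum>i<n. indicator A (x i)) / of_nat n"
proof -
  let ?f = "\<lambda>A. (\<Sum>i<n. emeasure (return borel (x i)) A) / of_nat n"
  have "countably_additive (sets borel) ?f"
  proof (rule countably_additiveI)
    fix B :: "nat \<Rightarrow> 'a set"
    assume "range B \<subseteq> sets borel" "disjoint_family B"
    then have "(\<Sum>j. emeasure (return borel (x i)) (B j)) = emeasure (return borel (x i)) (\<Union>(range B))"
      for i by (intro suminf_emeasure) auto
    then show "(\<Sum>j. ?f (B j)) = ?f (\<Union>(range B))"
      by (simp add: divide_ennreal_def suminf_sum)
  qed
  moreover have "positive (sets borel) ?f"
    by (simp add: positive_def)
  ultimately have "emeasure (empirical n x) A = ?f A"
    using assms sets.sigma_algebra_axioms[of borel] unfolding empirical_def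
    by (intro emeasure_measure_of_sigma) (auto simp: space_borel)
  then show ?thesis
    using assms by simp
qed

lemma energy_on_probs_empirical:
  fixes x :: "nat \<Rightarrow> 'a::t1_space"
  assumes sym: "symmetric_on_power n w" and "n \<ge> 1" and x: "x \<in> space (power_borel n)"
  shows "energy_on_probs n w (empirical n x) = w x"
proof -
  let ?y = "SOME y. y \<in> space (power_borel n) \<and> empirical n x = empirical n y"
  have "\<exists>y. y \<in> space (power_borel n) \<and> empirical n x = empirical n y"
    using x by blast
  then have y: "?y \<in> space (power_borel n)" "empirical n x = empirical n ?y"
    using someI_ex by (metis (mono_tags, lifting))+
  have ccard: "emeasure (empirical n z) {a} = ennreal (card {i\<in>{..<n}. z i = a} / n)"
    for z :: "nat \<Rightarrow> 'a" and a
  proof -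
    have "(\<Sum>i<n. indicator {a} (z i) :: ennreal) = of_nat (card {i\<in>{..<n}. z i = a})"
      by (simp add: indicator_def sum.If_cases Int_def)
    then show ?thesis
      using \<open>n \<ge> 1\<close> by (simp add: emeasure_empirical ennreal_of_nat_eq_real_of_nat divide_ennreal)
  qed
  have "card {i\<in>{..<n}. x i = a} = card {i\<in>{..<n}. ?y i = a}" for a
    using ccard[of x a] ccard[of ?y a] y(2) \<open>n \<ge> 1\<close> by simp
  moreover have "{i. i < n \<and> a = z i} = {i\<in>{..<n}. z i = a}" for z :: "nat \<Rightarrow> 'a" and a
    by auto
  ultimately have "image_mset ?y (mset_set {..<n}) = image_mset x (mset_set {..<n})"
    by (intro multiset_eqI)
      (simp add: count_image_mset' sum.If_cases Int_def flip: card_eq_sum)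
  from image_mset_eq_implies_permutes[OF finite_lessThan this] obtain p
    where p: "p permutes {..<n}" "\<forall>i\<in>{..<n}. ?y i = x (p i)"
    by auto
  have "?y = x \<circ> p"
  proof (rule ext)
    fix i show "?y i = (x \<circ> p) i"
      using p y(1) x
      by (cases "i < n") (auto simp: space_PiM PiE_def extensional_def permutes_def)
  qed
  moreover have "w (x \<circ> p) = w x"
    using sym p(1) x by (auto simp: symmetric_on_power_def space_PiM PiE_def)
  ultimately show ?thesis
    using x unfolding energy_on_probs_def by auto
qed

end

theory Submission
  imports Defs
begin

text \<open>
  Write \<open>v\<^sub>n = n \<beta>\<^sub>n\<close>. On the exponential scale \<open>v\<^sub>n\<close> it suffices to bound the unnormalised measure
  \<open>\<gamma>\<^sub>n\<close> from below by \<open>exp (- v\<^sub>n F \<mu>)\<close> near every \<open>\<mu>\<close>, and from above by \<open>exp (- v\<^sub>n inf F)\<close> on closed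
  sets; the normalising constant is the case of the whole space.

  Lower bound: replace \<open>\<pi>\<^sup>n\<close> by \<open>\<mu>\<^sup>n\<close> at the cost of the density, use Jensen's inequality, and the law
  of large numbers to see that \<open>\<mu>\<^sup>n\<close> is concentrated near \<open>\<mu>\<close>. The entropy enters with weight
  \<open>n / v\<^sub>n\<close>, which vanishes at zero temperature; there the regularity assumption reduces the general
  case to measures of finite entropy.

  Upper bound: near \<open>\<mu>\<close>, the lower limit assumption bounds the energy from below, and the
  Donsker--Varadhan formula together with Chernoff's inequality bounds the \<open>\<pi>\<^sup>n\<close>-probability. The weak
  topology is second countable, so a closed set is covered by countably many such neighbourhoods.
  Finitely many suffice up to a negligible event, at positive temperature by exponential tightness
  and Prokhorov's theorem, at zero temperature by confinement.
\<close>

section \<open>The weak topology on a Polish space\<close>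

text \<open>Both regimes run through one parameter, the limit \<kappa> of \<open>1 / b n\<close>,
  which is also the limit of n / \<open>v\<^sub>n\<close>; zero temperature is \<kappa> = 0. The
  local bounds treat every such \<kappa> alike, and only compactness separates the regimes. An event
  of \<open>\<pi>\<^sup>n\<close>-probability exp (- n L) is negligible at speed
  \<open>v\<^sub>n\<close> as long as \<open>b n\<close> stays bounded, because L can be chosen
  large; once \<open>b n\<close> tends to infinity no fixed L suffices, and compactness has to come
  from the energy itself.

  The space of measures carries no metric here. One countable family of Lipschitz functions does the
  work instead: it generates the topology, makes the empirical measure measurable, reduces
  convergence to countably many integrals and supplies countable covers. Compact subsets of M are
  replaced by bounds, at every scale \<open>(1/2)^k\<close>, on the index of the first dense point
  near x. Such bounds describe totally bounded sets, and completeness makes the centres named by a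
  random sequence of indices converge.\<close>

lemma borel_probs_iff: "\<mu> \<in> borel_probs \<longleftrightarrow> prob_space \<mu> \<and> sets \<mu> = sets borel"
  by (auto simp: space_prob_algebra)

lemma borel_probs_space: "\<mu> \<in> borel_probs \<Longrightarrow> space \<mu> = UNIV"
  using sets_eq_imp_space_eq[of \<mu> borel] by (auto simp: borel_probs_iff)

lemma borel_probs_measurable [simp]:
  "\<mu> \<in> borel_probs \<Longrightarrow> measurable \<mu> N = measurable borel N"
  by (intro measurable_cong_sets) (auto simp: borel_probs_iff)

lemma borel_probs_integrable:
  fixes f :: "'a::topological_space \<Rightarrow> real"
  assumes "\<mu> \<in> borel_probs" "f \<in> borel_measurable borel" "\<And>x. \<bar>f x\<bar> \<le> B"
  shows "integrable \<mu> f"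
proof -
  interpret prob_space \<mu> using assms by (simp add: borel_probs_iff)
  show ?thesis using assms by (intro integrable_const_bound[where B = B]) auto
qed

section \<open>Countably many Lipschitz test functions\<close>

definition dense_seq :: "nat \<Rightarrow> 'a::polish_space" where
  "dense_seq = (SOME q. closure (range q) = UNIV)"

lemma dense_seq: "closure (range (dense_seq :: nat \<Rightarrow> 'a::polish_space)) = UNIV"
proof -
  obtain D :: "'a set" where D: "countable D" "\<And>X. open X \<Longrightarrow> X \<noteq> {} \<Longrightarrow> \<exists>d\<in>D. d \<in> X"
    by (rule countable_dense_setE) auto
  have "D \<noteq> {}" using D(2)[of UNIV] by auto
  moreover have "x \<in> closure D" for x
    unfolding closure_approachable
  proof (intro allI impI)
    fix e :: real assume "e > 0"
    then show "\<exists>y\<in>D. dist y x < e"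
      using D(2)[of "ball x e"] by (auto simp: dist_commute)
  qed
  ultimately have "closure (range (from_nat_into D)) = UNIV"
    using D(1) by (auto simp: range_from_nat_into)
  then show ?thesis
    unfolding dense_seq_def by (rule someI[where P = "\<lambda>q. closure (range q) = UNIV"])
qed

lemma dense_seq_close:
  assumes "e > 0" obtains i where "dist x (dense_seq i) < e"
proof -
  have "x \<in> closure (range dense_seq)" by (simp add: dense_seq)
  then show ?thesis using assms that unfolding closure_approachable by (force simp: dist_commute)
qed

text \<open>A continuous function \<open>f \<ge> 0\<close> is the pointwise supremum of the plateaus below it. Hence the integrals
  of the countably many functions \<open>plateau_max l\<close>, all of them Lipschitz, determine the weak topology.\<close>

definition plateau :: "nat \<times> rat \<times> rat \<Rightarrow> 'a::polish_space \<Rightarrow> real" where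
  "plateau = (\<lambda>(i, r, c) x.
     real_of_rat c * min 1 (max 0 (2 - dist x (dense_seq i) / real_of_rat r)))"

definition plateau_max :: "(nat \<times> rat \<times> rat) list \<Rightarrow> 'a::polish_space \<Rightarrow> real" where
  "plateau_max l x = foldr (\<lambda>p. max (plateau p x)) l 0"

lemma plateau_max_simps [simp]:
  "plateau_max [] x = 0" "plateau_max (p # l) x = max (plateau p x) (plateau_max l x)"
  by (auto simp: plateau_max_def)

lemma plateau_max_le_iff:
  "plateau_max l x \<le> t \<longleftrightarrow> 0 \<le> t \<and> (\<forall>p\<in>set l. plateau p x \<le> t)"
  by (induction l) auto

lemma plateau_max_nonneg [simp]: "0 \<le> plateau_max l x"
  by (induction l) auto

lemma plateau_max_ge: "p \<in> set l \<Longrightarrow> plateau p x \<le> plateau_max l x"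
  by (induction l) auto

lemma abs_min_max_diff:
  fixes a b c :: real
  shows "\<bar>max c a - max c b\<bar> \<le> \<bar>a - b\<bar>" "\<bar>min c a - min c b\<bar> \<le> \<bar>a - b\<bar>"
    "\<bar>max a a' - max b b'\<bar> \<le> max \<bar>a - b\<bar> \<bar>a' - b'\<bar>"
  by (auto simp: max_def min_def)

text \<open>No sign is imposed on r and c. For r = 0 division by zero gives 0, so the plateau is the
  constant c and the Lipschitz constant |c| / |r| = 0 is still correct.\<close>

lemma plateau_Lipschitz:
  "\<exists>L. \<forall>x y. \<bar>plateau p x - plateau p y\<bar> \<le> L * dist x y"
proof -
  obtain i r c where p: "p = (i, r, c)" by (cases p)
  let ?h = "\<lambda>x::'a. min 1 (max 0 (2 - dist x (dense_seq i) / real_of_rat r))"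
  have "\<bar>plateau p x - plateau p y\<bar> \<le> (\<bar>real_of_rat c\<bar> / \<bar>real_of_rat r\<bar>) * dist x y"
    for x y :: 'a
  proof -
    have "\<bar>?h x - ?h y\<bar> \<le> \<bar>(dist y (dense_seq i) - dist x (dense_seq i)) / real_of_rat r\<bar>"
      by (rule order_trans[OF abs_min_max_diff(2) order_trans[OF abs_min_max_diff(1)]])
        (simp add: diff_divide_distrib)
    also have "\<dots> \<le> dist x y / \<bar>real_of_rat r\<bar>"
      unfolding abs_divide
      by (intro divide_right_mono)
        (use dist_triangle[of x "dense_seq i" y] dist_triangle[of y "dense_seq i" x]
         in \<open>auto simp: dist_commute\<close>)
    finally have "\<bar>real_of_rat c\<bar> * \<bar>?h x - ?h y\<bar> \<le> \<bar>real_of_rat c\<bar> * (dist x y / \<bar>real_of_rat r\<bar>)"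
      by (rule mult_left_mono) simp
    then show ?thesis
      by (simp add: p plateau_def abs_mult flip: right_diff_distrib)
  qed
  then show ?thesis by blast
qed

text \<open>The maximum of two functions inherits the larger Lipschitz constant. The constant later
  bounds the error of replacing a point by the centre of a small ball containing it.\<close>

lemma plateau_max_Lipschitz:
  obtains L where "L \<ge> 0" "\<And>x y :: 'a::polish_space. \<bar>plateau_max l x - plateau_max l y\<bar> \<le>
      L * dist x y"
proof -
  have "\<exists>L\<ge>0. \<forall>x y :: 'a. \<bar>plateau_max l x - plateau_max l y\<bar> \<le> L * dist x y"
  proof (induction l)
    case (Cons p l)
    then obtain L where L: "L \<ge> 0" "\<And>x y :: 'a. \<bar>plateau_max l x - plateau_max l y\<bar> \<le> L * dist x y"
      by blast
    obtain L' where L': "\<And>x y :: 'a. \<bar>plateau p x - plateau p y\<bar> \<le> L' * dist x y"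
      using plateau_Lipschitz by metis
    have "\<bar>plateau_max (p # l) x - plateau_max (p # l) y\<bar> \<le> max L L' * dist x y" for x y :: 'a
    proof -
      have "L * dist x y \<le> max L L' * dist x y" "L' * dist x y \<le> max L L' * dist x y"
        by (auto intro: mult_right_mono)
      then show ?thesis
        unfolding plateau_max_simps
        by (intro order_trans[OF abs_min_max_diff(3)] max.boundedI)
          (use L(2)[of x y] L'[of x y] in linarith)+
    qed
    then show ?case using L(1) by (intro exI[of _ "max L L'"]) auto
  qed auto
  then show ?thesis using that by blast
qed

lemma plateau_max_bounded: "\<exists>B. \<forall>x. \<bar>plateau_max l x\<bar> \<le> B"
proof -
  have "plateau (i, r, c) x \<le> \<bar>real_of_rat c\<bar>" for i r c and x :: 'a
  proof -
    have "plateau (i, r, c) x \<le>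
        \<bar>real_of_rat c\<bar> * min 1 (max 0 (2 - dist x (dense_seq i) / real_of_rat r))"
      unfolding plateau_def prod.case by (intro mult_right_mono abs_ge_self) auto
    also have "\<dots> \<le> \<bar>real_of_rat c\<bar> * 1"
      by (intro mult_left_mono) auto
    finally show ?thesis by simp
  qed
  then have bd: "plateau p x \<le> \<bar>real_of_rat (snd (snd p))\<bar>" for p and x :: 'a
    by (cases p) auto
  have "plateau_max l x \<le> (\<Sum>p\<leftarrow>l. \<bar>real_of_rat (snd (snd p))\<bar>)" for x :: 'a
  proof (induction l)
    case (Cons p l)
    have "0 \<le> (\<Sum>p\<leftarrow>l. \<bar>real_of_rat (snd (snd p)) :: real\<bar>)"
      by (intro sum_list_nonneg) auto
    then show ?case
      using Cons bd[of p x] abs_ge_zero[of "real_of_rat (snd (snd p)) :: real"]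
      unfolding plateau_max_simps list.map sum_list.Cons by linarith
  qed simp
  then show ?thesis by (metis abs_of_nonneg plateau_max_nonneg)
qed

lemma continuous_plateau_max [continuous_intros]: "continuous_on S (plateau_max l)"
proof -
  obtain L where L: "L \<ge> 0" "\<And>x y::'a. \<bar>plateau_max l x - plateau_max l y\<bar> \<le> L * dist x y"
    using plateau_max_Lipschitz[where l = l] by blast
  have "L-lipschitz_on S (plateau_max l)"
    using L by (intro lipschitz_onI) (auto simp: dist_real_def)
  then show ?thesis by (rule lipschitz_on_continuous_on)
qed

lemma borel_measurable_plateau_max [measurable]: "plateau_max l \<in> borel_measurable borel"
  by (intro borel_measurable_continuous_onI continuous_plateau_max)

text \<open>For r > 0 the plateau equals c on the ball of radius r around the dense point i and
  vanishes outside radius 2 r. With x in the smaller ball, 3 r < e keeps the larger ball inside the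
  region where f exceeds c; elsewhere f \<ge> 0 suffices.\<close>

lemma plateau_approx:
  fixes f :: "'a::polish_space \<Rightarrow> real"
  assumes "continuous_on UNIV f" "\<And>x. 0 \<le> f x" "0 \<le> t" "t < f x"
  obtains p where "\<And>y. plateau p y \<le> f y" "t < plateau p x"
proof -
  obtain c where c: "t < real_of_rat c" "real_of_rat c < f x"
    using of_rat_dense[OF assms(4)] by blast
  have "open {y. real_of_rat c < f y}"
    using assms(1) by (intro open_Collect_less) auto
  then obtain e where e: "e > 0" "\<And>y. dist y x < e \<Longrightarrow> real_of_rat c < f y"
    using c(2) unfolding open_dist by auto
  obtain r where r: "0 < real_of_rat r" "real_of_rat r < e / 3"
    using of_rat_dense[of 0 "e / 3"] e(1) by auto
  obtain i where i: "dist x (dense_seq i) < real_of_rat r"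
    using dense_seq_close r(1) by blast
  have "plateau (i, r, c) y \<le> f y" for y
  proof (cases "dist y (dense_seq i) < 2 * real_of_rat r")
    case True
    have "dist y x < e"
      using True i r(2) dist_triangle2[of y x "dense_seq i"] by simp
    moreover have "plateau (i, r, c) y \<le> real_of_rat c * 1"
      unfolding plateau_def prod.case
      using less_imp_le[OF le_less_trans[OF assms(3) c(1)]] by (intro mult_left_mono) auto
    ultimately show ?thesis using e(2)[of y] by simp
  next
    case False
    then have "2 - dist y (dense_seq i) / real_of_rat r \<le> 0"
      using r(1) by (simp add: field_simps)
    then show ?thesis using assms(2) by (simp add: plateau_def max_absorb1)
  qed
  moreover have "t < plateau (i, r, c) x"
  proof -
    have "dist x (dense_seq i) / real_of_rat r < 1"
      using i r(1) by (simp add: field_simps)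
    then show ?thesis using c by (simp add: plateau_def)
  qed
  ultimately show ?thesis using that by blast
qed

text \<open>Those among the first k plateaus that lie below f have a maximum increasing to f
  pointwise; dominated convergence, with the constant bound B, carries this to the integrals. The
  countable family does not depend on f.\<close>

lemma integral_plateau_max_approx:
  fixes f :: "'a::polish_space \<Rightarrow> real"
  assumes \<mu>: "\<mu> \<in> borel_probs" and f: "continuous_on UNIV f" "\<And>x. 0 \<le> f x" "\<And>x. f x \<le> B"
    and t: "t < (\<integral>x. f x \<partial>\<mu>)"
  obtains l where "\<And>x. plateau_max l x \<le> f x" "t < (\<integral>x. plateau_max l x \<partial>\<mu>)"
proof -
  define l where
    "l k = filter (\<lambda>p. \<forall>x. plateau p x \<le> f x) (map from_nat [0..<k])" for k
  have le: "plateau_max (l k) x \<le> f x" for k x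
    using f(2) by (auto simp: plateau_max_le_iff l_def)
  have lim: "(\<lambda>k. plateau_max (l k) x) \<longlonglongrightarrow> f x" for x
  proof (rule order_tendstoI)
    fix s assume s: "s < f x"
    show "\<forall>\<^sub>F k in sequentially. s < plateau_max (l k) x"
    proof (cases "s < 0")
      case True
      then show ?thesis
        by (intro always_eventually allI less_le_trans[OF _ plateau_max_nonneg])
    next
      case False
      then have "0 \<le> s" by simp
      then obtain p where p: "\<And>y. plateau p y \<le> f y" "s < plateau p x"
        using plateau_approx[OF f(1,2) _ s] by blast
      have "p \<in> set (l k)" if "k > to_nat p" for k
        using that p(1) by (auto simp: l_def intro!: image_eqI[of _ _ "to_nat p"])
      then have "s < plateau_max (l k) x" if "k > to_nat p" for k
        using that less_le_trans[OF p(2) plateau_max_ge[of p "l k" x]] by blast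
      then show ?thesis
        unfolding eventually_sequentially by (metis Suc_le_eq)
    qed
  next
    fix s assume "f x < s"
    then show "\<forall>\<^sub>F k in sequentially. plateau_max (l k) x < s"
      by (intro always_eventually) (blast intro: le_less_trans[OF le])
  qed
  interpret prob_space \<mu> using \<mu> by (simp add: borel_probs_iff)
  have "(\<lambda>k. \<integral>x. plateau_max (l k) x \<partial>\<mu>) \<longlonglongrightarrow> (\<integral>x. f x \<partial>\<mu>)"
  proof (rule integral_dominated_convergence[where w = "\<lambda>_. B"])
    show "f \<in> borel_measurable \<mu>" using \<mu> f(1) by (simp add: borel_measurable_continuous_onI)
    show "AE x in \<mu>. norm (plateau_max (l k) x) \<le> B" for k
      using order_trans[OF le f(3)] by auto
  qed (use \<mu> lim in auto)
  from order_tendstoD(1)[OF this t] obtain k where "t < (\<integral>x. plateau_max (l k) x \<partial>\<mu>)"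
    unfolding eventually_sequentially by blast
  with that le show ?thesis by blast
qed

section \<open>A countable base of the weak topology\<close>

definition weak_subbasic :: "(nat \<times> rat \<times> rat) list \<times> rat \<Rightarrow> 'a::polish_space measure set" where
  "weak_subbasic = (\<lambda>(l, q). {\<nu> \<in> borel_probs. real_of_rat q < (\<integral>x. plateau_max l x \<partial>\<nu>)})"

lemma openin_weak_topology_integral:
  fixes f :: "'a::topological_space \<Rightarrow> real"
  assumes "continuous_on UNIV f" "bounded (range f)" "open U"
  shows "openin weak_topology {\<mu> \<in> borel_probs. (\<integral>x. f x \<partial>\<mu>) \<in> U}"
  unfolding weak_topology_def using assms by (intro topology_generated_by_Basis) blast

lemma openin_weak_subbasic: "openin weak_topology (weak_subbasic p)"
proof -
  obtain l q where p: "p = (l, q)" by (cases p)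
  have "bounded (range (plateau_max l :: 'a \<Rightarrow> real))"
    using plateau_max_bounded[of l] by (auto simp: bounded_iff)
  from openin_weak_topology_integral[OF continuous_plateau_max this, of "{real_of_rat q<..}"]
  show ?thesis by (simp add: p weak_subbasic_def)
qed

text \<open>Adding B makes f nonnegative and shifts every integral by exactly B, since all measures
  have mass 1. A lower bound on the integral of a plateau maximum below f + B then passes to f by
  monotonicity. Half-lines bounded from below are enough for a subbasis because upper bounds come
  from -f.\<close>

lemma weak_subbasic_integral_greater:
  fixes f :: "'a::polish_space \<Rightarrow> real"
  assumes \<mu>: "\<mu> \<in> borel_probs" and f: "continuous_on UNIV f" "\<And>x. \<bar>f x\<bar> \<le> B"
    and t: "t < (\<integral>x. f x \<partial>\<mu>)"
  obtains p where "\<mu> \<in> weak_subbasic p" "weak_subbasic p \<subseteq> {\<nu> \<in> borel_probs. t < (\<integral>x. f x \<partial>\<nu>)}"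
proof -
  have int: "integrable \<nu> f" if "\<nu> \<in> borel_probs" for \<nu>
    using that f by (intro borel_probs_integrable borel_measurable_continuous_onI)
  have eq: "(\<integral>x. f x + B \<partial>\<nu>) = (\<integral>x. f x \<partial>\<nu>) + B" if "\<nu> \<in> borel_probs" for \<nu>
  proof -
    interpret prob_space \<nu> using that by (simp add: borel_probs_iff)
    show ?thesis using int[OF that] by (simp add: prob_space)
  qed
  have bd: "0 \<le> f x + B" "f x + B \<le> 2 * B" for x
    using f(2)[of x] by auto
  have "continuous_on UNIV (\<lambda>x. f x + B)"
    using f(1) by (intro continuous_intros)
  from integral_plateau_max_approx[OF \<mu> this bd, of "t + B"] t eq[OF \<mu>]
  obtain l where l: "\<And>x. plateau_max l x \<le> f x + B" "t + B < (\<integral>x. plateau_max l x \<partial>\<mu>)"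
    by auto
  obtain q where q: "t + B < real_of_rat q" "real_of_rat q < (\<integral>x. plateau_max l x \<partial>\<mu>)"
    using of_rat_dense[OF l(2)] by blast
  obtain B' where B': "\<And>x::'a. \<bar>plateau_max l x\<bar> \<le> B'"
    using plateau_max_bounded by blast
  have "t < (\<integral>x. f x \<partial>\<nu>)" if \<nu>: "\<nu> \<in> borel_probs" "real_of_rat q < (\<integral>x. plateau_max l x \<partial>\<nu>)" for \<nu>
  proof -
    interpret prob_space \<nu> using \<nu> by (simp add: borel_probs_iff)
    have "(\<integral>x. plateau_max l x \<partial>\<nu>) \<le> (\<integral>x. f x + B \<partial>\<nu>)"
      using \<nu>(1) l(1) B' int[OF \<nu>(1)]
      by (intro integral_mono) (auto intro!: borel_probs_integrable)
    then show ?thesis using eq[OF \<nu>(1)] q(1) \<nu>(2) by simp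
  qed
  then show ?thesis
    using q(2) \<mu> by (intro that[of "(l, q)"]) (auto simp: weak_subbasic_def)
qed

text \<open>The index type is countable, so \<open>to_nat\<close> and \<open>from_nat\<close>
  enumerate the base; neighbourhoods can later be picked by code instead of by choice.\<close>

definition weak_basic :: "((nat \<times> rat \<times> rat) list \<times> rat) list \<Rightarrow> 'a::polish_space measure set" where
  "weak_basic ps = borel_probs \<inter> (\<Inter>p\<in>set ps. weak_subbasic p)"

lemma openin_weak_basic: "openin weak_topology (weak_basic ps :: 'a::polish_space measure set)"
proof (induction ps)
  case Nil
  then show ?case
    using openin_topspace[of "weak_topology :: 'a measure topology"] by (simp add: weak_basic_def)
next
  case (Cons p ps)
  have "weak_basic (p # ps) = weak_subbasic p \<inter> (weak_basic ps :: 'a measure set)"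
    by (auto simp: weak_basic_def)
  then show ?case using openin_Int[OF openin_weak_subbasic Cons] by simp
qed

text \<open>An interval around the integral of f is cut out by one lower bound for f and one for -f,
  so each generator of the topology contains a basic set around each of its points; finite
  intersections and unions preserve this.\<close>

lemma weak_basic_nhd:
  fixes U :: "'a::polish_space measure set"
  assumes "openin weak_topology U" "\<mu> \<in> U"
  obtains ps where "\<mu> \<in> weak_basic ps" "weak_basic ps \<subseteq> U"
proof -
  let ?S = "{{\<mu> \<in> borel_probs. (\<integral>x. f x \<partial>\<mu>) \<in> U} | (f :: 'a \<Rightarrow> real) U.
        continuous_on UNIV f \<and> bounded (range f) \<and> open U}"
  have "generate_topology_on ?S U"
    using assms(1) unfolding weak_topology_def openin_topology_generated_by_iff .
  then have "\<forall>\<mu>\<in>U. \<exists>ps. \<mu> \<in> weak_basic ps \<and> weak_basic ps \<subseteq> U"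
  proof (induction rule: generate_topology_on.induct)
    case (Int a b)
    show ?case
    proof
      fix \<mu> assume "\<mu> \<in> a \<inter> b"
      with Int.IH obtain ps qs where "\<mu> \<in> weak_basic ps" "weak_basic ps \<subseteq> a"
        "\<mu> \<in> weak_basic qs" "weak_basic qs \<subseteq> b" by (metis IntE)
      then show "\<exists>ps. \<mu> \<in> weak_basic ps \<and> weak_basic ps \<subseteq> a \<inter> b"
        by (intro exI[of _ "ps @ qs"]) (auto simp: weak_basic_def)
    qed
  next
    case (UN K)
    then show ?case by (meson Union_upper UnionE subset_trans)
  next
    case (Basis s)
    then obtain f :: "'a \<Rightarrow> real" and U where s: "s = {\<mu> \<in> borel_probs. (\<integral>x. f x \<partial>\<mu>) \<in> U}"
      "continuous_on UNIV f" "bounded (range f)" "open U" by blast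
    obtain B where B: "\<And>x. \<bar>f x\<bar> \<le> B" using s(3) by (auto simp: bounded_iff)
    show ?case
    proof
      fix \<mu> assume "\<mu> \<in> s"
      then have \<mu>: "\<mu> \<in> borel_probs" and "(\<integral>x. f x \<partial>\<mu>) \<in> U" by (auto simp: s)
      then obtain e where e: "e > 0" "\<And>y. \<bar>y - (\<integral>x. f x \<partial>\<mu>)\<bar> < e \<Longrightarrow> y \<in> U"
        using s(4) unfolding open_dist dist_real_def by blast
      obtain p where p: "\<mu> \<in> weak_subbasic p"
        "weak_subbasic p \<subseteq> {\<nu> \<in> borel_probs. (\<integral>x. f x \<partial>\<mu>) - e < (\<integral>x. f x \<partial>\<nu>)}"
        using weak_subbasic_integral_greater[OF \<mu> s(2) B, of "(\<integral>x. f x \<partial>\<mu>) - e"] e(1) by auto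
      have "continuous_on UNIV (\<lambda>x. - f x)" "\<And>x. \<bar>- f x\<bar> \<le> B"
        using s(2) B by (auto intro: continuous_intros)
      from weak_subbasic_integral_greater[OF \<mu> this, of "- (\<integral>x. f x \<partial>\<mu>) - e"] e(1)
      obtain p' where p': "\<mu> \<in> weak_subbasic p'"
        "weak_subbasic p' \<subseteq> {\<nu> \<in> borel_probs. - (\<integral>x. f x \<partial>\<mu>) - e < (\<integral>x. - f x \<partial>\<nu>)}"
        by auto
      have "weak_basic [p, p'] \<subseteq> s"
      proof
        fix \<nu> :: "'a measure" assume "\<nu> \<in> weak_basic [p, p']"
        then have "\<nu> \<in> borel_probs" "(\<integral>x. f x \<partial>\<mu>) - e < (\<integral>x. f x \<partial>\<nu>)"
          "- (\<integral>x. f x \<partial>\<mu>) - e < - (\<integral>x. f x \<partial>\<nu>)"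
          using p(2) p'(2) by (auto simp: weak_basic_def)
        then show "\<nu> \<in> s" unfolding s(1) using e(2)[of "\<integral>x. f x \<partial>\<nu>"] by auto
      qed
      then show "\<exists>ps. \<mu> \<in> weak_basic ps \<and> weak_basic ps \<subseteq> s"
        using p(1) p'(1) \<mu> by (intro exI[of _ "[p, p']"]) (auto simp: weak_basic_def)
    qed
  qed simp
  then show ?thesis using assms(2) that by blast
qed

text \<open>Subbasic sets come from lower half-lines, so one-sided control of the integrals
  suffices. Upper control of a bounded f is hidden in it, through the plateau maxima below B -
  f.\<close>

lemma limitin_weak_topologyI:
  fixes \<mu> :: "'a::polish_space measure"
  assumes \<mu>: "\<mu> \<in> borel_probs" "\<And>n. \<nu> n \<in> borel_probs"
    and ev: "\<And>l t. t < (\<integral>x. plateau_max l x \<partial>\<mu>) \<Longrightarrow>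
      \<forall>\<^sub>F n in sequentially. t < (\<integral>x. plateau_max l x \<partial>\<nu> n)"
  shows "limitin weak_topology \<nu> \<mu> sequentially"
  unfolding limitin_def
proof (intro conjI allI impI)
  fix U assume U: "openin weak_topology U \<and> \<mu> \<in> U"
  obtain ps where ps: "\<mu> \<in> weak_basic ps" "weak_basic ps \<subseteq> U"
    using weak_basic_nhd[of U \<mu>] U by metis
  have "\<forall>\<^sub>F n in sequentially. \<forall>p\<in>set ps. \<nu> n \<in> weak_subbasic p"
  proof (intro eventually_ball_finite ballI finite_set)
    fix p assume "p \<in> set ps"
    then have "\<mu> \<in> weak_subbasic p" using ps(1) by (auto simp: weak_basic_def)
    then show "\<forall>\<^sub>F n in sequentially. \<nu> n \<in> weak_subbasic p"
      using ev \<mu>(2) by (auto simp: weak_subbasic_def split: prod.splits)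
  qed
  then show "\<forall>\<^sub>F n in sequentially. \<nu> n \<in> U"
    by eventually_elim (use ps(2) \<mu>(2) in \<open>auto simp: weak_basic_def\<close>)
qed (use \<mu> in simp)

section \<open>Tight sequences of measures\<close>

text \<open>A Skorokhod representation: \<open>[0, 1)\<close> is cut into intervals of lengths \<open>p w\<close>, nested along the words,
  and \<open>W k u\<close> is the word of length \<open>k\<close> whose interval contains \<open>u\<close>. Words grow at the head.\<close>

lemma interval_words:
  fixes p :: "nat list \<Rightarrow> real"
  assumes nonneg: "\<And>w. 0 \<le> p w" and Nil: "p [] = 1" and sums: "\<And>w. (\<lambda>i. p (i # w)) sums p w"
  obtains W :: "nat \<Rightarrow> real \<Rightarrow> nat list"
  where "\<And>u. W 0 u = []" "\<And>k u. \<exists>i. W (Suc k) u = i # W k u"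
    "\<And>k u. u \<in> {0..<1} \<Longrightarrow> 0 < p (W k u)"
    "\<And>w. {u \<in> {0..<1}. W (length w) u = w} \<in> sets borel"
    "\<And>w. measure lborel {u \<in> {0..<1}. W (length w) u = w} = p w"
proof -
  define left where "left = rec_list 0 (\<lambda>i w s. s + (\<Sum>j<i. p (j # w)))"
  have left_simps: "left [] = 0" "left (i # w) = left w + (\<Sum>j<i. p (j # w))" for i w
    by (auto simp: left_def)
  \<comment> \<open>\<open>left w\<close> is the left end of the interval of w, and the intervals of
    its extensions are laid side by side from there. The next letter is the first one whose interval
    ends beyond u.\<close>
  define W where
    "W k u = rec_nat [] (\<lambda>k w. (LEAST i. u < left w + (\<Sum>j<Suc i. p (j # w))) # w) k"
    for k :: nat and u
  have W0: "W 0 u = []" for u by (simp add: W_def)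
  have WS: "W (Suc k) u = (LEAST i. u < left (W k u) + (\<Sum>j<Suc i. p (j # W k u))) # W k u" for k u
    by (simp add: W_def)
  have len: "length (W k u) = k" for k u
    by (induction k) (simp_all add: W0 WS)
  have sum_le: "(\<Sum>j<m. p (j # w)) \<le> p w" for m w
    using sum_le_suminf[of "\<lambda>i. p (i # w)" "{..<m}"] sums[of w] nonneg
    by (auto simp: sums_iff)
  have mono: "(\<Sum>j<m. p (j # w)) \<le> (\<Sum>j<m'. p (j # w))" if "m \<le> m'" for m m' w
    using that nonneg by (intro sum_mono2) auto
  have bounds: "left (W k u) \<le> u \<and> u < left (W k u) + p (W k u)" if u: "u \<in> {0..<1}" for k u
  proof (induction k)
    case 0
    then show ?case using u by (simp add: W0 left_simps Nil)
  next
    case (Suc k)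
    define w where "w = W k u"
    \<comment> \<open>The extensions exhaust the interval of w in the limit and u lies strictly
      below its right end, so a finite partial sum passes u and the \<open>LEAST\<close> in
      \<open>W\<close> is attained.\<close>
    have "\<forall>\<^sub>F m in sequentially. u - left w < (\<Sum>j<m. p (j # w))"
      using sums[of w] Suc unfolding sums_def w_def by (intro order_tendstoD(1)) auto
    then obtain m where "u - left w < (\<Sum>j<m. p (j # w))"
      unfolding eventually_sequentially by blast
    then have "u < left w + (\<Sum>j<Suc m. p (j # w))"
      using nonneg[of "m # w"] by simp
    then have least: "u < left w +
        (\<Sum>j<Suc (LEAST i. u < left w + (\<Sum>j<Suc i. p (j # w))). p (j # w))"
      by (rule LeastI)
    define i where "i = (LEAST i. u < left w + (\<Sum>j<Suc i. p (j # w)))"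
    have "left w + (\<Sum>j<i. p (j # w)) \<le> u"
    proof (cases i)
      case 0
      then show ?thesis using Suc by (simp add: w_def)
    next
      case (Suc i')
      then have "i' < (LEAST i. u < left w + (\<Sum>j<Suc i. p (j # w)))" by (simp add: i_def)
      from not_less_Least[OF this] Suc show ?thesis by simp
    qed
    moreover have "W (Suc k) u = i # w" unfolding WS i_def w_def ..
    ultimately show ?case
      using least unfolding i_def[symmetric] by (simp add: left_simps)
  qed
  have W_iff: "W (length w) u = w \<longleftrightarrow> left w \<le> u \<and> u < left w + p w"
    if u: "u \<in> {0..<1}" for w u
  proof
    assume "W (length w) u = w"
    then show "left w \<le> u \<and> u < left w + p w" using bounds[OF u, of "length w"] by simp
  next
    assume "left w \<le> u \<and> u < left w + p w"
    then show "W (length w) u = w"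
    proof (induction w)
      case (Cons i w)
      have "0 \<le> (\<Sum>j<i. p (j # w))" using nonneg by (intro sum_nonneg) auto
      moreover have "left (i # w) + p (i # w) \<le> left w + p w"
        using sum_le[where m = "Suc i" and w = w] by (simp add: left_simps)
      ultimately have Ww: "W (length w) u = w"
        using Cons by (auto simp: left_simps)
      have "(LEAST j. u < left w + (\<Sum>j<Suc j. p (j # w))) = i"
      proof (rule Least_equality)
        show "u < left w + (\<Sum>j<Suc i. p (j # w))"
          using Cons.prems by (simp add: left_simps)
      next
        fix j assume j: "u < left w + (\<Sum>j<Suc j. p (j # w))"
        show "i \<le> j"
        proof (rule ccontr)
          assume "\<not> i \<le> j"
          then have "(\<Sum>j<Suc j. p (j # w)) \<le> (\<Sum>j<i. p (j # w))" by (intro mono) simp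
          then show False using j Cons.prems by (simp add: left_simps)
        qed
      qed
      then show ?case by (simp only: length_Cons WS Ww)
    qed (simp add: W0)
  qed
  have left_bounds: "0 \<le> left w \<and> left w + p w \<le> 1" for w
  proof (induction w)
    case (Cons i w)
    have "0 \<le> (\<Sum>j<i. p (j # w))" using nonneg by (intro sum_nonneg) auto
    then show ?case using Cons sum_le[where m = "Suc i" and w = w] by (simp add: left_simps)
  qed (simp add: left_simps Nil)
  have eq: "{u \<in> {0..<1}. W (length w) u = w} = {left w..<left w + p w}" for w
    using W_iff[of _ w] left_bounds[of w] by auto
  show ?thesis
  proof (rule that[of W])
    show "0 < p (W k u)" if "u \<in> {0..<1}" for k u
      using bounds[OF that, of k] by simp
    show "\<exists>i. W (Suc k) u = i # W k u" for k u unfolding WS by blast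
    show "{u \<in> {0..<1}. W (length w) u = w} \<in> sets borel" for w
      unfolding eq by simp
    show "measure lborel {u \<in> {0..<1}. W (length w) u = w} = p w" for w
      unfolding eq using nonneg[of w] by simp
  qed (fact W0)
qed

text \<open>The points with \<open>addr k x \<le> N k\<close> for all k form a totally bounded set,
  so tail bounds on addresses express tightness without naming compact sets.\<close>

definition addr :: "nat \<Rightarrow> 'a::polish_space \<Rightarrow> nat" where
  "addr k x = (LEAST i. dist x (dense_seq i) < (1/2)^k)"

lemma addr_close: "dist x (dense_seq (addr k x)) < (1/2)^k"
proof -
  obtain i where "dist x (dense_seq i) < (1/2)^k" by (rule dense_seq_close[of "(1/2)^k" x]) auto
  then show ?thesis unfolding addr_def by (rule LeastI)
qed

text \<open>The dense point found at the finer scale also qualifies at the coarser one. Thus a tail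
  bound at a fine scale controls all coarser scales.\<close>

lemma addr_mono: "k \<le> k' \<Longrightarrow> addr k x \<le> addr k' x"
  unfolding addr_def[of k]
  by (rule Least_le, rule less_le_trans[OF addr_close]) (auto intro: power_decreasing)

lemma measurable_addr [measurable]: "addr k \<in> measurable borel (count_space UNIV)"
  unfolding addr_def by measurable

text \<open>The finest address, at scale k - 1 for a word of length k, stands at the head, in
  agreement with the direction in which words grow in \<open>interval_words\<close>.\<close>

fun word :: "nat \<Rightarrow> 'a::polish_space \<Rightarrow> nat list" where
  "word 0 x = []"
| "word (Suc k) x = addr k x # word k x"

lemma word_vimage_measurable [measurable]: "{x. word k x = w} \<in> sets borel"
proof (induction k arbitrary: w)
  case (Suc k)
  have "{x::'a. word (Suc k) x = w} =
      (case w of [] \<Rightarrow> {} | i # v \<Rightarrow> {x. addr k x = i} \<inter> {x. word k x = v})"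
    by (auto split: list.splits)
  also have "\<dots> \<in> sets borel"
    using Suc by (cases w) (auto intro!: sets.Int measurable_equality_set simp: pred_def)
  finally show ?case .
qed auto

lemma length_word [simp]: "length (word k x) = k"
  by (induction k) auto

text \<open>Tychonoff's theorem makes the product of intervals compact. The index type is countable,
  so the product is metrizable and compactness yields convergent subsequences; this stands in for a
  diagonal argument.\<close>

lemma pointwise_convergent_subsequence:
  fixes P :: "nat \<Rightarrow> 'i::countable \<Rightarrow> real"
  assumes "\<And>n i. P n i \<in> {a..b}"
  obtains r p where "strict_mono r" "\<And>i. (\<lambda>n. P (r n) i) \<longlonglongrightarrow> p i"
proof -
  have "compact (PiE UNIV (\<lambda>_::'i. {a..b}))"
    using compactin_PiE[of "\<lambda>_::'i. euclidean :: real topology" UNIV "\<lambda>_. {a..b}"]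
    by (simp add: euclidean_product_topology)
  moreover have "P n \<in> PiE UNIV (\<lambda>_::'i. {a..b})" for n using assms by auto
  ultimately obtain p r where "strict_mono r" "(P \<circ> r) \<longlonglongrightarrow> p"
    unfolding compact_eq_seq_compact_metric seq_compact_def by metis
  moreover have "(\<lambda>n. P (r n) i) \<longlonglongrightarrow> p i" for i
    using continuous_on_tendsto_compose[OF continuous_on_product_coordinates, OF \<open>(P \<circ> r) \<longlonglongrightarrow> p\<close>, of
        i]
    by simp
  ultimately show ?thesis using that by blast
qed

text \<open>The sequential form of Prokhorov's theorem. Along a subsequence the probabilities of all words
  converge, and by tightness no mass is lost between words of length \<open>k\<close> and \<open>k + 1\<close>. The limit is the
  law of \<open>Z u\<close>, the limit of the centres \<open>Y k u\<close> of the balls named by a random word \<open>W\<close>.\<close>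

lemma tight_convergent_subsequence:
  fixes \<nu> :: "nat \<Rightarrow> 'a::polish_space measure"
  assumes \<nu>: "\<And>n. \<nu> n \<in> borel_probs"
    and tight: "\<And>k e. 0 < e \<Longrightarrow> \<exists>N. \<forall>n. measure (\<nu> n) {x. N < addr k x} \<le> e"
  obtains r \<mu> where "strict_mono r" "\<mu> \<in> borel_probs"
    "limitin weak_topology (\<nu> \<circ> r) \<mu> sequentially"
proof -
  have prob: "prob_space (\<nu> n)" and sets [simp]: "sets (\<nu> n) = sets borel" for n
    using \<nu>[of n] by (auto simp: borel_probs_iff)
  define P where "P n w = measure (\<nu> n) {x. word (length w) x = w}" for n w
  have P: "P n w \<in> {0..1}" for n w
    using prob_space.prob_le_1[OF prob] by (auto simp: P_def)
  obtain r p where r: "strict_mono r" and p: "\<And>w. (\<lambda>n. P (r n) w) \<longlonglongrightarrow> p w"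
    using pointwise_convergent_subsequence[of P, OF P] by metis
  have p_nonneg: "0 \<le> p w" for w
    using P by (intro LIMSEQ_le_const[OF p]) auto
  have p_Nil: "p [] = 1"
  proof -
    have "P n [] = 1" for n
      using prob_space.prob_space[OF prob[of n]] borel_probs_space[OF \<nu>[of n]] by (simp add: P_def)
    then show ?thesis using p[of "[]"] by (auto simp: LIMSEQ_const_iff)
  qed
  \<comment> \<open>The defect is the probability that w is followed by an address of at least m,
    hence at most a tail probability of that address.\<close>
  have split: "P n w - (\<Sum>i<m. P n (i # w)) \<in> {0..measure (\<nu> n) {x. m \<le> addr (length w) x}}"
      for n m w
  proof -
    interpret prob_space "\<nu> n" by (rule prob)
    have [simp]: "space (\<nu> n) = UNIV" using \<nu> by (rule borel_probs_space)
    have [measurable]: "{x :: 'a. Q (addr (length w) x) \<and> word (length w) x = w} \<in> sets borel" for Q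
    proof -
      have "{x :: 'a. Q (addr (length w) x) \<and> word (length w) x = w} =
        {x::'a. word (length w) x = w} \<inter> {x. Q (addr (length w) x)}" by auto
      also have "{x::'a. Q (addr (length w) x)} \<in> sets borel"
        using measurable_sets[OF measurable_addr[of "length w"], of "Collect Q"]
        by (simp add: vimage_def)
      then have "{x::'a. word (length w) x = w} \<inter> {x. Q (addr (length w) x)} \<in> sets borel"
        by auto
      finally show ?thesis .
    qed
    have "(\<Sum>i<m. P n (i # w)) =
        measure (\<nu> n) (\<Union>i<m. {x. addr (length w) x = i \<and> word (length w) x = w})"
      by (subst finite_measure_finite_Union)
        (auto simp: P_def disjoint_family_on_def intro!: sum.cong)
    also have "(\<Union>i<m. {x. addr (length w) x = i \<and> word (length w) x = w}) =
        {x::'a. addr (length w) x < m \<and> word (length w) x = w}" by auto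
    finally have "P n w - (\<Sum>i<m. P n (i # w)) =
        measure (\<nu> n) {x. word (length w) x = w} - measure (\<nu> n) {x. addr (length w) x <
            m \<and> word (length w) x = w}"
      by (simp add: P_def)
    also have "\<dots> = measure (\<nu> n) ({x. word (length w) x = w} -
        {x. addr (length w) x < m \<and> word (length w) x = w})"
      by (subst finite_measure_Diff) auto
    also have "{x. word (length w) x = w} - {x. addr (length w) x < m \<and> word (length w) x = w} =
        {x::'a. m \<le> addr (length w) x \<and> word (length w) x = w}" by auto
    finally have "P n w - (\<Sum>i<m. P n (i # w)) =
        measure (\<nu> n) {x. m \<le> addr (length w) x \<and> word (length w) x = w}" .
    moreover have "\<dots> \<le> measure (\<nu> n) {x. m \<le> addr (length w) x}"
      by (intro finite_measure_mono) auto
    ultimately show ?thesis by simp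
  qed
  \<comment> \<open>The tail bound from \<open>tight\<close> is uniform in n, so the defect stays at
    most e / 2 in the limit along r. Without uniformity mass could escape to ever larger
    addresses.\<close>
  have p_sums: "(\<lambda>i. p (i # w)) sums p w" for w
    unfolding sums_def
  proof (rule LIMSEQ_I)
    fix e :: real assume "e > 0"
    then obtain N where N: "\<And>n. measure (\<nu> n) {x. N < addr (length w) x} \<le> e / 2"
      using tight[of "e / 2" "length w"] by auto
    have "norm ((\<Sum>i<m. p (i # w)) - p w) < e" if m: "m \<ge> Suc N" for m
    proof -
      have lim: "(\<lambda>n. P (r n) w - (\<Sum>i<m. P (r n) (i # w))) \<longlonglongrightarrow> p w - (\<Sum>i<m. p (i # w))"
        by (intro tendsto_intros p)
      have up: "P n w - (\<Sum>i<m. P n (i # w)) \<le> e / 2" for n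
      proof -
        interpret prob_space "\<nu> n" by (rule prob)
        have "measure (\<nu> n) {x. m \<le> addr (length w) x} \<le> measure (\<nu> n) {x. N < addr (length w) x}"
          using m by (intro finite_measure_mono) auto
        then show ?thesis using split[of n w m] N[of n] by auto
      qed
      have "p w - (\<Sum>i<m. p (i # w)) \<le> e / 2"
        using up by (intro LIMSEQ_le_const2[OF lim]) auto
      moreover have "0 \<le> p w - (\<Sum>i<m. p (i # w))"
        using split by (intro LIMSEQ_le_const[OF lim]) auto
      ultimately show ?thesis using \<open>e > 0\<close> by simp
    qed
    then show "\<exists>no. \<forall>n\<ge>no. norm ((\<Sum>i<n. p (i # w)) - p w) < e" by blast
  qed
  obtain W :: "nat \<Rightarrow> real \<Rightarrow> nat list" where W0: "\<And>u. W 0 u = []" and WS: "\<And>k u. \<exists>i. W (Suc k) u =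
      i # W k u"
    and W_pos: "\<And>k u. u \<in> {0..<1} \<Longrightarrow> 0 < p (W k u)"
    and W_sets: "\<And>w. {u \<in> {0..<1}. W (length w) u = w} \<in> sets borel"
    and W_measure: "\<And>w. measure lborel {u \<in> {0..<1}. W (length w) u = w} = p w"
    by (rule interval_words[OF p_nonneg p_Nil p_sums]) (rule that)
  have len: "length (W k u) = k" for k u
  proof (induction k)
    case (Suc k) then show ?case using WS[of k u] by auto
  qed (simp add: W0)
  have len_0: "W k u = [] \<longleftrightarrow> k = 0" for k u
    using len[of k u] by (metis length_0_conv)
  \<comment> \<open>The head of a word of length \<open>Suc k\<close> is the address at scale k,
    hence the shift.\<close>
  define Y where "Y k u = (if u \<in>
      {0..<1} then dense_seq (hd (W (Suc k) u)) else dense_seq 0 :: 'a)" for k u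
  have nested: "word j x = W j u" if "word k x = W k u" "j \<le> k" for j k u and x :: 'a
    using that(2,1)
  proof (induction k rule: dec_induct)
    case (step k) then show ?case using WS[of k u] by auto
  qed
  \<comment> \<open>A word of positive limiting probability is the word of some actual point x,
    since otherwise its probability would be 0 for every n. This x is close to all centres named by
    the word, which makes them close to each other.\<close>
  have Y_close: "\<exists>x. \<forall>j<k. dist x (Y j u) < (1/2)^j" if u: "u \<in> {0..<1}" for k u
  proof -
    have "\<exists>x::'a. word k x = W k u"
    proof (rule ccontr)
      assume "\<nexists>x::'a. word k x = W k u"
      then have "{x::'a. word k x = W k u} = {}" by blast
      then have "P n (W k u) = 0" for n by (simp add: P_def len)
      then have "p (W k u) = 0" using p[of "W k u"] by (simp add: LIMSEQ_const_iff)
      then show False using W_pos[OF u, of k] by simp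
    qed
    then obtain x :: 'a where x: "word k x = W k u" by blast
    have "dist x (Y j u) < (1/2)^j" if "j < k" for j
    proof -
      have "W (Suc j) u = addr j x # word j x"
        using nested[OF x, of "Suc j"] that by simp
      then show ?thesis using u addr_close[of x j] by (simp add: Y_def)
    qed
    then show ?thesis by blast
  qed
  have Y_dist: "dist (Y j u) (Y k u) \<le> 2 * (1/2)^j" if "j \<le> k" for j k u
  proof (cases "u \<in> {0..<1}")
    case True
    obtain x where x: "\<And>i. i < Suc k \<Longrightarrow> dist x (Y i u) < (1/2)^i" using Y_close[OF True] by metis
    have "(1/2)^k \<le> ((1/2)^j :: real)" using that by (intro power_decreasing) auto
    moreover have "dist x (Y j u) < (1/2)^j" "dist x (Y k u) < (1/2)^k"
      using x that by auto
    ultimately show ?thesis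
      using dist_triangle3[of "Y j u" "Y k u" x] by linarith
  qed (auto simp: Y_def)
  define Z where "Z u = lim (\<lambda>k. Y k u)" for u
  have Z: "(\<lambda>k. Y k u) \<longlonglongrightarrow> Z u" for u
  proof -
    have "Cauchy (\<lambda>k. Y k u)"
    proof (rule metric_CauchyI)
      fix e :: real assume e: "e > 0"
      obtain j :: nat where j: "(1/2)^j < e / 4" using real_arch_pow_inv[of "e/4" "1/2"] e by auto
      have "dist (Y m u) (Y n u) < e" if "m \<ge> j" "n \<ge> j" for m n
        using Y_dist[OF that(1), of u] Y_dist[OF that(2), of u] j
          dist_triangle3[of "Y m u" "Y n u" "Y j u"] by linarith
      then show "\<exists>M. \<forall>m\<ge>M. \<forall>n\<ge>M. dist (Y m u) (Y n u) < e" by blast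
    qed
    then show ?thesis unfolding Z_def by (intro convergent_LIMSEQ_iff[THEN iffD1] Cauchy_convergent)
  qed
  have Z_dist: "dist (Z u) (Y k u) \<le> 2 * (1/2)^k" for k u
  proof -
    have "(\<lambda>n. dist (Y k u) (Y n u)) \<longlonglongrightarrow> dist (Y k u) (Z u)" by (intro tendsto_intros Z)
    moreover have "\<exists>N. \<forall>n\<ge>N. dist (Y k u) (Y n u) \<le> 2 * (1/2)^k" using Y_dist by blast
    ultimately have "dist (Y k u) (Z u) \<le> 2 * (1/2)^k" by (rule LIMSEQ_le_const2)
    then show ?thesis by (simp add: dist_commute)
  qed
  \<comment> \<open>Measurability of \<open>W\<close> is known only for preimages inside [0, 1).
    Outside, which is a null set of the uniform measure, the word is replaced by a constant.\<close>
  define V where "V k u = (if u \<in> {0..<1} then W k u else [])" for k u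
  have V_meas [measurable]: "V k \<in> measurable borel (count_space UNIV)" for k
  proof (subst measurable_count_space_eq2_countable, intro conjI ballI)
    fix w :: "nat list"
    have "V k -` {w} \<inter> space borel =
      (if length w = k then {u \<in> {0..<1}. W (length w) u = w} else {}) \<union>
      (if w = [] then - {0..<1} else {})"
      by (auto simp: V_def len len_0 split: if_splits)
    also have "\<dots> \<in> sets borel" using W_sets[of w] by (intro sets.Un) auto
    finally show "V k -` {w} \<inter> space borel \<in> sets borel" .
  qed auto
  have Y_V: "Y k u = (if u \<in> {0..<1} then dense_seq (hd (V (Suc k) u)) else dense_seq 0)" for k u
    by (simp add: Y_def V_def)
  have Y_meas [measurable]: "Y k \<in> measurable borel borel" for k
    unfolding Y_V[abs_def] by measurable
  have Z_meas [measurable]: "Z \<in> measurable borel borel"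
    by (rule borel_measurable_LIMSEQ_metric[OF Y_meas Z])
  define \<Omega> where "\<Omega> = uniform_measure lborel {0..<1::real}"
  interpret \<Omega>: prob_space \<Omega> unfolding \<Omega>_def by (intro prob_space_uniform_measure) auto
  have [simp, measurable_cong]: "sets \<Omega> = sets borel" by (simp add: \<Omega>_def)
  have [simp]: "space \<Omega> = UNIV" by (simp add: \<Omega>_def)
  have AE_\<Omega>: "AE u in \<Omega>. u \<in> {0..<1}"
    unfolding \<Omega>_def by (rule AE_uniform_measureI) auto
  define \<mu> where "\<mu> = distr \<Omega> borel Z"
  have \<mu>: "\<mu> \<in> borel_probs"
    unfolding \<mu>_def borel_probs_iff by (auto intro!: \<Omega>.prob_space_distr)
  have "limitin weak_topology (\<nu> \<circ> r) \<mu> sequentially"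
  proof (rule limitin_weak_topologyI[OF \<mu>])
    show "(\<nu> \<circ> r) n \<in> borel_probs" for n using \<nu> by simp
    fix l t assume t: "t < (\<integral>x. plateau_max l x \<partial>\<mu>)"
    define g where "g = (plateau_max l :: 'a \<Rightarrow> real)"
    have [measurable]: "g \<in> borel_measurable borel" by (simp add: g_def)
    obtain L where L: "L \<ge> 0" "\<And>x y. \<bar>g x - g y\<bar> \<le> L * dist x y"
      using plateau_max_Lipschitz[where 'a = 'a and l = l] unfolding g_def by blast
    obtain B where B: "\<And>x. \<bar>g x\<bar> \<le> B" using plateau_max_bounded[where 'a = 'a and l = l] g_def
        by auto
    define \<delta> where "\<delta> = (\<integral>x. g x \<partial>\<mu>) - t"
    have "\<delta> > 0" using t by (simp add: \<delta>_def g_def)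
    \<comment> \<open>Of the three units \<open>L * (1/2)^k\<close> of error, two are spent between
      \<open>Z u\<close> and the centre \<open>Y k u\<close>, one between a point and the centre
      given by its own address at scale k.\<close>
    obtain k :: nat where k: "3 * L * (1/2)^k < \<delta>"
    proof -
      obtain k :: nat where "(1/2)^k < \<delta> / (3 * L + 1)"
        using real_arch_pow_inv[of "\<delta> / (3 * L + 1)" "1/2"] \<open>\<delta> > 0\<close> L(1) by auto
      then have "(3 * L + 1) * (1/2)^k < \<delta>" using L(1) by (simp add: field_simps)
      moreover have "3 * L * (1/2)^k \<le> (3 * L + 1) * (1/2)^k" by (intro mult_right_mono) auto
      ultimately have "3 * L * (1/2)^k < \<delta>" by linarith
      then show ?thesis by (rule that)
    qed
    define h where "h w = g (dense_seq (hd w))" for w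
    have h: "0 \<le> h w" "\<bar>h w\<bar> \<le> B" for w by (auto simp: h_def B) (simp add: g_def)
    have int: "integrable \<Omega> f" if "\<And>u. \<bar>f u\<bar> \<le> B" "f \<in> borel_measurable borel"
      for f :: "real \<Rightarrow> real"
      using that by (intro \<Omega>.integrable_const_bound[where B = B]) auto
    have "(\<integral>x. g x \<partial>\<mu>) = (\<integral>u. g (Z u) \<partial>\<Omega>)"
      unfolding \<mu>_def by (intro integral_distr) auto
    also have "\<dots> \<le> (\<integral>u. h (V (Suc k) u) + 2 * L * (1/2)^k \<partial>\<Omega>)"
    proof (intro integral_mono_AE)
      have "g (Z u) \<le> h (V (Suc k) u) + 2 * L * (1/2)^k" if "u \<in> {0..<1}" for u
      proof -
        have "\<bar>g (Z u) - g (Y k u)\<bar> \<le> L * (2 * (1/2)^k)"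
          using L(2)[of "Z u" "Y k u"] mult_left_mono[OF Z_dist[of u k] L(1)] by linarith
        then show ?thesis using that by (auto simp: h_def Y_V)
      qed
      then show "AE u in \<Omega>. g (Z u) \<le> h (V (Suc k) u) + 2 * L * (1/2)^k"
        by (rule eventually_mono[OF AE_\<Omega>])
    qed (use h B in \<open>auto intro!: int Bochner_Integration.integrable_add\<close>)
    also have "\<dots> = (\<integral>u. h (V (Suc k) u) \<partial>\<Omega>) + 2 * L * (1/2)^k"
      using h by (subst Bochner_Integration.integral_add)
          (auto intro!: int simp: \<Omega>.prob_space[simplified])
    finally have hV: "t + L * (1/2)^k < (\<integral>u. h (V (Suc k) u) \<partial>\<Omega>)"
      using k unfolding \<delta>_def by simp
    \<comment> \<open>The probabilities converge word by word, not uniformly, so only finitely many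
      words may be kept. As h \<ge> 0, discarding the others lowers the integral, which is the
      harmless direction for a one-sided criterion.\<close>
    let ?h = "\<lambda>m u. if to_nat (V (Suc k) u) < m then h (V (Suc k) u) else 0"
    have "(\<lambda>m. \<integral>u. (?h m u) \<partial>\<Omega>) \<longlonglongrightarrow>
        (\<integral>u. h (V (Suc k) u) \<partial>\<Omega>)"
    proof (rule integral_dominated_convergence[where w = "\<lambda>_. B"])
      have "(\<lambda>m. if to_nat (V (Suc k) u) < m then h (V (Suc k) u) else 0) \<longlonglongrightarrow> h (V (Suc k) u)" for u
        by (rule tendsto_eventually, rule
            eventually_mono[OF eventually_gt_at_top[of "to_nat (V (Suc k) u)"]])
          simp
      then show "AE u in \<Omega>. (\<lambda>m. if to_nat (V (Suc k) u) < m then h (V (Suc k) u) else 0) \<longlonglongrightarrow>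
          h (V (Suc k) u)"
        by simp
      show "AE u in \<Omega>. norm (?h m u) \<le> B" for m
        using h(2) order_trans[OF abs_ge_zero h(2)] by auto
    qed auto
    from order_tendstoD(1)[OF this hV] obtain m where
      m: "t + L * (1/2)^k < (\<integral>u. (?h m u) \<partial>\<Omega>)"
      unfolding eventually_sequentially by blast
    define D where "D w = {u \<in> {0..<1}. W (length w) u = w}" for w
    have D_sets [measurable, simp]: "D w \<in> sets borel" for w using W_sets by (simp add: D_def)
    have [simp]: "integrable \<Omega> (indicator (D w) :: real \<Rightarrow> real)" for w
      by (intro integrable_real_indicator) (auto simp: \<Omega>.emeasure_eq_measure)
    define S where "S = {w :: nat list. to_nat w < m \<and> length w = Suc k}"
    have "finite {w :: nat list. to_nat w < m}"
      using finite_vimageI[of "{..<m}" "to_nat :: nat list \<Rightarrow> nat"] by (simp add: vimage_def)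
    then have [simp]: "finite S" unfolding S_def by (rule rev_finite_subset) auto
    have "(\<integral>u. (?h m u) \<partial>\<Omega>) =
        (\<integral>u. (\<Sum>w\<in>S. h w * indicator (D w) u) \<partial>\<Omega>)"
    proof (rule integral_cong_AE)
      have "(?h m u) =
          (\<Sum>w\<in>S. h w * indicator (D w) u)" if u: "u \<in> {0..<1}" for u
      proof -
        have "(\<Sum>w\<in>S. h w * indicator (D w) u) =
            (\<Sum>w\<in>S. if w = W (Suc k) u then h w else 0)"
          using u by (intro sum.cong) (auto simp: S_def D_def)
        also have "\<dots> = (if W (Suc k) u \<in> S then h (W (Suc k) u) else 0)" by simp
        finally show ?thesis using u by (simp add: V_def S_def len)
      qed
      then show "AE u in \<Omega>. (?h m u) =
          (\<Sum>w\<in>S. h w * indicator (D w) u)"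
        by (rule eventually_mono[OF AE_\<Omega>])
    qed measurable
    also have "\<dots> = (\<Sum>w\<in>S. h w * measure \<Omega> (D w))"
      by (subst Bochner_Integration.integral_sum) auto
    also have "\<dots> = (\<Sum>w\<in>S. h w * p w)"
    proof (intro sum.cong refl arg_cong2[where f = "(*)"])
      fix w
      have "measure \<Omega> (D w) =
        measure lborel ({0..<1} \<inter> D w)"
        unfolding \<Omega>_def by (subst measure_uniform_measure) auto
      also have "{0..<1} \<inter> D w = D w" by (auto simp: D_def)
      finally show "measure \<Omega> (D w) = p w" using W_measure by (simp add: D_def)
    qed
    finally have "t + L * (1/2)^k < (\<Sum>w\<in>S. h w * p w)" using m by simp
    moreover have "(\<lambda>n. \<Sum>w\<in>S. h w * P (r n) w) \<longlonglongrightarrow> (\<Sum>w\<in>S. h w * p w)"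
      by (intro tendsto_intros p)
    ultimately have "\<forall>\<^sub>F n in sequentially. t + L * (1/2)^k < (\<Sum>w\<in>S. h w * P (r n) w)"
      by (rule order_tendstoD(1)[rotated])
    moreover have below: "(\<Sum>w\<in>S. h w * P n w) - L * (1/2)^k \<le> (\<integral>x. g x \<partial>\<nu> n)" for n
    proof -
      interpret prob_space "\<nu> n" by (rule prob)
      have sp: "space (\<nu> n) = UNIV" using \<nu> by (rule borel_probs_space)
      have int: "integrable (\<nu> n) (indicator {x. word (length w) x = w} :: 'a \<Rightarrow> real)" for w
        by (intro integrable_real_indicator) (auto simp: emeasure_eq_measure)
      have "(\<Sum>w\<in>S. h w * P n w) - L * (1/2)^k =
          (\<integral>x. (\<Sum>w\<in>S. h w * indicator {x. word (length w) x = w} x) - L * (1/2)^k \<partial>\<nu> n)"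
      proof -
        have "(\<integral>x. (\<Sum>w\<in>S. h w * indicator {x. word (length w) x = w} x) - L * (1/2)^k \<partial>\<nu> n) =
            (\<Sum>w\<in>S. \<integral>x. h w * indicator {x. word (length w) x = w} x \<partial>\<nu> n) - (\<integral>x. L * (1/2)^k \<partial>\<nu> n)"
          by (subst Bochner_Integration.integral_diff)
            (auto intro!: int integrable_mult_right Bochner_Integration.integrable_sum
                Bochner_Integration.integral_sum
              simp del: integral_mult_right_zero sum_mult_indicator integral_const)
        also have "\<dots> = (\<Sum>w\<in>S. h w * P n w) - L * (1/2)^k"
          using prob_space sp by (simp add: P_def)
        finally show ?thesis by simp
      qed
      also have "\<dots> \<le> (\<integral>x. g x \<partial>\<nu> n)"
      proof (intro integral_mono)
        fix x :: 'a
        have "(\<Sum>w\<in>S. h w * indicator {x. word (length w) x = w} x) =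
            (\<Sum>w\<in>S. if w = word (Suc k) x then h w else 0)"
          by (intro sum.cong) (auto simp: S_def)
        also have "\<dots> \<le> h (word (Suc k) x)" using h(1) by auto
        also have "\<dots> \<le> g x + L * (1/2)^k"
          using L(2)[of x "dense_seq (addr k x)"]
            mult_left_mono[OF less_imp_le[OF addr_close[of x k]] L(1)] by (simp add: h_def)
        finally show "(\<Sum>w\<in>S. h w * indicator {x. word (length w) x = w} x) - L * (1/2)^k \<le> g x"
            by simp
      next
        show "integrable (\<nu> n) (\<lambda>x. (\<Sum>w\<in>S. h w * indicator {x. word (length w) x = w} x) - L *
            (1/2)^k)"
          by (intro Bochner_Integration.integrable_diff Bochner_Integration.integrable_sum
              integrable_mult_right int integrable_const)
      qed (use B \<nu> in \<open>auto intro!: borel_probs_integrable\<close>)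
      finally show ?thesis .
    qed
    ultimately show "\<forall>\<^sub>F n in sequentially. t < (\<integral>x. plateau_max l x \<partial>(\<nu> \<circ> r) n)"
    proof (elim eventually_mono)
      fix n assume "t + L * (1/2)^k < (\<Sum>w\<in>S. h w * P (r n) w)"
      then show "t < (\<integral>x. plateau_max l x \<partial>(\<nu> \<circ> r) n)"
        using below[of "r n"] unfolding g_def comp_def by linarith
    qed
  qed
  with r \<mu> that show ?thesis by blast
qed

section \<open>Relative entropy\<close>

text \<open>Pointwise, the positive part of f + c plus the negative part of f equals the positive
  part of f plus c. The negative part has integral at most c and can be cancelled, leaving a single
  nonnegative integral in place of a difference.\<close>

lemma ereal_integral_shift:
  assumes "prob_space M" "f \<in> borel_measurable M" "\<And>x. x \<in> space M \<Longrightarrow> ereal (- c) \<le> f x" "0 \<le> c"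
  shows "ereal_integral M f = enn2ereal (\<integral>\<^sup>+x. e2ennreal (f x + ereal c) \<partial>M) - ereal c"
proof -
  interpret prob_space M by fact
  note [measurable] = assms(2)
  have pointwise: "e2ennreal (f x + ereal c) + e2ennreal (- f x) = e2ennreal (f x) + ennreal c"
    if "x \<in> space M" for x
  proof (cases "f x")
    case (real r)
    then have "- c \<le> r" using assms(3)[OF that] by simp
    then show ?thesis using real assms(4)
      by (cases "0 \<le> r") (simp_all add: e2ennreal_ereal ennreal_neg flip: ennreal_plus)
  qed (use assms(3)[OF that] in auto)
  define P N A where "P = (\<integral>\<^sup>+x. e2ennreal (f x) \<partial>M)" and "N = (\<integral>\<^sup>+x. e2ennreal (- f x) \<partial>M)"
    and "A = (\<integral>\<^sup>+x. e2ennreal (f x + ereal c) \<partial>M)"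
  have "A + N = (\<integral>\<^sup>+x. e2ennreal (f x + ereal c) + e2ennreal (- f x) \<partial>M)"
    unfolding A_def N_def by (intro nn_integral_add[symmetric]) auto
  also have "\<dots> = (\<integral>\<^sup>+x. e2ennreal (f x) + ennreal c \<partial>M)"
    by (intro nn_integral_cong pointwise)
  also have "\<dots> = P + ennreal c"
    unfolding P_def by (subst nn_integral_add) (auto simp: emeasure_space_1)
  finally have eq: "A + N = P + ennreal c" .
  have "N \<le> (\<integral>\<^sup>+x. ennreal c \<partial>M)"
    unfolding N_def
  proof (intro nn_integral_mono)
    fix x assume "x \<in> space M"
    then have "- f x \<le> ereal c" using assms(3) ereal_uminus_le_reorder by fastforce
    then show "e2ennreal (- f x) \<le> ennreal c" using e2ennreal_mono by fastforce
  qed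
  then have "N < top" by (simp add: emeasure_space_1 le_less_trans)
  then obtain n where n: "N = ennreal n" "0 \<le> n" by (cases N) auto
  have "enn2ereal A + ereal n = enn2ereal P + ereal c"
    using arg_cong[OF eq, of enn2ereal] n assms(4)
        by (simp add: plus_ennreal.rep_eq enn2ereal_ennreal)
  then have "enn2ereal P - ereal n = enn2ereal A - ereal c"
    by (cases "enn2ereal A"; cases "enn2ereal P") auto
  then show ?thesis
    unfolding ereal_integral_def P_def[symmetric] N_def[symmetric] A_def[symmetric]
    using n by (simp add: enn2ereal_ennreal)
qed

text \<open>For a function bounded below, a finite extended integral excludes the value \<infinity>
  almost everywhere; from there on the Bochner integral and its linearity are available.\<close>

lemma ereal_integral_finite:
  assumes "prob_space M" "f \<in> borel_measurable M" "\<And>x. x \<in> space M \<Longrightarrow> ereal (- c) \<le> f x" "0 \<le> c"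
    and fin: "ereal_integral M f < \<infinity>"
  shows "AE x in M. f x = ereal (real_of_ereal (f x))"
    and "integrable M (\<lambda>x. real_of_ereal (f x))"
    and "ereal_integral M f = ereal (\<integral>x. real_of_ereal (f x) \<partial>M)"
proof -
  interpret prob_space M by fact
  note [measurable] = assms(2)
  define A where "A = (\<integral>\<^sup>+x. e2ennreal (f x + ereal c) \<partial>M)"
  have shift: "ereal_integral M f = enn2ereal A - ereal c"
    unfolding A_def by (rule ereal_integral_shift[OF assms(1-4)])
  have "A \<noteq> top"
  proof
    assume "A = top"
    then have "ereal_integral M f = \<infinity>" unfolding shift by simp
    then show False using fin by simp
  qed
  have "AE x in M. e2ennreal (f x + ereal c) \<noteq> \<infinity>"
    using \<open>A \<noteq> top\<close> unfolding A_def by (intro nn_integral_noteq_infinite) auto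
  then show AE: "AE x in M. f x = ereal (real_of_ereal (f x))"
    using AE_space
  proof eventually_elim
    case (elim x)
    then show ?case
      using assms(3)[of x] by (cases "f x") auto
  qed
  have "A = (\<integral>\<^sup>+x. ennreal (real_of_ereal (f x) + c) \<partial>M)"
    unfolding A_def
  proof (rule nn_integral_cong_AE, use AE in eventually_elim)
    case (elim x)
    then have "f x + ereal c = ereal (real_of_ereal (f x) + c)" by (metis plus_ereal.simps(1))
    then show ?case
      by (simp add: e2ennreal_ereal)
  qed
  moreover have nonneg: "AE x in M. 0 \<le> real_of_ereal (f x) + c"
    using AE AE_space
  proof eventually_elim
    case (elim x)
    then show ?case
      using assms(3)[of x] by (cases "f x") auto
  qed
  ultimately have int: "integrable M (\<lambda>x. real_of_ereal (f x) + c)"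
    using \<open>A \<noteq> top\<close> by (intro integrableI_nonneg) (auto simp: less_top)
  have "integrable M (\<lambda>x. (real_of_ereal (f x) + c) - c)"
    using int by (rule Bochner_Integration.integrable_diff) auto
  then show int': "integrable M (\<lambda>x. real_of_ereal (f x))" by simp
  have "A = ennreal (\<integral>x. real_of_ereal (f x) + c \<partial>M)"
    unfolding \<open>A = (\<integral>\<^sup>+x. ennreal (real_of_ereal (f x) + c) \<partial>M)\<close>
    by (rule nn_integral_eq_integral[OF int nonneg])
  moreover have "(\<integral>x. real_of_ereal (f x) + c \<partial>M) = (\<integral>x. real_of_ereal (f x) \<partial>M) + c"
    using int' by (simp add: prob_space)
  moreover have "0 \<le> (\<integral>x. real_of_ereal (f x) + c \<partial>M)"
    using nonneg by (rule integral_nonneg_AE)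
  ultimately show "ereal_integral M f = ereal (\<integral>x. real_of_ereal (f x) \<partial>M)"
    unfolding shift by (simp add: enn2ereal_ennreal)
qed

text \<open>The tangent at 1 of the convex function x ln x. Besides nonnegativity of the entropy it
  yields the lower bound -1, which serves as the shift in entropy integrals and bounds the entropy
  lost outside an event.\<close>

lemma mult_ln_ge: "0 \<le> x \<Longrightarrow> x - 1 \<le> x * ln (x::real)"
proof (cases "x = 0")
  case False
  assume "0 \<le> x"
  with False have "x > 0" by simp
  then have "ln (1 / x) \<le> 1 / x - 1" by (intro ln_le_minus_one) auto
  then have "x * (1 - 1 / x) \<le> x * ln x" using \<open>x > 0\<close> by (intro mult_left_mono) (auto simp: ln_div)
  moreover have "x * (1 - 1 / x) = x - 1" using \<open>x > 0\<close> by (simp add: field_simps)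
  ultimately show ?thesis by simp
qed simp

text \<open>The Radon--Nikodym derivative is finite only almost everywhere. Its image under
  \<open>enn2real\<close> is a real density of the same measure, and the entropy is defined through
  that image.\<close>

lemma relative_entropy_density:
  assumes "\<mu> \<in> borel_probs" "\<pi> \<in> borel_probs" "absolutely_continuous \<pi> \<mu>"
  obtains h :: "'a::topological_space \<Rightarrow> real" where
    "h \<in> borel_measurable borel" "\<And>x. 0 \<le> h x" "\<mu> = density \<pi> (\<lambda>x. ennreal (h x))"
    "relative_entropy \<mu> \<pi> = ereal_integral \<pi> (\<lambda>x. ereal (h x * ln (h x)))"
proof -
  interpret \<pi>: prob_space \<pi> using assms(2) by (simp add: borel_probs_iff)
  interpret \<mu>: prob_space \<mu> using assms(1) by (simp add: borel_probs_iff)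
  have sets: "sets \<mu> = sets \<pi>" using assms by (simp add: borel_probs_iff)
  define h where "h x = enn2real (RN_deriv \<pi> \<mu> x)" for x
  have "AE x in \<pi>. RN_deriv \<pi> \<mu> x \<noteq> \<infinity>"
    using assms(3) sets \<mu>.sigma_finite_measure by (rule \<pi>.RN_deriv_finite[rotated 1])
  then have "AE x in \<pi>. RN_deriv \<pi> \<mu> x = ennreal (h x)"
    by eventually_elim (auto simp: h_def less_top)
  then have "density \<pi> (RN_deriv \<pi> \<mu>) = density \<pi> (\<lambda>x. ennreal (h x))"
    by (intro density_cong) (auto simp: h_def)
  then have "\<mu> = density \<pi> (\<lambda>x. ennreal (h x))"
    using \<pi>.density_RN_deriv[OF assms(3) sets] by simp
  moreover have "h \<in> borel_measurable borel"
  proof -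
    have "h \<in> borel_measurable \<pi>" unfolding h_def by measurable
    then show ?thesis using assms(2) by simp
  qed
  ultimately show ?thesis
    using assms(3) by (intro that[of h]) (auto simp: relative_entropy_def h_def)
qed

text \<open>Integrate h ln h + 1 \<ge> h against \<pi>; the right-hand side has integral 1.\<close>

lemma relative_entropy_nonneg:
  fixes \<mu> \<pi> :: "'a::topological_space measure"
  assumes "\<mu> \<in> borel_probs" "\<pi> \<in> borel_probs"
  shows "0 \<le> relative_entropy \<mu> \<pi>"
proof (cases "absolutely_continuous \<pi> \<mu>")
  case True
  from relative_entropy_density[OF assms True] obtain h :: "'a \<Rightarrow> real" where
    h: "h \<in> borel_measurable borel" "\<And>x. 0 \<le> h x" "\<mu> = density \<pi> (\<lambda>x. ennreal (h x))"
    and D: "relative_entropy \<mu> \<pi> = ereal_integral \<pi> (\<lambda>x. ereal (h x * ln (h x)))" by blast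
  note [measurable] = h(1)
  interpret \<pi>: prob_space \<pi> using assms(2) by (simp add: borel_probs_iff)
  interpret \<mu>: prob_space \<mu> using assms(1) by (simp add: borel_probs_iff)
  have ge: "-1 \<le> h x * ln (h x)" for x using mult_ln_ge[OF h(2)[of x]] h(2)[of x] by linarith
  have [measurable]: "h \<in> borel_measurable \<pi>" using h(1) assms(2) by simp
  have "1 = emeasure \<mu> UNIV"
    using \<mu>.emeasure_space_1 borel_probs_space[OF assms(1)] by simp
  also have "\<dots> = (\<integral>\<^sup>+x. ennreal (h x) \<partial>\<pi>)"
    using sets.top[of \<pi>] borel_probs_space[OF assms(2)] by (subst h(3), subst emeasure_density) auto
  also have "\<dots> \<le> (\<integral>\<^sup>+x. e2ennreal (ereal (h x * ln (h x)) + ereal 1) \<partial>\<pi>)"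
  proof (intro nn_integral_mono)
    fix x
    have "h x \<le> h x * ln (h x) + 1" using mult_ln_ge[OF h(2)[of x]] by linarith
    then show "ennreal (h x) \<le> e2ennreal (ereal (h x * ln (h x)) + ereal 1)"
      by (simp add: e2ennreal_ereal ennreal_leI)
  qed
  finally have "1 \<le> (\<integral>\<^sup>+x. e2ennreal (ereal (h x * ln (h x)) + ereal 1) \<partial>\<pi>)" .
  then have "1 \<le> enn2ereal (\<integral>\<^sup>+x. e2ennreal (ereal (h x * ln (h x)) + ereal 1) \<partial>\<pi>)"
    by (simp add: less_eq_ennreal.rep_eq one_ennreal.rep_eq)
  moreover have "relative_entropy \<mu> \<pi> =
      enn2ereal (\<integral>\<^sup>+x. e2ennreal (ereal (h x * ln (h x)) + ereal 1) \<partial>\<pi>) - ereal 1"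
    unfolding D using ge assms(2) by (intro ereal_integral_shift \<pi>.prob_space_axioms) auto
  ultimately show ?thesis by (simp add: ereal_diff_positive one_ereal_def)
qed (simp add: relative_entropy_def)

section \<open>Continuous approximation and the Donsker--Varadhan formula\<close>

lemma continuous_L1_dense:
  fixes f :: "'a::polish_space \<Rightarrow> real"
  assumes "finite_measure M" and sets: "sets M = sets borel" and f: "integrable M f" and "0 < e"
  obtains g B where "continuous_on UNIV g" "\<And>x. \<bar>g x\<bar> \<le> B" "(\<integral>x. \<bar>f x - g x\<bar> \<partial>M) < e"
proof -
  interpret finite_measure M by fact
  have sp: "space M = UNIV" using sets_eq_imp_space_eq[OF sets] by simp
  have meas: "borel_measurable M = borel_measurable borel" by (intro measurable_cong_sets sets refl)
  have cont_int: "integrable M g" if "continuous_on UNIV g" "\<And>x. \<bar>g x\<bar> \<le> B" for g :: "'a \<Rightarrow> real"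
      and B
    using that by (intro integrable_const_bound[where B = B])
        (auto simp: meas borel_measurable_continuous_onI)
  have "\<forall>e>0. \<exists>g B. continuous_on UNIV g \<and> (\<forall>x. \<bar>g x\<bar> \<le> B) \<and> (\<integral>x. \<bar>f x - g x\<bar> \<partial>M) < e"
    using f
  proof (induction f rule: integrable_induct)
    case (base A c)
    show ?case
    proof (intro allI impI)
      fix e :: real assume "0 < e"
      \<comment> \<open>Two errors of size e', one from the open superset and one from the
        continuous approximation, are multiplied by |c|. The added 1 makes the final bound strict
        and covers c = 0.\<close>
      define e' where "e' = e / (2 * (\<bar>c\<bar> + 1))"
      have "0 < e'" using \<open>0 < e\<close> by (simp add: e'_def)
      have "(INF U\<in>{U. A \<subseteq> U \<and> open U}. emeasure M U) < emeasure M A + ennreal e'"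
        using outer_regular[OF sets, of A] base \<open>0 < e'\<close> sets
        by (auto simp: emeasure_eq_measure simp flip: ennreal_plus)
      then obtain U where U: "A \<subseteq> U" "open U" "emeasure M U < emeasure M A + ennreal e'"
        by (auto simp: INF_less_iff)
      have [measurable]: "U \<in> sets M" "A \<in> sets M" using U(2) base sets by auto
      have UA: "measure M U < measure M A + e'"
        using U(3) \<open>0 < e'\<close> by (simp add: emeasure_eq_measure ennreal_less_iff flip: ennreal_plus)
      \<comment> \<open>The distance to the empty set is 0 by convention, so U = UNIV has to be
        treated apart.\<close>
      define g where "g m x = (if U = UNIV then 1 else min 1 (real m * infdist x (- U)))" for m x
      have g_cont: "continuous_on UNIV (g m)" for m
        unfolding g_def by (cases "U = UNIV") (auto intro!: continuous_intros)
      have g_bd: "0 \<le> g m x" "g m x \<le> 1" for m x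
        by (auto simp: g_def infdist_nonneg)
      have g_lim: "(\<lambda>m. g m x) \<longlonglongrightarrow> indicator U x" for x
      proof (cases "U = UNIV")
        case False
        show ?thesis
        proof (cases "x \<in> U")
          case True
          have "infdist x (- U) > 0"
            using True False U(2) by (subst infdist_pos_not_in_closed) auto
          then obtain m0 :: nat where "1 < real m0 * infdist x (- U)"
            using ex_less_of_nat_mult by blast
          then have "g m x = 1" if "m \<ge> m0" for m
            using that False mult_right_mono[of "real m0" "real m" "infdist x (- U)"]
            by (simp add: g_def infdist_nonneg min_def)
          then show ?thesis
            using True by (intro tendsto_eventually) (auto simp: eventually_sequentially)
        qed (simp add: g_def False)
      qed (simp add: g_def)
      have [measurable]: "g m \<in> borel_measurable M" for m
        unfolding meas by (intro borel_measurable_continuous_onI g_cont)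
      have "(\<lambda>m. \<integral>x. \<bar>indicator U x - g m x\<bar> \<partial>M) \<longlonglongrightarrow> (\<integral>x. 0 \<partial>M)"
      proof (rule integral_dominated_convergence[where w = "\<lambda>_. 1"])
        show "AE x in M. (\<lambda>m. \<bar>indicator U x - g m x\<bar>) \<longlonglongrightarrow> 0"
        proof (intro AE_I2 tendsto_rabs_zero)
          fix x
          show "(\<lambda>m. indicator U x - g m x) \<longlonglongrightarrow> 0"
            using tendsto_diff[OF tendsto_const[of "indicator U x"] g_lim[of x]] by simp
        qed
        show "AE x in M. norm \<bar>indicator U x - g m x\<bar> \<le> 1" for m
          using g_bd by (intro AE_I2) (auto simp: indicator_def)
      qed auto
      then have "\<forall>\<^sub>F m in sequentially. (\<integral>x. \<bar>indicator U x - g m x\<bar> \<partial>M) < e'"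
        using \<open>0 < e'\<close> by (intro order_tendstoD(2)) auto
      then obtain m where m: "(\<integral>x. \<bar>indicator U x - g m x\<bar> \<partial>M) < e'"
        unfolding eventually_sequentially by blast
      have int: "integrable M (\<lambda>x. \<bar>indicator U x - g m x\<bar>)"
        "integrable M (indicator U :: 'a \<Rightarrow> real)" "integrable M (indicator A :: 'a \<Rightarrow> real)"
        using g_bd by (auto intro!: integrable_const_bound[where B = 1] simp: indicator_def)
      have "(\<integral>x. \<bar>indicator A x *\<^sub>R c - c * g m x\<bar> \<partial>M) \<le>
          (\<integral>x. \<bar>c\<bar> * (indicator U x - indicator A x + \<bar>indicator U x - g m x\<bar>) \<partial>M)"
      proof (rule integral_mono)
        fix x
        have "\<bar>indicator A x - g m x\<bar> \<le> indicator U x - indicator A x + \<bar>indicator U x - g m x\<bar>"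
          using U(1) by (auto simp: indicator_def)
        then have "\<bar>c\<bar> * \<bar>indicator A x - g m x\<bar> \<le>
            \<bar>c\<bar> * (indicator U x - indicator A x + \<bar>indicator U x - g m x\<bar>)"
          by (intro mult_left_mono) auto
        moreover have "indicator A x *\<^sub>R c - c * g m x = c * (indicator A x - g m x)"
          by (simp add: algebra_simps)
        ultimately show "\<bar>indicator A x *\<^sub>R c - c * g m x\<bar> \<le>
            \<bar>c\<bar> * (indicator U x - indicator A x + \<bar>indicator U x - g m x\<bar>)"
          by (simp add: abs_mult)
      next
        show "integrable M (\<lambda>x. \<bar>indicator A x *\<^sub>R c - c * g m x\<bar>)"
          using int(3) cont_int[OF g_cont, of m 1] g_bd
          by (intro integrable_abs Bochner_Integration.integrable_diff integrable_mult_right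
              integrable_scaleR_left) auto
      qed (use int in auto)
      also have "\<dots> = \<bar>c\<bar> * (measure M U - measure M A + (\<integral>x. \<bar>indicator U x - g m x\<bar> \<partial>M))"
        using int sp by simp
      also have "\<dots> \<le> \<bar>c\<bar> * (e' + e')"
        using UA m by (intro mult_left_mono) auto
      also have "\<dots> < e"
      proof -
        have "\<bar>c\<bar> * (e' + e') = e * (\<bar>c\<bar> / (\<bar>c\<bar> + 1))"
          unfolding e'_def mult_2[symmetric] by (simp del: distrib_left_numeral)
        also have "\<dots> < e * 1"
          using \<open>0 < e\<close> by (intro mult_strict_left_mono) (auto simp: divide_less_eq)
        finally show ?thesis by simp
      qed
      finally have "(\<integral>x. \<bar>indicator A x *\<^sub>R c - c * g m x\<bar> \<partial>M) < e" .
      moreover have "continuous_on UNIV (\<lambda>x. c * g m x)"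
        by (intro continuous_intros g_cont)
      moreover have "\<bar>c * g m x\<bar> \<le> \<bar>c\<bar>" for x
        using g_bd[of m x] by (auto simp: abs_mult intro!: mult_left_le)
      ultimately show "\<exists>g B. continuous_on UNIV g \<and> (\<forall>x. \<bar>g x\<bar> \<le> B) \<and>
          (\<integral>x. \<bar>indicator A x *\<^sub>R c - g x\<bar> \<partial>M) < e" by blast
    qed
  next
    case (add f1 f2)
    show ?case
    proof (intro allI impI)
      fix e :: real assume "0 < e"
      then have "0 < e / 2" by simp
      from add.IH(1)[rule_format, OF this] obtain g1 B1 where 1: "continuous_on UNIV g1"
          "\<And>x. \<bar>g1 x\<bar> \<le> B1"
        "(\<integral>x. \<bar>f1 x - g1 x\<bar> \<partial>M) < e / 2" by blast
      from add.IH(2)[rule_format, OF \<open>0 < e / 2\<close>] obtain g2 B2 where 2: "continuous_on UNIV g2"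
          "\<And>x. \<bar>g2 x\<bar> \<le> B2"
        "(\<integral>x. \<bar>f2 x - g2 x\<bar> \<partial>M) < e / 2" by blast
      have "(\<integral>x. \<bar>f1 x + f2 x - (g1 x + g2 x)\<bar> \<partial>M) \<le> (\<integral>x. \<bar>f1 x - g1 x\<bar> + \<bar>f2 x - g2 x\<bar> \<partial>M)"
        using add.hyps cont_int[OF 1(1,2)] cont_int[OF 2(1,2)] by (intro integral_mono) auto
      also have "\<dots> = (\<integral>x. \<bar>f1 x - g1 x\<bar> \<partial>M) + (\<integral>x. \<bar>f2 x - g2 x\<bar> \<partial>M)"
        using add.hyps cont_int[OF 1(1,2)] cont_int[OF 2(1,2)]
            by (intro Bochner_Integration.integral_add) auto
      also have "\<dots> < e" using 1(3) 2(3) by simp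
      finally have "(\<integral>x. \<bar>f1 x + f2 x - (g1 x + g2 x)\<bar> \<partial>M) < e" .
      moreover have "\<bar>g1 x + g2 x\<bar> \<le> B1 + B2" for x using 1(2)[of x] 2(2)[of x] by linarith
      moreover have "continuous_on UNIV (\<lambda>x. g1 x + g2 x)" using 1 2 by (intro continuous_intros)
      ultimately show "\<exists>g B. continuous_on UNIV g \<and> (\<forall>x. \<bar>g x\<bar> \<le> B) \<and>
          (\<integral>x. \<bar>f1 x + f2 x - g x\<bar> \<partial>M) < e" by blast
    qed
  next
    case (lim f s)
    show ?case
    proof (intro allI impI)
      fix e :: real assume "0 < e"
      have "(\<lambda>i. \<integral>x. \<bar>f x - s i x\<bar> \<partial>M) \<longlonglongrightarrow> (\<integral>x. 0 \<partial>M)"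
      proof (rule integral_dominated_convergence[where w = "\<lambda>x. 3 * \<bar>f x\<bar>"])
        show "AE x in M. (\<lambda>i. \<bar>f x - s i x\<bar>) \<longlonglongrightarrow> 0"
        proof (intro AE_I2 tendsto_rabs_zero)
          fix x assume "x \<in> space M"
          then show "(\<lambda>i. f x - s i x) \<longlonglongrightarrow> 0"
            using tendsto_diff[OF tendsto_const[of "f x"] lim.hyps(2)[of x]] by simp
        qed
        show "AE x in M. norm \<bar>f x - s i x\<bar> \<le> 3 * \<bar>f x\<bar>" for i
        proof (intro AE_I2)
          fix x assume "x \<in> space M"
          then show "norm \<bar>f x - s i x\<bar> \<le> 3 * \<bar>f x\<bar>"
            using lim.hyps(3)[of x i] unfolding real_norm_def by linarith
        qed
      qed (use lim.hyps in auto)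
      then have "\<forall>\<^sub>F i in sequentially. (\<integral>x. \<bar>f x - s i x\<bar> \<partial>M) < e / 2"
        using \<open>0 < e\<close> by (intro order_tendstoD(2)) auto
      then obtain i where i: "(\<integral>x. \<bar>f x - s i x\<bar> \<partial>M) < e / 2"
        unfolding eventually_sequentially by blast
      have "0 < e / 2" using \<open>0 < e\<close> by simp
      from lim.IH[rule_format, OF this] obtain g B where g: "continuous_on UNIV g" "\<And>x. \<bar>g x\<bar> \<le> B"
        "(\<integral>x. \<bar>s i x - g x\<bar> \<partial>M) < e / 2" by blast
      have "(\<integral>x. \<bar>f x - g x\<bar> \<partial>M) \<le> (\<integral>x. \<bar>f x - s i x\<bar> + \<bar>s i x - g x\<bar> \<partial>M)"
        using lim.hyps(1,4) cont_int[OF g(1,2)] by (intro integral_mono) auto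
      also have "\<dots> = (\<integral>x. \<bar>f x - s i x\<bar> \<partial>M) + (\<integral>x. \<bar>s i x - g x\<bar> \<partial>M)"
        using lim.hyps(1,4) cont_int[OF g(1,2)] by (intro Bochner_Integration.integral_add) auto
      also have "\<dots> < e" using i g(3) by simp
      finally show "\<exists>g B. continuous_on UNIV g \<and> (\<forall>x. \<bar>g x\<bar> \<le> B) \<and> (\<integral>x. \<bar>f x - g x\<bar> \<partial>M) < e"
        using g by blast
    qed
  qed
  then show ?thesis using \<open>0 < e\<close> that by blast
qed

lemma integral_exp_bounded:
  fixes f :: "'a::topological_space \<Rightarrow> real"
  assumes \<pi>: "\<pi> \<in> borel_probs" and f: "f \<in> borel_measurable borel" "\<And>x. \<bar>f x\<bar> \<le> B"
  shows "integrable \<pi> (\<lambda>x. exp (f x))" and "0 < (\<integral>x. exp (f x) \<partial>\<pi>)"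
proof -
  interpret prob_space \<pi> using \<pi> by (simp add: borel_probs_iff)
  show int: "integrable \<pi> (\<lambda>x. exp (f x))"
  proof (rule borel_probs_integrable[OF \<pi>, where B = "exp B"])
    show "\<bar>exp (f x)\<bar> \<le> exp B" for x using f(2)[of x] by simp
  qed (use f(1) in measurable)
  have "exp (- B) = (\<integral>x. exp (- B) \<partial>\<pi>)" using prob_space by simp
  also have "\<dots> \<le> (\<integral>x. exp (f x) \<partial>\<pi>)"
    using int f(2) by (intro integral_mono) (auto simp: abs_le_iff minus_le_iff)
  finally show "0 < (\<integral>x. exp (f x) \<partial>\<pi>)" by (rule less_le_trans[rotated]) simp
qed

text \<open>The tangent of exp at y has slope at most exp B. The resulting Lipschitz bound is
  one-sided, and x may be arbitrarily large.\<close>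

lemma exp_le_exp_add:
  fixes x y B :: real
  assumes "y \<le> B"
  shows "exp y \<le> exp x + exp B * \<bar>x - y\<bar>"
proof (cases "y \<le> x")
  case False
  have "exp y * (1 + (x - y)) \<le> exp y * exp (x - y)"
    by (intro mult_left_mono exp_ge_add_one_self) auto
  then have "exp y \<le> exp x + exp y * \<bar>x - y\<bar>"
    using False by (simp add: algebra_simps flip: exp_add)
  also have "\<dots> \<le> exp x + exp B * \<bar>x - y\<bar>"
    using assms by (intro add_left_mono mult_right_mono) auto
  finally show ?thesis .
qed (simp add: add_increasing2)

text \<open>Inner regularity yields a compact K that is charged by \<mu> but \<pi>-null. Large
  multiples of its indicator have large \<mu>-integral, while their exponential has \<pi>-integral
  1; continuous functions decreasing to them nearly achieve the same.\<close>

lemma variational_not_absolutely_continuous: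
  fixes \<mu> \<pi> :: "'a::polish_space measure"
  assumes \<mu>: "\<mu> \<in> borel_probs" and \<pi>: "\<pi> \<in> borel_probs" and "\<not> absolutely_continuous \<pi> \<mu>"
  obtains f :: "'a \<Rightarrow> real" and B where "continuous_on UNIV f" "\<And>x. \<bar>f x\<bar> \<le> B"
    "d < (\<integral>x. f x \<partial>\<mu>) - ln (\<integral>x. exp (f x) \<partial>\<pi>)"
proof -
  interpret \<pi>: prob_space \<pi> using \<pi> by (simp add: borel_probs_iff)
  interpret \<mu>: prob_space \<mu> using \<mu> by (simp add: borel_probs_iff)
  have sets: "sets \<mu> = sets borel" "sets \<pi> = sets borel" using \<mu> \<pi> by (auto simp: borel_probs_iff)
  have sp: "space \<mu> = UNIV" "space \<pi> = UNIV" using \<mu> \<pi> borel_probs_space by auto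
  obtain A where A: "A \<in> sets borel" "emeasure \<pi> A = 0" "0 < emeasure \<mu> A"
    using assms(3) sets unfolding absolutely_continuous_def null_sets_def
    by (auto simp: zero_less_iff_neq_zero)
  have "0 < (SUP K\<in>{K. K \<subseteq> A \<and> compact K}. emeasure \<mu> K)"
    using A by (subst inner_regular[OF sets(1) _ A(1), symmetric]) auto
  then obtain K where K: "K \<subseteq> A" "compact K" "0 < emeasure \<mu> K"
    by (auto simp: less_SUP_iff)
  have cl: "closed K" using K(2) by (rule compact_imp_closed)
  have "K \<noteq> {}" using K(3) by auto
  have K_meas: "K \<in> sets \<mu>" "K \<in> sets \<pi>" using cl sets by auto
  have \<mu>K: "0 < measure \<mu> K" using K(3) by (simp add: \<mu>.emeasure_eq_measure)
  have \<pi>K: "measure \<pi> K = 0"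
  proof -
    have "emeasure \<pi> K \<le> emeasure \<pi> A" using K(1) A(1) sets by (intro emeasure_mono) auto
    then show ?thesis using A(2) by (simp add: measure_def)
  qed
  \<comment> \<open>Chosen to bring the \<mu>-integral to at least |d| + 1; the logarithm will be
    kept below 1.\<close>
  define t where "t = (\<bar>d\<bar> + 1) / measure \<mu> K"
  have t: "0 < t" "t * measure \<mu> K = \<bar>d\<bar> + 1" using \<mu>K by (auto simp: t_def add_nonneg_pos)
  define g where "g m x = t * max 0 (1 - real m * infdist x K)" for m x
  have g_cont: "continuous_on UNIV (g m)" for m
    unfolding g_def by (intro continuous_intros)
  have g_bd: "0 \<le> g m x" "g m x \<le> t" for m x
  proof -
    have "t * max 0 (1 - real m * infdist x K) \<le> t * 1"
      using t(1) by (intro mult_left_mono) (auto simp: infdist_nonneg)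
    then show "g m x \<le> t" by (simp add: g_def)
  qed (use t(1) in \<open>simp add: g_def\<close>)
  have g_lim: "(\<lambda>m. g m x) \<longlonglongrightarrow> t * indicator K x" for x
  proof (cases "x \<in> K")
    case False
    have "infdist x K > 0"
      using False cl \<open>K \<noteq> {}\<close> by (subst infdist_pos_not_in_closed) auto
    then obtain m0 :: nat where "1 < real m0 * infdist x K"
      using ex_less_of_nat_mult by blast
    then have "g m x = 0" if "m \<ge> m0" for m
      using that mult_right_mono[of "real m0" "real m" "infdist x K"]
      by (simp add: g_def infdist_nonneg max_def)
    then show ?thesis
      using False by (intro tendsto_eventually) (auto simp: eventually_sequentially)
  qed (simp add: g_def)
  have [measurable]: "g m \<in> borel_measurable borel" for m
    by (intro borel_measurable_continuous_onI g_cont)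
  have "(\<lambda>m. \<integral>x. exp (g m x) \<partial>\<pi>) \<longlonglongrightarrow> (\<integral>x. exp (t * indicator K x) \<partial>\<pi>)"
  proof (rule integral_dominated_convergence[where w = "\<lambda>_. exp t"])
    show "AE x in \<pi>. (\<lambda>m. exp (g m x)) \<longlonglongrightarrow> exp (t * indicator K x)"
      by (intro AE_I2 tendsto_intros g_lim)
    show "AE x in \<pi>. norm (exp (g m x)) \<le> exp t" for m using g_bd by auto
  qed (use \<pi> cl in auto)
  also have "(\<integral>x. exp (t * indicator K x) \<partial>\<pi>) = 1"
  proof -
    have "AE x in \<pi>. x \<notin> K"
      using \<pi>K K_meas by (intro AE_not_in) (auto simp: null_sets_def \<pi>.emeasure_eq_measure)
    then have "(\<integral>x. exp (t * indicator K x) \<partial>\<pi>) = (\<integral>x. 1 \<partial>\<pi>)"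
      using K_meas by (intro integral_cong_AE) (auto intro: eventually_mono[OF \<open>AE x in \<pi>. x \<notin> K\<close>])
    then show ?thesis using \<pi>.prob_space by simp
  qed
  finally have "\<forall>\<^sub>F m in sequentially. (\<integral>x. exp (g m x) \<partial>\<pi>) < exp 1"
    by (rule order_tendstoD(2)) (use exp_gt_one[of "1::real"] in simp)
  then obtain m where m: "(\<integral>x. exp (g m x) \<partial>\<pi>) < exp 1"
    unfolding eventually_sequentially by blast
  have "(1::real) = (\<integral>x. 1 \<partial>\<pi>)" using \<pi>.prob_space by simp
  also have "\<dots> \<le> (\<integral>x. exp (g m x) \<partial>\<pi>)"
    using g_bd \<pi> by (intro integral_mono) (auto intro!: borel_probs_integrable[where B = "exp t"])
  finally have "0 < (\<integral>x. exp (g m x) \<partial>\<pi>)" by simp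
  then have "ln (\<integral>x. exp (g m x) \<partial>\<pi>) < 1"
    using m by (metis exp_gt_zero ln_exp ln_less_cancel_iff)
  moreover have "\<bar>d\<bar> + 1 \<le> (\<integral>x. g m x \<partial>\<mu>)"
  proof -
    have "\<bar>d\<bar> + 1 = (\<integral>x. t * indicator K x \<partial>\<mu>)" using t(2) K_meas by simp
    also have "\<dots> \<le> (\<integral>x. g m x \<partial>\<mu>)"
    proof (intro integral_mono)
      show "integrable \<mu> (\<lambda>x. t * indicator K x)"
        using K_meas by (intro integrable_mult_right integrable_real_indicator)
            (auto simp: \<mu>.emeasure_eq_measure)
      show "integrable \<mu> (g m)" using g_bd \<mu> by (intro borel_probs_integrable[where B = t]) auto
      show "t * indicator K x \<le> g m x" for x
        using g_bd by (auto simp: indicator_def) (simp add: g_def)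
    qed
    finally show ?thesis .
  qed
  ultimately show ?thesis
    using g_bd by (intro that[OF g_cont[of m], of t]) auto
qed

text \<open>The truncated logarithms \<open>f m\<close> of the density \<open>h\<close> are almost optimal, by Fatou's lemma applied to
  \<open>h * f m \<ge> -1\<close>. They are then approximated by continuous functions in \<open>L\<^sup>1(\<pi> + \<mu>)\<close>.\<close>

lemma variational_absolutely_continuous:
  fixes \<mu> \<pi> :: "'a::polish_space measure"
  assumes \<mu>: "\<mu> \<in> borel_probs" and \<pi>: "\<pi> \<in> borel_probs" and ac: "absolutely_continuous \<pi> \<mu>"
    and d: "ereal d < relative_entropy \<mu> \<pi>"
  obtains f :: "'a \<Rightarrow> real" and B where "continuous_on UNIV f" "\<And>x. \<bar>f x\<bar> \<le> B"
    "d < (\<integral>x. f x \<partial>\<mu>) - ln (\<integral>x. exp (f x) \<partial>\<pi>)"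
proof -
  interpret \<pi>: prob_space \<pi> using \<pi> by (simp add: borel_probs_iff)
  interpret \<mu>: prob_space \<mu> using \<mu> by (simp add: borel_probs_iff)
  from relative_entropy_density[OF \<mu> \<pi> ac] obtain h :: "'a \<Rightarrow> real" where
    h: "h \<in> borel_measurable borel" "\<And>x. 0 \<le> h x" "\<mu> = density \<pi> (\<lambda>x. ennreal (h x))"
    and D: "relative_entropy \<mu> \<pi> = ereal_integral \<pi> (\<lambda>x. ereal (h x * ln (h x)))" by blast
  note [measurable] = h(1)
  have meas\<pi> [simp]: "borel_measurable \<pi> = borel_measurable borel" using \<pi> by simp
  have ge: "-1 \<le> h x * ln (h x)" for x using mult_ln_ge[OF h(2)[of x]] h(2)[of x] by linarith
  have int_h: "integrable \<pi> h" "(\<integral>x. h x \<partial>\<pi>) = 1"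
  proof -
    have "emeasure \<mu> UNIV = 1" using \<mu>.emeasure_space_1 borel_probs_space[OF \<mu>] by simp
    then have 1: "(\<integral>\<^sup>+x. ennreal (h x) \<partial>\<pi>) = ennreal 1"
      using sets.top[of \<pi>] borel_probs_space[OF \<pi>]
          by (subst (asm) h(3), subst (asm) emeasure_density) auto
    show "integrable \<pi> h" using 1 h(2) by (intro integrableI_nonneg) auto
    show "(\<integral>x. h x \<partial>\<pi>) = 1" using 1 h(2) by (intro integral_eq_nn_integral[THEN trans]) auto
  qed
  have int_\<mu>: "(\<integral>x. f x \<partial>\<mu>) = (\<integral>x. h x * f x \<partial>\<pi>)" if "f \<in> borel_measurable borel"
      for f :: "'a \<Rightarrow> real"
    using that h(2) by (subst h(3), subst integral_density) auto
  define f where "f m x = ln (min (max (h x) (1 / (real m + 1))) (real m + 1))" for m x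
  define B where "B m = ln (real m + 1)" for m
  have [measurable]: "f m \<in> borel_measurable borel" for m unfolding f_def by measurable
  have f_bd: "\<bar>f m x\<bar> \<le> B m" for m x
  proof -
    let ?c = "min (max (h x) (1 / (real m + 1))) (real m + 1)"
    have "1 / (real m + 1) \<le> real m + 1" by (simp add: field_simps)
    then have c: "1 / (real m + 1) \<le> ?c" "?c \<le> real m + 1" "0 < 1 / (real m + 1)" by auto
    then have "ln (1 / (real m + 1)) \<le> ln ?c" "ln ?c \<le> ln (real m + 1)"
      using order_less_le_trans[OF c(3,1)] by (auto simp: ln_le_cancel_iff)
    then show ?thesis by (auto simp: f_def B_def ln_div)
  qed
  \<comment> \<open>Integrated, this gives at most 1 + 1 / (m + 1): the lower cut-off of the density
    costs little in the logarithmic term.\<close>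
  have f_exp: "exp (f m x) \<le> h x + 1 / (real m + 1)" for m x
  proof -
    have "0 < min (max (h x) (1 / (real m + 1))) (real m + 1)"
      by (simp add: less_max_iff_disj add_nonneg_pos)
    then have "exp (f m x) = min (max (h x) (1 / (real m + 1))) (real m + 1)" by (simp add: f_def)
    also have "\<dots> \<le> max (h x) (1 / (real m + 1))" by (rule min.cobounded1)
    also have "\<dots> \<le> h x + 1 / (real m + 1)" using h(2)[of x] by (intro max.boundedI) auto
    finally show ?thesis .
  qed
  \<comment> \<open>For h x \<ge> 1 the truncated logarithm is nonnegative. For h x < 1 only the
    lower cut-off can act, and it raises the logarithm, so the bound h ln h \<ge> -1
    applies.\<close>
  have hf_ge: "-1 \<le> h x * f m x" for m x
  proof (cases "1 \<le> h x")
    case True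
    then have "1 \<le> min (max (h x) (1 / (real m + 1))) (real m + 1)" by auto
    then have "0 \<le> f m x" unfolding f_def by (rule ln_ge_zero)
    then have "0 \<le> h x * f m x" using h(2) by (intro mult_nonneg_nonneg)
    then show ?thesis by simp
  next
    case False
    show ?thesis
    proof (cases "h x = 0")
      case False
      then have "0 < h x" using h(2)[of x] by simp
      then have "ln (h x) \<le> f m x"
        unfolding f_def using \<open>\<not> 1 \<le> h x\<close> by (subst ln_le_cancel_iff) auto
      then have "h x * ln (h x) \<le> h x * f m x" using h(2) by (intro mult_left_mono)
      then show ?thesis using ge[of x] by simp
    qed simp
  qed
  have hf_lim: "(\<lambda>m. h x * f m x) \<longlonglongrightarrow> h x * ln (h x)" for x
  proof (cases "h x = 0")
    case False
    then have hx: "0 < h x" using h(2)[of x] by simp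
    obtain m0 :: nat where m0: "h x < real m0" "1 / h x < real m0"
      using reals_Archimedean2[of "max (h x) (1 / h x)"] by auto
    have "f m x = ln (h x)" if "m \<ge> m0" for m
    proof -
      have "h x < real m + 1" "1 / h x < real m + 1" using m0 that by auto
      then show ?thesis using hx by (simp add: f_def field_simps max_def min_def)
    qed
    then show ?thesis by (intro tendsto_eventually) (auto simp: eventually_sequentially)
  qed simp
  have int_hf: "integrable \<pi> (\<lambda>x. h x * f m x)" for m
    using f_bd[of m] h(2) int_h(1)
    by (intro Bochner_Integration.integrable_bound[OF integrable_mult_left[OF int_h(1), of "B m"]])
      (auto simp: abs_mult intro!: mult_left_mono order_trans[OF f_bd abs_ge_self])
  define A where "A = (\<integral>\<^sup>+x. ennreal (h x * ln (h x) + 1) \<partial>\<pi>)"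
  have DA: "relative_entropy \<mu> \<pi> = enn2ereal A - ereal 1"
    unfolding D A_def using ge
    by (subst ereal_integral_shift[where c = 1])
      (auto simp: \<pi>.prob_space_axioms e2ennreal_ereal)
  obtain d' where d': "d < d'" "ereal d' < relative_entropy \<mu> \<pi>"
    using ereal_dense2[OF d] by (metis ereal_less_eq(3) less_ereal.simps(1))
  have "ennreal (d' + 1) < A"
  proof (cases A)
    case (real a)
    then have "d' + 1 < a" using d'(2) DA by (simp add: enn2ereal_ennreal)
    moreover have "1 \<le> a"
      using relative_entropy_nonneg[OF \<mu> \<pi>] DA real by (simp add: enn2ereal_ennreal)
    ultimately show ?thesis using real
      by (cases "0 \<le> d' + 1") (auto simp: ennreal_less_iff ennreal_neg)
  qed simp
  also have "A \<le> liminf (\<lambda>m. \<integral>\<^sup>+x. ennreal (h x * f m x + 1) \<partial>\<pi>)"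
  proof -
    have "A = (\<integral>\<^sup>+x. liminf (\<lambda>m. ennreal (h x * f m x + 1)) \<partial>\<pi>)"
      unfolding A_def
    proof (intro nn_integral_cong lim_imp_Liminf[symmetric])
      show "(\<lambda>m. ennreal (h x * f m x + 1)) \<longlonglongrightarrow> ennreal (h x * ln (h x) + 1)" for x
        by (intro tendsto_ennrealI tendsto_intros hf_lim)
    qed simp
    also have "\<dots> \<le> liminf (\<lambda>m. \<integral>\<^sup>+x. ennreal (h x * f m x + 1) \<partial>\<pi>)"
      by (intro nn_integral_liminf) auto
    finally show ?thesis .
  qed
  finally have "\<forall>\<^sub>F m in sequentially. ennreal (d' + 1) < (\<integral>\<^sup>+x. ennreal (h x * f m x + 1) \<partial>\<pi>)"
    by (rule less_LiminfD)
  moreover have "(\<lambda>m. 1 / (real m + 1)) \<longlonglongrightarrow> 0" by real_asymp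
  then have "\<forall>\<^sub>F m in sequentially. 1 / (real m + 1) < (d' - d) / 2"
    using d'(1) by (intro order_tendstoD(2)) auto
  ultimately have "\<forall>\<^sub>F m in sequentially. ennreal (d' + 1) < (\<integral>\<^sup>+x. ennreal (h x * f m x + 1) \<partial>\<pi>) \<and>
      1 / (real m + 1) < (d' - d) / 2" by (rule eventually_conj)
  then obtain m where m: "ennreal (d' + 1) < (\<integral>\<^sup>+x. ennreal (h x * f m x + 1) \<partial>\<pi>)"
      "1 / (real m + 1) < (d' - d) / 2"
    unfolding eventually_sequentially by blast
  have "(\<integral>\<^sup>+x. ennreal (h x * f m x + 1) \<partial>\<pi>) = ennreal (\<integral>x. h x * f m x + 1 \<partial>\<pi>)"
  proof (intro nn_integral_eq_integral AE_I2)
    show "0 \<le> h x * f m x + 1" for x using hf_ge[of x m] by linarith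
  qed (use int_hf in auto)
  also have "(\<integral>x. h x * f m x + 1 \<partial>\<pi>) = (\<integral>x. f m x \<partial>\<mu>) + 1"
    using int_hf \<pi>.prob_space by (simp add: int_\<mu>)
  finally have f_large: "d' < (\<integral>x. f m x \<partial>\<mu>)"
    using m(1) by (cases "0 \<le> d' + 1") (auto simp: ennreal_less_iff ennreal_neg)
  have f_int: "integrable \<mu> (f m)" "integrable \<pi> (f m)"
    using f_bd \<mu> \<pi> by (auto intro!: borel_probs_integrable)
  define \<delta> where "\<delta> = (d' - d) / 2"
  have "\<delta> > 0" using d'(1) by (simp add: \<delta>_def)
  \<comment> \<open>Half of the gap d' - d, namely \<delta>, is reserved for the continuous
    approximation: \<eta> for the \<mu>-integral and exp (B m) \<eta> for the exponential one. The
    other half pays for 1 / (m + 1).\<close>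
  define \<eta> where "\<eta> = \<delta> / (1 + exp (B m))"
  have \<eta>: "0 < \<eta>" "\<eta> + exp (B m) * \<eta> = \<delta>"
  proof -
    have "1 + exp (B m) > 0" by (intro add_pos_pos) auto
    then show "0 < \<eta>" using \<open>\<delta> > 0\<close> by (simp add: \<eta>_def)
    have "\<eta> + exp (B m) * \<eta> = (1 + exp (B m)) * \<eta>" by (simp add: algebra_simps)
    also have "\<dots> = \<delta>" using \<open>1 + exp (B m) > 0\<close> by (simp add: \<eta>_def)
    finally show "\<eta> + exp (B m) * \<eta> = \<delta>" .
  qed
  define M where "M = density \<pi> (\<lambda>x. ennreal (1 + h x))"
  have "finite_measure M"
  proof
    have "emeasure M (space M) = (\<integral>\<^sup>+x. ennreal (1 + h x) \<partial>\<pi>)"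
      unfolding M_def by (simp add: emeasure_density cong: nn_integral_cong)
    also have "\<dots> = ennreal (\<integral>x. 1 + h x \<partial>\<pi>)"
      using int_h h(2) by (intro nn_integral_eq_integral) (auto intro!: AE_I2 add_nonneg_nonneg)
    finally show "emeasure M (space M) \<noteq> \<infinity>" by simp
  qed
  moreover have sets_M: "sets M = sets borel" using \<pi> by (simp add: M_def borel_probs_iff)
  moreover have "integrable M (f m)"
  proof -
    interpret finite_measure M by fact
    have "borel_measurable M = borel_measurable borel" by (intro measurable_cong_sets sets_M refl)
    then show ?thesis using f_bd by (intro integrable_const_bound[where B = "B m"]) auto
  qed
  ultimately obtain g B' where g: "continuous_on UNIV g" "\<And>x. \<bar>g x\<bar> \<le> B'"
      "(\<integral>x. \<bar>f m x - g x\<bar> \<partial>M) < \<eta>"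
    using continuous_L1_dense[of M "f m" \<eta>] \<eta>(1) by metis
  \<comment> \<open>The bound B' of g comes with the approximation and is not controlled by \<eta>.
    Clamping to [- B m, B m] restores the bound from which \<eta> was computed, and never moves g
    away from \<open>f m\<close>.\<close>
  define g' where "g' x = max (- B m) (min (B m) (g x))" for x
  have "0 \<le> B m" by (simp add: B_def)
  then have g'_bd: "\<bar>g' x\<bar> \<le> B m" for x by (auto simp: g'_def)
  have g'_cont: "continuous_on UNIV g'" unfolding g'_def using g(1) by (intro continuous_intros)
  have [measurable]: "g \<in> borel_measurable borel" "g' \<in> borel_measurable borel"
    using g(1) g'_cont by (auto intro: borel_measurable_continuous_onI)
  have g'_int: "integrable \<mu> g'" "integrable \<pi> g'"
    using g'_bd \<mu> \<pi> by (auto intro!: borel_probs_integrable)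
  have diff_int: "integrable \<mu> (\<lambda>x. \<bar>f m x - g' x\<bar>)" "integrable \<pi> (\<lambda>x. \<bar>f m x - g' x\<bar>)"
    using f_int g'_int by auto
  have closer: "\<bar>f m x - g' x\<bar> \<le> \<bar>f m x - g x\<bar>" for x
    using f_bd[of m x] by (auto simp: g'_def max_def min_def)
  have diff: "(\<integral>x. \<bar>f m x - g' x\<bar> \<partial>\<pi>) + (\<integral>x. \<bar>f m x - g' x\<bar> \<partial>\<mu>) < \<eta>"
  proof -
    have hint: "integrable \<pi> (\<lambda>x. h x * \<bar>f m x - k x\<bar>)"
      if "k \<in> borel_measurable borel" "\<And>x. \<bar>k x\<bar> \<le> C" for k C
    proof (rule Bochner_Integration.integrable_bound[OF
        integrable_mult_left[OF int_h(1), of "B m + C"]])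
      show "AE x in \<pi>. norm (h x * \<bar>f m x - k x\<bar>) \<le> norm (h x * (B m + C))"
      proof (rule AE_I2)
        fix x
        have "\<bar>f m x - k x\<bar> \<le> \<bar>B m + C\<bar>" using f_bd[of m x] that(2)[of x] by linarith
        then show "norm (h x * \<bar>f m x - k x\<bar>) \<le> norm (h x * (B m + C))"
          by (simp add: abs_mult mult_left_mono)
      qed
    qed (use that in auto)
    have pint: "integrable \<pi> (\<lambda>x. \<bar>f m x - g x\<bar>)"
      using f_int g(2) \<pi> by (intro integrable_abs Bochner_Integration.integrable_diff
          borel_probs_integrable[of \<pi> g]) auto
    have "(\<integral>x. \<bar>f m x - g' x\<bar> \<partial>\<pi>) + (\<integral>x. \<bar>f m x - g' x\<bar> \<partial>\<mu>) =
        (\<integral>x. \<bar>f m x - g' x\<bar> + h x * \<bar>f m x - g' x\<bar> \<partial>\<pi>)"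
      using diff_int hint[of g' "B m"] g'_bd by (simp add: int_\<mu>)
    also have "\<dots> \<le> (\<integral>x. \<bar>f m x - g x\<bar> + h x * \<bar>f m x - g x\<bar> \<partial>\<pi>)"
      using diff_int hint[of g' "B m"] g'_bd hint[of g B'] g(2) pint h(2) closer
      by (intro integral_mono Bochner_Integration.integrable_add add_mono mult_left_mono) auto
    also have "\<dots> = (\<integral>x. \<bar>f m x - g x\<bar> \<partial>M)"
      unfolding M_def using h(2)
          by (subst integral_density) (auto simp: algebra_simps intro!: AE_I2 add_nonneg_nonneg)
    finally show ?thesis using g(3) by simp
  qed
  have diff_nonneg: "0 \<le> (\<integral>x. \<bar>f m x - g' x\<bar> \<partial>\<pi>)" "0 \<le> (\<integral>x. \<bar>f m x - g' x\<bar> \<partial>\<mu>)" by auto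
  have "(\<integral>x. f m x \<partial>\<mu>) \<le> (\<integral>x. g' x + \<bar>f m x - g' x\<bar> \<partial>\<mu>)"
    using f_int g'_int diff_int by (intro integral_mono) auto
  also have "\<dots> = (\<integral>x. g' x \<partial>\<mu>) + (\<integral>x. \<bar>f m x - g' x\<bar> \<partial>\<mu>)"
    using g'_int diff_int by (intro Bochner_Integration.integral_add) auto
  finally have "(\<integral>x. f m x \<partial>\<mu>) - (\<integral>x. g' x \<partial>\<mu>) \<le> (\<integral>x. \<bar>f m x - g' x\<bar> \<partial>\<mu>)" by simp
  then have g'_large: "d' - \<eta> < (\<integral>x. g' x \<partial>\<mu>)"
    using f_large diff diff_nonneg by linarith
  have exp_int: "integrable \<pi> (\<lambda>x. exp (g' x))" and exp_pos: "0 < (\<integral>x. exp (g' x) \<partial>\<pi>)"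
    using integral_exp_bounded[OF \<pi> _ g'_bd] by measurable
  have "(\<integral>x. exp (g' x) \<partial>\<pi>) \<le> (\<integral>x. h x + 1 / (real m + 1) + exp (B m) * \<bar>f m x - g' x\<bar> \<partial>\<pi>)"
  proof (rule integral_mono[OF exp_int])
    fix x
    show "exp (g' x) \<le> h x + 1 / (real m + 1) + exp (B m) * \<bar>f m x - g' x\<bar>"
      using exp_le_exp_add[of "g' x" "B m" "f m x"] f_exp[of m x] g'_bd[of x] by linarith
  qed (use int_h diff_int in auto)
  also have "\<dots> = 1 + 1 / (real m + 1) + exp (B m) * (\<integral>x. \<bar>f m x - g' x\<bar> \<partial>\<pi>)"
    using int_h diff_int \<pi>.prob_space by simp
  also have "\<dots> \<le> 1 + 1 / (real m + 1) + exp (B m) * \<eta>"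
  proof (intro add_left_mono mult_left_mono)
    show "(\<integral>x. \<bar>f m x - g' x\<bar> \<partial>\<pi>) \<le> \<eta>" using diff diff_nonneg by linarith
  qed simp
  finally have "(\<integral>x. exp (g' x) \<partial>\<pi>) \<le> 1 + (1 / (real m + 1) + exp (B m) * \<eta>)" by simp
  with exp_pos have "ln (\<integral>x. exp (g' x) \<partial>\<pi>) \<le> ln (1 + (1 / (real m + 1) + exp (B m) * \<eta>))"
    by (subst ln_le_cancel_iff) auto
  also have "\<dots> \<le> 1 / (real m + 1) + exp (B m) * \<eta>"
    using \<eta>(1) by (intro ln_add_one_self_le_self) auto
  finally have "d < (\<integral>x. g' x \<partial>\<mu>) - ln (\<integral>x. exp (g' x) \<partial>\<pi>)"
    using g'_large \<eta>(2) m(2) unfolding \<delta>_def by argo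
  then show ?thesis using g'_cont g'_bd that by blast
qed

text \<open>Bounded continuous f are what the upper bound needs: such an f defines a weakly open
  neighbourhood of \<mu>, on which Chernoff's inequality gives the rate d.\<close>

lemma variational_relative_entropy:
  fixes \<mu> \<pi> :: "'a::polish_space measure"
  assumes "\<mu> \<in> borel_probs" "\<pi> \<in> borel_probs" "ereal d < relative_entropy \<mu> \<pi>"
  obtains f :: "'a \<Rightarrow> real" and B where "continuous_on UNIV f" "\<And>x. \<bar>f x\<bar> \<le> B"
    "d < (\<integral>x. f x \<partial>\<mu>) - ln (\<integral>x. exp (f x) \<partial>\<pi>)"
  using variational_absolutely_continuous[OF assms(1,2) _ assms(3)]
    variational_not_absolutely_continuous[OF assms(1,2)] by metis

section \<open>Empirical measures of independent samples\<close>

lemma sets_empirical [simp]: "sets (empirical n x) = sets borel"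
  unfolding empirical_def using sets.sigma_sets_eq[of borel] by simp

text \<open>Reading the average of point masses as the law of x at a uniformly random index gives
  total mass 1 and turns integrals into averages. For n = 0 there would be no index to
  choose.\<close>

lemma empirical_eq_distr:
  assumes "n \<ge> 1"
  shows "empirical n x = distr (measure_pmf (pmf_of_set {..<n})) borel x"
proof (rule measure_eqI)
  fix A assume "A \<in> sets (empirical n x)"
  then have A: "A \<in> sets borel" by simp
  have ne: "{..<n} \<noteq> {}" using assms by (simp add: lessThan_empty_iff)
  have "(\<Sum>i<n. indicator A (x i) :: ennreal) = of_nat (card ({..<n} \<inter> x -` A))"
    by (simp add: indicator_def sum.If_cases Int_def)
  then show "emeasure (empirical n x) A =
      emeasure (distr (measure_pmf (pmf_of_set {..<n})) borel x) A"
    using A assms ne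
    by (simp add: emeasure_empirical emeasure_distr emeasure_pmf_of_set
        ennreal_of_nat_eq_real_of_nat divide_ennreal)
qed simp

lemma empirical_borel_probs: "n \<ge> 1 \<Longrightarrow> empirical n x \<in> borel_probs"
  unfolding borel_probs_iff
  by (simp add: empirical_eq_distr measure_pmf.prob_space_distr)

lemma integral_empirical:
  fixes f :: "'a::topological_space \<Rightarrow> real"
  assumes "n \<ge> 1" "f \<in> borel_measurable borel"
  shows "(\<integral>y. f y \<partial>empirical n x) = (\<Sum>i<n. f (x i)) / real n"
proof -
  have "{..<n} \<noteq> {}" using assms by (simp add: lessThan_empty_iff)
  then show ?thesis
    using assms by (simp add: empirical_eq_distr integral_distr integral_pmf_of_set)
qed

lemma sets_power_measure:
  "\<mu> \<in> borel_probs \<Longrightarrow> sets (power_measure n \<mu>) = sets (power_borel n)"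
  by (intro sets_PiM_cong) (auto simp: borel_probs_iff)

lemma space_power_measure:
  "\<mu> \<in> borel_probs \<Longrightarrow> space (power_measure n \<mu>) = space (power_borel n)"
  by (intro sets_eq_imp_space_eq sets_power_measure)

lemma measurable_power_measure:
  "\<mu> \<in> borel_probs \<Longrightarrow> measurable (power_measure n \<mu>) N = measurable (power_borel n) N"
  by (intro measurable_cong_sets sets_power_measure refl)

lemma prob_space_power_measure: "\<mu> \<in> borel_probs \<Longrightarrow> prob_space (power_measure n \<mu>)"
  by (intro prob_space_PiM) (auto simp: borel_probs_iff)

lemma measurable_sum_coordinates [measurable]:
  fixes f :: "'a::topological_space \<Rightarrow> real"
  assumes [measurable]: "f \<in> borel_measurable borel"
  shows "(\<lambda>x. \<Sum>i<n. f (x i)) \<in> borel_measurable (power_borel n)"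
proof (intro borel_measurable_sum)
  fix i assume "i \<in> {..<n}"
  then show "(\<lambda>x. f (x i)) \<in> borel_measurable (power_borel n)" by measurable
qed

abbreviation empirical_in :: "nat \<Rightarrow> 'a::topological_space measure set \<Rightarrow> (nat \<Rightarrow> 'a) set" where
  "empirical_in n A \<equiv> {x \<in> space (power_borel n). empirical n x \<in> A}"

lemma empirical_weak_basic_measurable:
  assumes "n \<ge> 1"
  shows "empirical_in n (weak_basic ps) \<in> sets (power_borel n)"
proof -
  have "empirical_in n (weak_subbasic p) \<in> sets (power_borel n)" for p
  proof -
    obtain l q where p: "p = (l, q)" by (cases p)
    have "empirical_in n (weak_subbasic p) =
      {x \<in> space (power_borel n). real_of_rat q < (\<Sum>i<n. plateau_max l (x i)) / real n}"
      using assms by (simp add: p weak_subbasic_def empirical_borel_probs integral_empirical)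
    also have "\<dots> \<in> sets (power_borel n)" by measurable
    finally show ?thesis .
  qed
  then have "{x \<in> space (power_borel n). \<forall>p\<in>set ps. empirical n x \<in> weak_subbasic p} \<in>
      sets (power_borel n)"
    by (intro sets.sets_Collect_finite_All) auto
  then show ?thesis
    using assms by (simp add: weak_basic_def empirical_borel_probs)
qed

text \<open>An open set is the union of the basic sets it contains, and there are only countably
  many of those.\<close>

lemma empirical_openin_measurable:
  fixes A :: "'a::polish_space measure set"
  assumes "n \<ge> 1" "openin weak_topology A"
  shows "empirical_in n A \<in> sets (power_borel n)"
proof -
  have "empirical_in n A =
    (\<Union>ps\<in>{ps. weak_basic ps \<subseteq> A}. empirical_in n (weak_basic ps))"
    using weak_basic_nhd[OF assms(2)] by blast
  also have "\<dots> \<in> sets (power_borel n)"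
    by (intro sets.countable_UN') (use empirical_weak_basic_measurable[OF assms(1)] in auto)
  finally show ?thesis .
qed

lemma sets_borel_of_topology: "sets (borel_of_topology T) = sigma_sets (topspace T) {U. openin T U}"
  unfolding borel_of_topology_def by (intro sets_measure_of) (auto dest: openin_subset)

lemma space_borel_of_topology: "space (borel_of_topology T) = topspace T"
  unfolding borel_of_topology_def by (intro space_measure_of) (auto dest: openin_subset)

lemma openin_borel_of_topology: "openin T U \<Longrightarrow> U \<in> sets (borel_of_topology T)"
  unfolding sets_borel_of_topology by auto

lemma closedin_borel_of_topology: "closedin T C \<Longrightarrow> C \<in> sets (borel_of_topology T)"
  using sets.compl_sets[OF openin_borel_of_topology[of T "topspace T - C"]]
  by (auto simp: closedin_def space_borel_of_topology double_diff)

lemma measurable_empirical: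
  assumes "n \<ge> 1"
  shows "empirical n \<in> measurable (power_borel n) (borel_of_topology (weak_topology :: 'a::polish_space measure topology))"
  unfolding borel_of_topology_def
proof (rule measurable_sigma_sets)
  show "{U. openin (weak_topology :: 'a measure topology) U} \<subseteq> Pow (topspace weak_topology)"
    using openin_subset by blast
  show "empirical n \<in> space (power_borel n) \<rightarrow> topspace (weak_topology :: 'a measure topology)"
    using assms by (auto intro: empirical_borel_probs)
  fix U assume "U \<in> {U. openin (weak_topology :: 'a measure topology) U}"
  then show "empirical n -` U \<inter> space (power_borel n) \<in> sets (power_borel n)"
    using empirical_openin_measurable[OF assms, of U] by (simp add: vimage_def Int_def conj_commute)
qed (intro sets_measure_of, use openin_subset in blast)

section \<open>Independent samples: Chernoff bounds, law of large numbers, densities\<close>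

lemma power_measure_prod:
  fixes f :: "'a::topological_space \<Rightarrow> ennreal"
  assumes "\<mu> \<in> borel_probs" "f \<in> borel_measurable borel"
  shows "(\<integral>\<^sup>+x. (\<Prod>i<n. f (x i)) \<partial>power_measure n \<mu>) = (\<integral>\<^sup>+x. f x \<partial>\<mu>) ^ n"
proof -
  interpret prob_space \<mu> using assms by (simp add: borel_probs_iff)
  interpret product_sigma_finite "\<lambda>_::nat. \<mu>"
    by (simp add: product_sigma_finite_def sigma_finite_measure_axioms)
  show ?thesis
    using assms by (subst product_nn_integral_prod) auto
qed

text \<open>The exponential of the excess dominates the indicator and factorizes over the
  coordinates. A tilting parameter is absorbed by scaling f and c together.\<close>

lemma power_measure_Chernoff:
  fixes f :: "'a::topological_space \<Rightarrow> real"
  assumes \<mu>: "\<mu> \<in> borel_probs" and f: "f \<in> borel_measurable borel"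
  shows "emeasure (power_measure n \<mu>) {x \<in> space (power_borel n). real n * c \<le> (\<Sum>i<n. f (x i))} \<le>
    (\<integral>\<^sup>+x. ennreal (exp (f x - c)) \<partial>\<mu>) ^ n"
proof -
  let ?A = "{x \<in> space (power_borel n). real n * c \<le> (\<Sum>i<n. f (x i))}"
  note [measurable] = f
  have [measurable]: "?A \<in> sets (power_borel n)" by measurable
  have "emeasure (power_measure n \<mu>) ?A = (\<integral>\<^sup>+x. indicator ?A x \<partial>power_measure n \<mu>)"
    using sets_power_measure[OF \<mu>] by (intro nn_integral_indicator[symmetric]) auto
  also have "\<dots> \<le> (\<integral>\<^sup>+x. (\<Prod>i<n. ennreal (exp (f (x i) - c))) \<partial>power_measure n \<mu>)"
  proof (intro nn_integral_mono)
    fix x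
    have eq: "(\<Prod>i<n. ennreal (exp (f (x i) - c))) = ennreal (exp ((\<Sum>i<n. f (x i)) - real n * c))"
      by (simp add: prod_ennreal exp_sum[symmetric] sum_subtractf)
    show "indicator ?A x \<le> (\<Prod>i<n. ennreal (exp (f (x i) - c)))"
      unfolding eq by (auto simp: indicator_def ennreal_1[symmetric] simp del: ennreal_1 intro!:
          ennreal_leI)
  qed
  also have "\<dots> = (\<integral>\<^sup>+x. ennreal (exp (f x - c)) \<partial>\<mu>) ^ n"
    using \<mu> by (intro power_measure_prod) auto
  finally show ?thesis .
qed

lemma power_measure_law_of_large_numbers:
  fixes f :: "'a::topological_space \<Rightarrow> real"
  assumes \<mu>: "\<mu> \<in> borel_probs" and f: "f \<in> borel_measurable borel" "\<And>x. \<bar>f x\<bar> \<le> B"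
    and q: "(\<integral>x. f x \<partial>\<mu>) < q"
  shows "(\<lambda>n. measure (power_measure n \<mu>) {x \<in> space (power_borel n). real n * q \<le>
      (\<Sum>i<n. f (x i))}) \<longlonglongrightarrow> 0"
proof -
  interpret prob_space \<mu> using \<mu> by (simp add: borel_probs_iff)
  define K where "K = max B 1"
  have "K > 0" by (simp add: K_def)
  define m where "m = (\<integral>x. f x \<partial>\<mu>)"
  \<comment> \<open>The minimiser of the exponent s (m - q) + s^2 (2 K)^2 / 8 from Hoeffding's
    lemma; the minimum is - (q - m)^2 / (2 K^2).\<close>
  define s where "s = (q - m) / K\<^sup>2"
  have "s > 0" using q \<open>K > 0\<close> by (simp add: s_def m_def)
  have bd: "interval_bounded_random_variable \<mu> f (- K) K"
  proof
    show "random_variable borel f" using \<mu> f by simp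
    show "AE x in \<mu>. f x \<in> {- K..K}"
    proof (intro AE_I2)
      fix x
      have "\<bar>f x\<bar> \<le> K" using f(2)[of x] by (simp add: K_def le_max_iff_disj)
      then show "f x \<in> {- K..K}" by auto
    qed
  qed
  have "(\<integral>\<^sup>+x. ennreal (exp (s * f x - s * q)) \<partial>\<mu>) =
      (\<integral>\<^sup>+x. ennreal (exp (s * (m - q))) * ennreal (exp (s * (f x - m))) \<partial>\<mu>)"
    by (intro nn_integral_cong) (simp add: algebra_simps flip: ennreal_mult exp_add)
  also have "\<dots> = ennreal (exp (s * (m - q))) * (\<integral>\<^sup>+x. ennreal (exp (s * (f x - m))) \<partial>\<mu>)"
    using \<mu> f by (intro nn_integral_cmult) auto
  also have "\<dots> \<le> ennreal (exp (s * (m - q))) * ennreal (exp (s\<^sup>2 * (K - - K)\<^sup>2 / 8))"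
    using interval_bounded_random_variable.Hoeffdings_lemma_nn_integral[OF bd \<open>s > 0\<close>]
    by (intro mult_left_mono) (auto simp: m_def)
  also have "\<dots> = ennreal (exp (- (q - m)\<^sup>2 / (2 * K\<^sup>2)))"
  proof -
    have "s * (m - q) + s\<^sup>2 * (K - - K)\<^sup>2 / 8 = - (q - m)\<^sup>2 / (2 * K\<^sup>2)"
      using \<open>K > 0\<close> by (simp add: s_def power2_eq_square field_simps)
    then show ?thesis by (simp flip: ennreal_mult exp_add)
  qed
  finally have r: "(\<integral>\<^sup>+x. ennreal (exp (s * f x - s * q)) \<partial>\<mu>) \<le>
      ennreal (exp (- (q - m)\<^sup>2 / (2 * K\<^sup>2)))" .
  have bound: "measure (power_measure n \<mu>) {x \<in> space (power_borel n). real n * q \<le>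
      (\<Sum>i<n. f (x i))} \<le>
      exp (- (q - m)\<^sup>2 / (2 * K\<^sup>2)) ^ n" for n
  proof -
    interpret P: prob_space "power_measure n \<mu>" using \<mu> by (rule prob_space_power_measure)
    have eq: "{x \<in> space (power_borel n). real n * q \<le> (\<Sum>i<n. f (x i))} =
        {x \<in> space (power_borel n). real n * (s * q) \<le> (\<Sum>i<n. s * f (x i))}"
      using \<open>s > 0\<close> by (simp add: sum_distrib_left[symmetric] mult.left_commute)
    have "emeasure (power_measure n \<mu>) {x \<in> space (power_borel n). real n * q \<le> (\<Sum>i<n. f (x i))} \<le>
        (\<integral>\<^sup>+x. ennreal (exp (s * f x - s * q)) \<partial>\<mu>) ^ n"
      unfolding eq using \<mu> f by (intro power_measure_Chernoff) auto
    also have "\<dots> \<le> ennreal (exp (- (q - m)\<^sup>2 / (2 * K\<^sup>2))) ^ n"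
      using r by (intro power_mono) auto
    also have "\<dots> = ennreal (exp (- (q - m)\<^sup>2 / (2 * K\<^sup>2)) ^ n)"
      by (simp add: ennreal_power)
    finally show ?thesis by (simp add: P.emeasure_eq_measure)
  qed
  have "exp (- (q - m)\<^sup>2 / (2 * K\<^sup>2)) < 1"
    using q \<open>K > 0\<close> by (simp add: m_def zero_less_power2)
  then have "(\<lambda>n. exp (- (q - m)\<^sup>2 / (2 * K\<^sup>2)) ^ n) \<longlonglongrightarrow> 0"
    by (intro LIMSEQ_realpow_zero) auto
  then show ?thesis
    by (rule tendsto_sandwich[OF _ _ tendsto_const, rotated 2]) (use bound in auto)
qed

text \<open>A basic set around \<mu> inside A is given by finitely many strict bounds. Each fails
  for the sample with probability tending to 0, and a union bound collects them.\<close>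

lemma empirical_measures_converge:
  fixes A :: "'a::polish_space measure set"
  assumes A: "openin weak_topology A" "\<mu> \<in> A"
  shows "(\<lambda>n. measure (power_measure n \<mu>) (empirical_in n A)) \<longlonglongrightarrow> 1"
proof -
  have \<mu>: "\<mu> \<in> borel_probs" using openin_subset[OF A(1)] A(2) by auto
  obtain ps where ps: "\<mu> \<in> weak_basic ps" "weak_basic ps \<subseteq> A" using weak_basic_nhd[OF A] by blast
  \<comment> \<open>The signs are reversed because the law of large numbers above controls upper
    deviations, whereas a subbasic set fails when an average is too low.\<close>
  define bad :: "nat \<Rightarrow> (nat \<times> rat \<times> rat) list \<times> rat \<Rightarrow> (nat \<Rightarrow> 'a) set"
    where "bad n p = {x \<in> space (power_borel n).
      real n * (- real_of_rat (snd p)) \<le> (\<Sum>i<n. - plateau_max (fst p) (x i))}" for n p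
  have bad_sets [measurable]: "bad n p \<in> sets (power_borel n)" for n p unfolding bad_def
      by measurable
  have "(\<lambda>n. measure (power_measure n \<mu>) (bad n p)) \<longlonglongrightarrow> 0" if "p \<in> set ps" for p
  proof -
    have "\<mu> \<in> weak_subbasic p" using ps(1) that by (auto simp: weak_basic_def)
    then have "real_of_rat (snd p) < (\<integral>x. plateau_max (fst p) x \<partial>\<mu>)"
      by (auto simp: weak_subbasic_def split: prod.splits)
    moreover obtain B where "\<And>x::'a. \<bar>plateau_max (fst p) x\<bar> \<le> B" using plateau_max_bounded by blast
    ultimately show ?thesis
      unfolding bad_def by (intro power_measure_law_of_large_numbers[OF \<mu>, where B = B]) auto
  qed
  then have lim: "(\<lambda>n. 1 - (\<Sum>p\<in>set ps. measure (power_measure n \<mu>) (bad n p))) \<longlonglongrightarrow> 1 - (\<Sum>p\<in>set ps. 0)"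
    by (intro tendsto_intros)
  have lower: "1 - (\<Sum>p\<in>set ps. measure (power_measure n \<mu>) (bad n p)) \<le>
      measure (power_measure n \<mu>) (empirical_in n A)" if "n \<ge> 1" for n
  proof -
    interpret P: prob_space "power_measure n \<mu>" using \<mu> by (rule prob_space_power_measure)
    let ?A = "empirical_in n A"
    have sets: "?A \<in> P.events" "bad n p \<in> P.events" for p
      using empirical_openin_measurable[OF that A(1)] bad_sets
          by (auto simp: sets_power_measure[OF \<mu>])
    have "space (power_measure n \<mu>) - ?A \<subseteq> (\<Union>p\<in>set ps. bad n p)"
    proof
      fix x assume x: "x \<in> space (power_measure n \<mu>) - ?A"
      then have "empirical n x \<notin> weak_basic ps" using ps(2)
          by (auto simp: space_power_measure[OF \<mu>])
      then obtain p where p: "p \<in> set ps" "empirical n x \<notin> weak_subbasic p"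
        using empirical_borel_probs[OF \<open>n \<ge> 1\<close>, of x] by (auto simp: weak_basic_def)
      then have "\<not> real_of_rat (snd p) < (\<Sum>i<n. plateau_max (fst p) (x i)) / real n"
        using that empirical_borel_probs[OF that, of x]
        by (auto simp: weak_subbasic_def integral_empirical split: prod.splits)
      then have "x \<in> bad n p"
        using that x by (simp add: bad_def space_power_measure[OF \<mu>] sum_negf field_simps)
      then show "x \<in> (\<Union>p\<in>set ps. bad n p)" using p(1) by blast
    qed
    then have "P.prob (space (power_measure n \<mu>) - ?A) \<le> P.prob (\<Union>p\<in>set ps. bad n p)"
      using sets by (intro P.finite_measure_mono) auto
    also have "\<dots> \<le> (\<Sum>p\<in>set ps. P.prob (bad n p))"
      using sets by (intro P.finite_measure_subadditive_finite) auto
    finally show ?thesis using P.prob_compl[OF sets(1)] by simp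
  qed
  have upper: "measure (power_measure n \<mu>) (empirical_in n A) \<le> 1" for n
    using prob_space.prob_le_1[OF prob_space_power_measure[OF \<mu>]] .
  show ?thesis
    by (rule tendsto_sandwich[OF _ _ lim[simplified] tendsto_const])
      (use lower upper in \<open>auto simp: eventually_sequentially\<close>)
qed

lemma power_measure_density:
  fixes h :: "'a::topological_space \<Rightarrow> real"
  assumes \<pi>: "\<pi> \<in> borel_probs" and h: "h \<in> borel_measurable borel" "\<And>x. 0 \<le> h x"
    and \<mu>: "\<mu> \<in> borel_probs" "\<mu> = density \<pi> (\<lambda>x. ennreal (h x))"
  shows "power_measure n \<mu> = density (power_measure n \<pi>) (\<lambda>x. \<Prod>i<n. ennreal (h (x i)))"
proof -
  interpret \<pi>: prob_space \<pi> using \<pi> by (simp add: borel_probs_iff)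
  interpret \<mu>: prob_space \<mu> using \<mu> by (simp add: borel_probs_iff)
  interpret P: product_sigma_finite "\<lambda>_::nat. \<mu>"
    by (simp add: product_sigma_finite_def \<mu>.sigma_finite_measure_axioms)
  interpret Q: product_sigma_finite "\<lambda>_::nat. \<pi>"
    by (simp add: product_sigma_finite_def \<pi>.sigma_finite_measure_axioms)
  have [measurable]: "h \<in> borel_measurable \<pi>" using h \<pi> by simp
  have sets: "sets \<mu> = sets \<pi>" using \<mu> \<pi> by (simp add: borel_probs_iff)
  have meas: "(\<lambda>x. \<Prod>i<n. ennreal (h (x i))) \<in> borel_measurable (power_measure n \<pi>)"
    by measurable
  have "density (power_measure n \<pi>) (\<lambda>x. \<Prod>i<n. ennreal (h (x i))) = power_measure n \<mu>"
  proof (rule P.PiM_eqI)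
    show "sets (density (power_measure n \<pi>) (\<lambda>x. \<Prod>i<n. ennreal (h (x i)))) =
        sets (power_measure n \<mu>)"
      by (simp add: sets_power_measure \<mu>(1) \<pi>)
    fix A assume A: "\<And>i. i \<in> {..<n} \<Longrightarrow> A i \<in> sets \<mu>"
    then have A' [measurable]: "\<And>i. i \<in> {..<n} \<Longrightarrow> A i \<in> sets \<pi>" by (simp add: sets)
    have "emeasure (density (power_measure n \<pi>) (\<lambda>x. \<Prod>i<n. ennreal (h (x i)))) (Pi\<^sub>E {..<n} A) =
        (\<integral>\<^sup>+x. (\<Prod>i<n. ennreal (h (x i))) * indicator (Pi\<^sub>E {..<n} A) x \<partial>power_measure n \<pi>)"
      using A' by (intro emeasure_density meas sets_PiM_I_finite) auto
    also have "\<dots> = (\<integral>\<^sup>+x. (\<Prod>i<n. ennreal (h (x i)) * indicator (A i) (x i)) \<partial>power_measure n \<pi>)"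
    proof (intro nn_integral_cong)
      fix x assume "x \<in> space (power_measure n \<pi>)"
      then have "(indicator (Pi\<^sub>E {..<n} A) x :: ennreal) = (\<Prod>i<n. indicator (A i) (x i))"
        by (auto simp: indicator_def space_PiM PiE_def Pi_def)
      then show "(\<Prod>i<n. ennreal (h (x i))) * indicator (Pi\<^sub>E {..<n} A) x =
          (\<Prod>i<n. ennreal (h (x i)) * indicator (A i) (x i))"
        by (simp add: prod.distrib)
    qed
    also have "\<dots> = (\<Prod>i<n. \<integral>\<^sup>+y. ennreal (h y) * indicator (A i) y \<partial>\<pi>)"
      using A' by (intro Q.product_nn_integral_prod) auto
    also have "\<dots> = (\<Prod>i<n. emeasure \<mu> (A i))"
      using A' by (intro prod.cong refl) (simp add: \<mu>(2) emeasure_density)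
    finally show "emeasure (density (power_measure n \<pi>) (\<lambda>x. \<Prod>i<n. ennreal (h (x i)))) (Pi\<^sub>E {..<n} A) =
        (\<Prod>i<n. emeasure \<mu> (A i))" .
  qed simp
  then show ?thesis by simp
qed

text \<open>Each coordinate has law \<mu>. With f the logarithm of a density this is the additivity
  of relative entropy over independent coordinates.\<close>

lemma power_measure_marginal:
  fixes f :: "'a::topological_space \<Rightarrow> real"
  assumes \<mu>: "\<mu> \<in> borel_probs" and f: "integrable \<mu> f"
  shows "integrable (power_measure n \<mu>) (\<lambda>x. \<Sum>i<n. f (x i))"
    and "(\<integral>x. (\<Sum>i<n. f (x i)) \<partial>power_measure n \<mu>) = real n * (\<integral>x. f x \<partial>\<mu>)"
proof -
  have distr: "distr (power_measure n \<mu>) \<mu> (\<lambda>x. x i) = \<mu>" if "i < n" for i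
    using \<mu> that by (intro distr_PiM_component) (auto simp: borel_probs_iff)
  have int: "integrable (power_measure n \<mu>) (\<lambda>x. f (x i))" if "i < n" for i
    using f that by (subst integrable_distr_eq[symmetric, where N = \<mu>]) (auto simp: distr)
  then show "integrable (power_measure n \<mu>) (\<lambda>x. \<Sum>i<n. f (x i))" by auto
  have "(\<integral>x. f (x i) \<partial>power_measure n \<mu>) = (\<integral>x. f x \<partial>\<mu>)" if "i < n" for i
  proof -
    have "(\<integral>x. f (x i) \<partial>power_measure n \<mu>) = (\<integral>x. f x \<partial>distr (power_measure n \<mu>) \<mu> (\<lambda>x. x i))"
      using f that by (intro integral_distr[symmetric]) auto
    then show ?thesis using distr[OF that] by simp
  qed
  then show "(\<integral>x. (\<Sum>i<n. f (x i)) \<partial>power_measure n \<mu>) = real n * (\<integral>x. f x \<partial>\<mu>)"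
    using int by (subst Bochner_Integration.integral_sum) auto
qed

section \<open>Lower bounds on open sets\<close>

lemma exp_ereal_simps [simp]:
  "exp_ereal (ereal r) = ennreal (exp r)" "exp_ereal \<infinity> = \<infinity>" "exp_ereal (-\<infinity>) = 0"
  by (simp_all add: exp_ereal_def)

lemma exp_ereal_mono: "s \<le> t \<Longrightarrow> exp_ereal s \<le> exp_ereal t"
  by (cases s; cases t) (auto intro: ennreal_leI)

lemma borel_measurable_exp_ereal [measurable]: "exp_ereal \<in> borel_measurable borel"
proof -
  have "exp_ereal = (\<lambda>t. if t = \<infinity> then \<infinity> else if t =
      -\<infinity> then 0 else ennreal (exp (real_of_ereal t)))"
  proof
    show "exp_ereal t = (if t = \<infinity> then \<infinity> else if t =
        -\<infinity> then 0 else ennreal (exp (real_of_ereal t)))" for t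
      by (cases t) auto
  qed
  also have "\<dots> \<in> borel_measurable borel" by measurable
  finally show ?thesis .
qed

lemma ennreal_integral_le_nn_integral:
  fixes f :: "'a \<Rightarrow> real"
  assumes "integrable M f"
  shows "ennreal (\<integral>x. f x \<partial>M) \<le> (\<integral>\<^sup>+x. ennreal (f x) \<partial>M)"
proof -
  have "ennreal (\<integral>x. f x \<partial>M) \<le> ennreal (\<integral>x. max 0 (f x) \<partial>M)"
    using assms by (intro ennreal_leI integral_mono) auto
  also have "\<dots> = (\<integral>\<^sup>+x. ennreal (max 0 (f x)) \<partial>M)"
    using assms by (intro nn_integral_eq_integral[symmetric]) auto
  also have "\<dots> = (\<integral>\<^sup>+x. ennreal (f x) \<partial>M)"
    by (intro nn_integral_cong) (auto simp: max_def ennreal_neg)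
  finally show ?thesis .
qed

lemma energy_sequence_measurable:
  "energy_sequence Wn \<Longrightarrow> n \<ge> 1 \<Longrightarrow> Wn n \<in> borel_measurable (power_borel n)"
  by (auto simp: energy_sequence_def)

lemma emeasure_gibbs_measure:
  assumes "\<pi> \<in> borel_probs" "energy_sequence Wn" "n \<ge> 1" "S \<in> sets (power_borel n)"
  shows "emeasure (gibbs_measure \<pi> Wn b n) S =
    (\<integral>\<^sup>+x. exp_ereal (- (ereal (real n * b n) * Wn n x)) * indicator S x \<partial>power_measure n \<pi>)"
proof -
  note [measurable] = energy_sequence_measurable[OF assms(2,3)]
  have "(\<lambda>x. exp_ereal (- (ereal (real n * b n) * Wn n x))) \<in> borel_measurable (power_borel n)"
    by measurable
  then show ?thesis
    unfolding gibbs_measure_def using assms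
    by (intro emeasure_density) (simp_all add: measurable_power_measure sets_power_measure)
qed

lemma sets_gibbs_measure:
  "\<pi> \<in> borel_probs \<Longrightarrow> sets (gibbs_measure \<pi> Wn b n) = sets (power_borel n)"
  by (simp add: gibbs_measure_def sets_power_measure)

lemma space_gibbs_measure:
  "\<pi> \<in> borel_probs \<Longrightarrow> space (gibbs_measure \<pi> Wn b n) = space (power_borel n)"
  by (simp add: gibbs_measure_def space_power_measure)

text \<open>Tilting by the density of \<open>\<mu>\<close> followed by Jensen's inequality for the exponential, applied to
  \<open>\<mu>\<^sup>n\<close> conditioned on \<open>S\<close>.\<close>

lemma gibbs_measure_lower_bound:
  fixes \<pi> \<mu> :: "'a::polish_space measure"
  assumes \<pi>: "\<pi> \<in> borel_probs" and \<mu>: "\<mu> \<in> borel_probs" and Wn: "energy_sequence Wn"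
    and C: "\<And>x. x \<in> space (power_borel n) \<Longrightarrow> ereal (- C) \<le> Wn n x" "0 \<le> C"
    and n: "n \<ge> 1" and bn: "0 < b n"
    and D: "relative_entropy \<mu> \<pi> = ereal D"
    and E: "ereal_integral (power_measure n \<mu>) (Wn n) = ereal E"
    and S: "S \<in> sets (power_borel n)" and p: "p = measure (power_measure n \<mu>) S" "0 < p"
  shows "ennreal (p * exp (- (real n * b n * (E + C * (1 - p)) + real n * D + 1) / p)) \<le>
    emeasure (gibbs_measure \<pi> Wn b n) S"
proof -
  define v where "v = real n * b n"
  have "v > 0" using n bn by (simp add: v_def)
  have "absolutely_continuous \<pi> \<mu>" using D by (auto simp: relative_entropy_def split: if_splits)
  from relative_entropy_density[OF \<mu> \<pi> this] obtain h :: "'a \<Rightarrow> real" where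
    h: "h \<in> borel_measurable borel" "\<And>x. 0 \<le> h x" "\<mu> = density \<pi> (\<lambda>x. ennreal (h x))"
    and Dh: "relative_entropy \<mu> \<pi> = ereal_integral \<pi> (\<lambda>x. ereal (h x * ln (h x)))" by blast
  note [measurable] = h(1) energy_sequence_measurable[OF Wn n] S
  have meas\<pi>: "borel_measurable \<pi> = borel_measurable borel" using \<pi> by simp
  interpret \<pi>: prob_space \<pi> using \<pi> by (simp add: borel_probs_iff)
  define P where "P = power_measure n \<pi>"
  define Q where "Q = power_measure n \<mu>"
  interpret P: prob_space P unfolding P_def using \<pi> by (rule prob_space_power_measure)
  interpret Q: prob_space Q unfolding Q_def using \<mu> by (rule prob_space_power_measure)
  have measP: "measurable P N = measurable (power_borel n) N"
    and measQ: "measurable Q N = measurable (power_borel n) N" for N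
    unfolding P_def Q_def using \<pi> \<mu> by (simp_all add: measurable_power_measure)
  have spP: "space P = space (power_borel n)" and spQ: "space Q = space (power_borel n)"
    unfolding P_def Q_def using \<pi> \<mu> by (simp_all add: space_power_measure)
  have SPQ: "S \<in> P.events" "S \<in> Q.events"
    unfolding P_def Q_def using S \<pi> \<mu> by (auto simp: sets_power_measure)
  define H where "H x = (\<Prod>i<n. h (x i))" for x
  define L where "L x = (\<Sum>i<n. ln (h (x i)))" for x
  have H_meas [measurable]: "H \<in> borel_measurable (power_borel n)"
    unfolding H_def by (intro borel_measurable_prod) measurable
  have L_meas [measurable]: "L \<in> borel_measurable (power_borel n)"
    unfolding L_def by (rule measurable_sum_coordinates) measurable
  have H_nonneg: "0 \<le> H x" for x unfolding H_def using h(2) by (intro prod_nonneg) auto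
  \<comment> \<open>Since \<open>ln 0 = 0\<close>, L is finite but meaningless where some factor
    vanishes; there H is 0, so such points are \<open>Q\<close>-null.\<close>
  have HL: "H x = 0 \<or> H x = exp (L x)" for x
  proof (cases "\<exists>i<n. h (x i) = 0")
    case False
    then have "0 < h (x i)" if "i < n" for i using h(2)[of "x i"] that by (auto simp: less_le)
    then have "exp (L x) = H x"
      unfolding L_def H_def by (simp add: exp_sum)
    then show ?thesis by simp
  qed (auto simp: H_def)
  have QP: "Q = density P (\<lambda>x. ennreal (H x))"
    unfolding Q_def P_def H_def power_measure_density[OF \<pi> h(1,2) \<mu> h(3)]
    using h(2) by (simp add: prod_ennreal)
  define \<phi> where "\<phi> x = ereal (h x * ln (h x))" for x
  have ge: "-1 \<le> h x * ln (h x)" for x using mult_ln_ge[OF h(2)[of x]] h(2)[of x] by linarith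
  have \<phi>: "\<phi> \<in> borel_measurable \<pi>" "\<And>x. ereal (- 1) \<le> \<phi> x" "ereal_integral \<pi> \<phi> < \<infinity>"
    using ge D Dh unfolding meas\<pi> \<phi>_def[abs_def] by simp_all
  have \<phi>_int: "integrable \<pi> (\<lambda>x. h x * ln (h x))" "(\<integral>x. h x * ln (h x) \<partial>\<pi>) = D"
    using ereal_integral_finite(2,3)[OF \<pi>.prob_space_axioms \<phi>(1), of 1] \<phi>(2,3) D Dh
    unfolding \<phi>_def[abs_def] by simp_all
  have ln_int: "integrable \<mu> (\<lambda>x. ln (h x))" "(\<integral>x. ln (h x) \<partial>\<mu>) = D"
    using \<phi>_int h(2) by (simp_all add: h(3) integrable_real_density integral_real_density meas\<pi>)
  have L_int: "integrable Q L" "(\<integral>x. L x \<partial>Q) = real n * D"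
    unfolding Q_def L_def using power_measure_marginal[OF \<mu> ln_int(1)] ln_int(2) by auto
  define w where "w x = real_of_ereal (Wn n x)" for x
  have W_cond: "Wn n \<in> borel_measurable Q" "\<And>x. x \<in> space Q \<Longrightarrow> ereal (- C) \<le> Wn n x"
    "ereal_integral Q (Wn n) < \<infinity>"
    using energy_sequence_measurable[OF Wn n] C E by (auto simp: measQ spQ Q_def[symmetric])
  note W_fin = ereal_integral_finite[OF Q.prob_space_axioms W_cond(1,2) C(2) W_cond(3), folded
      w_def]
  have W_ae: "AE x in Q. Wn n x = ereal (w x)" by (rule W_fin(1))
  have w_int: "integrable Q w" "(\<integral>x. w x \<partial>Q) = E"
    using W_fin(2,3) E by (auto simp: Q_def[symmetric])
  have w_ge: "- C \<le> w x" if "x \<in> space Q" for x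
    using W_cond(2)[OF that] C(2) by (cases "Wn n x") (auto simp: w_def)
  define g where "g x = v * w x + L x" for x
  have g_int: "integrable Q g" unfolding g_def using w_int L_int by auto
  have gS_int: "integrable Q (\<lambda>x. g x * indicator S x)"
    using g_int SPQ by (intro integrable_real_mult_indicator) auto
  have iS: "integrable Q (indicator S :: _ \<Rightarrow> real)"
    using SPQ by (intro integrable_real_indicator) (auto simp: Q.emeasure_eq_measure)
  define X where "X = (\<integral>x. g x * indicator S x \<partial>Q)"
  have pQ: "(\<integral>x. indicator S x \<partial>Q) = p"
    using p(1) SPQ sets.sets_into_space[OF SPQ(2)] by (simp add: Q_def Int_absorb2)
  have "p \<le> 1" unfolding p(1) Q_def[symmetric] by (rule Q.prob_le_1)
  \<comment> \<open>Passing from all of M^n to S brings in what happens outside S. The energy is at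
    least -C there, giving C (1 - p); the integral of L there is at least -1, because H ln H \<ge>
    -1 and P has mass 1.\<close>
  have X_le: "X \<le> v * (E + C * (1 - p)) + real n * D + 1"
  proof -
    have Hint: "integrable P (\<lambda>x. H x * L x)"
      using L_int(1) H_nonneg
      by (subst (asm) QP, subst (asm) integrable_real_density) (auto simp: measP)
    have "(\<integral>x. - L x * indicator (space Q - S) x \<partial>Q) \<le> 1"
    proof -
      have "(\<integral>x. - L x * indicator (space Q - S) x \<partial>Q) =
          (\<integral>x. H x * (- L x * indicator (space Q - S) x) \<partial>P)"
        using H_nonneg SPQ by (subst QP, subst integral_real_density) (auto simp: measP spP spQ)
      also have "\<dots> \<le> (\<integral>x. 1 \<partial>P)"
      proof (rule integral_mono)
        show "integrable P (\<lambda>x. H x * (- L x * indicator (space Q - S) x))"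
          using integrable_real_mult_indicator[OF sets.compl_sets[OF SPQ(1)]
              Bochner_Integration.integrable_minus[OF Hint]]
          by (simp add: spP spQ mult.assoc)
        show "H x * (- L x * indicator (space Q - S) x) \<le> 1" for x
        proof -
          have "H x * L x = H x * ln (H x)" using HL[of x] by auto
          then have "- (H x * L x) \<le> 1"
            using mult_ln_ge[OF H_nonneg[of x]] H_nonneg[of x] by linarith
          then show ?thesis by (auto simp: indicator_def)
        qed
      qed auto
      finally show ?thesis using P.prob_space by simp
    qed
    moreover have "(\<integral>x. L x * indicator S x \<partial>Q) =
        (\<integral>x. L x + - L x * indicator (space Q - S) x \<partial>Q)"
      by (intro Bochner_Integration.integral_cong) (auto simp: indicator_def)
    moreover have "\<dots> = real n * D + (\<integral>x. - L x * indicator (space Q - S) x \<partial>Q)"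
      using L_int SPQ(2) by (subst Bochner_Integration.integral_add)
        (auto intro!: integrable_real_mult_indicator)
    ultimately have 1: "(\<integral>x. L x * indicator S x \<partial>Q) \<le> real n * D + 1" by simp
    have "(\<integral>x. w x * indicator S x \<partial>Q) \<le> (\<integral>x. w x + C * (1 - indicator S x) \<partial>Q)"
    proof (intro integral_mono)
      show "integrable Q (\<lambda>x. w x * indicator S x)"
        using w_int(1) SPQ(2) by (intro integrable_real_mult_indicator)
      show "integrable Q (\<lambda>x. w x + C * (1 - indicator S x))"
        using w_int(1) iS by auto
      show "w x * indicator S x \<le> w x + C * (1 - indicator S x)" if "x \<in> space Q" for x
        using w_ge[OF that] by (simp add: indicator_def)
    qed
    also have "\<dots> = E + C * (1 - p)"
      using w_int iS pQ Q.prob_space by simp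
    finally have "v * (\<integral>x. w x * indicator S x \<partial>Q) \<le> v * (E + C * (1 - p))"
      using \<open>v > 0\<close> by (intro mult_left_mono) auto
    moreover have "X = v * (\<integral>x. w x * indicator S x \<partial>Q) + (\<integral>x. L x * indicator S x \<partial>Q)"
      unfolding X_def g_def using w_int(1) L_int(1) SPQ(2)
      by (simp add: distrib_right mult.assoc integrable_real_mult_indicator)
    ultimately show ?thesis using 1 by linarith
  qed
  \<comment> \<open>The conditional mean of g on S under Q. The tangent to exp (- g) at c integrates
    over S to exactly p exp (- c), which is Jensen's inequality without constructing the conditioned
    measure.\<close>
  define c where "c = X / p"
  have "ennreal (p * exp (- (v * (E + C * (1 - p)) + real n * D + 1) / p)) \<le>
      ennreal (p * exp (- c))"
    using X_le p(2) unfolding c_def minus_divide_left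
    by (intro ennreal_leI mult_left_mono iffD2[OF exp_le_cancel_iff] divide_right_mono) auto
  also have "p * exp (- c) = (\<integral>x. exp (- c) * ((1 + c) * indicator S x - g x * indicator S x) \<partial>Q)"
  proof -
    have "(\<integral>x. exp (- c) * ((1 + c) * indicator S x - g x * indicator S x) \<partial>Q) =
        exp (- c) * ((1 + c) * p - X)"
      using gS_int iS pQ by (simp add: X_def)
    also have "(1 + c) * p - X = p" using p(2) by (simp add: c_def field_simps)
    finally show ?thesis by simp
  qed
  also have "ennreal \<dots> \<le>
      (\<integral>\<^sup>+x. ennreal (exp (- c) * ((1 + c) * indicator S x - g x * indicator S x)) \<partial>Q)"
    using gS_int iS by (intro ennreal_integral_le_nn_integral) auto
  also have "\<dots> \<le> (\<integral>\<^sup>+x. ennreal (exp (- L x)) *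
      (exp_ereal (- (ereal v * Wn n x)) * indicator S x) \<partial>Q)"
  proof (rule nn_integral_mono_AE)
    show "AE x in Q. ennreal (exp (- c) * ((1 + c) * indicator S x - g x * indicator S x)) \<le>
        ennreal (exp (- L x)) * (exp_ereal (- (ereal v * Wn n x)) * indicator S x)"
      using W_ae
    proof eventually_elim
      case (elim x)
      have "exp_ereal (- (ereal v * Wn n x)) = ennreal (exp (- v * w x))"
        by (subst elim) simp
      then have eq: "ennreal (exp (- L x)) * exp_ereal (- (ereal v * Wn n x)) =
          ennreal (exp (- g x))"
        by (simp add: g_def flip: ennreal_mult exp_add)
      have "exp (- c) * (1 + (c - g x)) \<le> exp (- c) * exp (c - g x)"
        by (intro mult_left_mono exp_ge_add_one_self) auto
      also have "\<dots> = exp (- g x)" by (simp flip: exp_add)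
      finally have "ennreal (exp (- c) * (1 + c - g x)) \<le> ennreal (exp (- g x))"
        by (intro ennreal_leI) (simp add: algebra_simps)
      then show ?case
        unfolding mult.assoc[symmetric] eq by (auto simp: indicator_def)
    qed
  qed
  also have "\<dots> = (\<integral>\<^sup>+x. ennreal (H x) *
      (ennreal (exp (- L x)) * (exp_ereal (- (ereal v * Wn n x)) * indicator S x)) \<partial>P)"
    unfolding QP by (intro nn_integral_density) (simp_all add: measP)
  \<comment> \<open>The product of H and exp (- L) is 1 where H > 0 and 0 elsewhere, so undoing the
    density loses only the part of P where H vanishes.\<close>
  also have "\<dots> \<le> (\<integral>\<^sup>+x. exp_ereal (- (ereal v * Wn n x)) * indicator S x \<partial>P)"
  proof (intro nn_integral_mono)
    fix x
    have "ennreal (H x) * ennreal (exp (- L x)) \<le> 1"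
      using HL[of x] by (auto simp flip: ennreal_mult exp_add)
    then show "ennreal (H x) *
        (ennreal (exp (- L x)) * (exp_ereal (- (ereal v * Wn n x)) * indicator S x)) \<le>
        exp_ereal (- (ereal v * Wn n x)) * indicator S x"
      unfolding mult.assoc[symmetric] using mult_right_mono[of _ 1]
          by (metis mult_1 mult.assoc zero_le)
  qed
  also have "\<dots> = emeasure (gibbs_measure \<pi> Wn b n) S"
    unfolding P_def v_def using emeasure_gibbs_measure[OF \<pi> Wn n S] by simp
  finally show ?thesis unfolding v_def .
qed

text \<open>After division by \<open>v\<^sub>n\<close> the entropy has weight
  \<open>1 / b n\<close>, tending to \<kappa>, while the error terms C (1 - p), 1 and ln p of the
  previous bound vanish because p tends to 1. The entropy must be finite even for \<kappa> = 0,
  since each single n uses it.\<close>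

lemma gibbs_measure_open_lower_bound:
  fixes \<pi> \<mu> :: "'a::polish_space measure"
  assumes \<pi>: "\<pi> \<in> borel_probs" and Wn: "energy_sequence Wn" "stable_sequence Wn"
    and b: "\<And>n. n \<ge> 1 \<Longrightarrow> 0 < b n" "(\<lambda>n. 1 / b n) \<longlonglongrightarrow> \<kappa>"
    and A: "openin weak_topology A" "\<mu> \<in> A"
    and D: "relative_entropy \<mu> \<pi> < \<infinity>" and upper: "upper_limit_at Wn W \<mu>"
    and l: "W \<mu> + ereal \<kappa> * relative_entropy \<mu> \<pi> < ereal l"
  shows "\<forall>\<^sub>F n in sequentially. ennreal (exp (- (real n * b n * l))) \<le>
    emeasure (gibbs_measure \<pi> Wn b n) (empirical_in n A)"
proof -
  have \<mu>: "\<mu> \<in> borel_probs" using openin_subset[OF A(1)] A(2) by auto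
  obtain C0 where C0: "\<And>n x. n \<ge> 1 \<Longrightarrow> x \<in> space (power_borel n) \<Longrightarrow> ereal C0 \<le> Wn n x"
    using Wn(2) unfolding stable_sequence_def by blast
  define C where "C = \<bar>C0\<bar>"
  have C: "ereal (- C) \<le> Wn n x" if "n \<ge> 1" "x \<in> space (power_borel n)" for n x
    using order_trans[OF _ C0[OF that], of "ereal (- C)"] by (simp add: C_def)
  obtain d where d: "relative_entropy \<mu> \<pi> = ereal d"
    using D relative_entropy_nonneg[OF \<mu> \<pi>] by (cases "relative_entropy \<mu> \<pi>") auto
  have "W \<mu> < ereal (l - \<kappa> * d)" using l d by (cases "W \<mu>") auto
  then obtain e where e: "W \<mu> < ereal e" "e < l - \<kappa> * d"
    using ereal_dense2 by (metis less_ereal.simps(1))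
  have "limsup (\<lambda>n. ereal_integral (power_measure n \<mu>) (Wn n)) < ereal e"
    using upper e(1) unfolding upper_limit_at_def by (rule le_less_trans)
  then have E: "\<forall>\<^sub>F n in sequentially. ereal_integral (power_measure n \<mu>) (Wn n) < ereal e"
    by (rule Limsup_lessD)
  define S where "S n = empirical_in n A" for n
  define p where "p n = measure (power_measure n \<mu>) (S n)" for n
  have p: "p \<longlonglongrightarrow> 1" unfolding p_def S_def by (rule empirical_measures_converge[OF A])
  have inv_n: "(\<lambda>n. 1 / real n) \<longlonglongrightarrow> 0" by real_asymp
  \<comment> \<open>Minus the logarithm of the previous lower bound, divided by
    \<open>v\<^sub>n\<close>, with e in place of the expected energy.\<close>
  have "(\<lambda>n. (e + C * (1 - p n) + d * (1 / b n) + (1 / real n) * (1 / b n)) / p n - ln (p n) *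
      ((1 / real n) * (1 / b n)))
      \<longlonglongrightarrow> (e + C * (1 - 1) + d * \<kappa> + 0 * \<kappa>) / 1 - ln 1 * (0 * \<kappa>)"
    by (intro tendsto_intros p b(2) inv_n) auto
  then have lim: "\<forall>\<^sub>F n in sequentially.
      (e + C * (1 - p n) + d * (1 / b n) + (1 / real n) * (1 / b n)) / p n - ln (p n) *
          ((1 / real n) * (1 / b n)) < l"
    using e(2) by (intro order_tendstoD(2)) (auto simp: mult.commute)
  have "\<forall>\<^sub>F n in sequentially. 0 < p n"
    using p by (rule order_tendstoD(1)) simp
  with lim E eventually_ge_at_top[of 1] show ?thesis
  proof eventually_elim
    case (elim n)
    define v where "v = real n * b n"
    have v: "v > 0" "(1 / real n) * (1 / b n) = 1 / v" "real n = v * (1 / b n)"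
      using elim b(1)[of n] by (auto simp: v_def)
    interpret Q: prob_space "power_measure n \<mu>" using \<mu> by (rule prob_space_power_measure)
    have meas: "Wn n \<in> borel_measurable (power_measure n \<mu>)"
      using energy_sequence_measurable[OF Wn(1), of n] elim \<mu>
          by (simp add: measurable_power_measure)
    have ge: "ereal (- C) \<le> Wn n x" if "x \<in> space (power_measure n \<mu>)" for x
      using C[of n x] that elim \<mu> by (simp add: space_power_measure)
    have fin: "ereal_integral (power_measure n \<mu>) (Wn n) < \<infinity>" using elim(2) by auto
    obtain E where E: "ereal_integral (power_measure n \<mu>) (Wn n) = ereal E"
      using ereal_integral_finite(3)[OF Q.prob_space_axioms meas ge _ fin] by (auto simp: C_def)
    have "E < e" using E elim(2) by simp
    have S: "S n \<in> sets (power_borel n)"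
      unfolding S_def using elim A by (intro empirical_openin_measurable) auto
    define R where "R = (v * (E + C * (1 - p n)) + real n * d + 1) / p n"
    have "R - ln (p n) \<le> v * l"
    proof -
      have "R \<le> (v * (e + C * (1 - p n)) + real n * d + 1) / p n"
        unfolding R_def using elim v \<open>E < e\<close>
        by (intro divide_right_mono add_mono mult_left_mono) (auto simp: C_def)
      also have "\<dots> = v * ((e + C * (1 - p n) + d * (1 / b n) + 1 / v) / p n)"
      proof -
        have "v * (e + C * (1 - p n)) + real n * d + 1 =
            v * (e + C * (1 - p n) + d * (1 / b n) + 1 / v)"
          using v(1) unfolding v(3) by (simp add: algebra_simps)
        then show ?thesis by simp
      qed
      finally have "R - ln (p n) \<le>
          v * ((e + C * (1 - p n) + d * (1 / b n) + 1 / v) / p n - ln (p n) * (1 / v))"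
        using v(1) by (simp add: right_diff_distrib)
      also have "\<dots> \<le> v * l"
        using elim(1) v by (intro mult_left_mono) auto
      finally show ?thesis .
    qed
    then have "exp (- (v * l)) \<le> exp (ln (p n) - R)" by simp
    also have "\<dots> = p n * exp (- R)"
      using elim by (simp add: exp_diff exp_minus divide_inverse)
    also have "- R = - (v * (E + C * (1 - p n)) + real n * d + 1) / p n"
      unfolding R_def by (rule minus_divide_left)
    finally have "ennreal (exp (- (v * l))) \<le>
        ennreal (p n * exp (- (v * (E + C * (1 - p n)) + real n * d + 1) / p n))"
      by (rule ennreal_leI)
    also have "\<dots> \<le> emeasure (gibbs_measure \<pi> Wn b n) (S n)"
      unfolding v_def using elim b(1) C
      by (intro gibbs_measure_lower_bound[OF \<pi> \<mu> Wn(1) _ _ _ _ d E S]) (auto simp: C_def p_def)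
    finally show ?case unfolding v_def S_def .
  qed
qed

section \<open>Upper bounds on closed sets\<close>

lemma weak_basic_antimono: "set ps \<subseteq> set qs \<Longrightarrow> weak_basic qs \<subseteq> weak_basic ps"
  by (auto simp: weak_basic_def)

text \<open>If this failed there would be counterexamples \<open>\<nu>\<^sub>k\<close> for \<open>n\<^sub>k \<rightarrow> \<infinity>\<close> converging to \<open>\<mu>\<close>. Filling the
  gaps between the \<open>n\<^sub>k\<close> with \<open>\<mu>\<close> gives a full sequence, as required by the lower limit assumption.\<close>

lemma lower_limit_local:
  fixes W :: "'a::polish_space measure \<Rightarrow> ereal"
  assumes A1: "lower_limit_assumption Wn W" and \<mu>: "\<mu> \<in> borel_probs" and w: "ereal w < W \<mu>"
  obtains G N where "openin weak_topology G" "\<mu> \<in> G"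
    "\<And>n \<nu>. n \<ge> N \<Longrightarrow> \<nu> \<in> G \<Longrightarrow> ereal w \<le> energy_on_probs n (Wn n) \<nu>"
proof (rule ccontr)
  assume contr: "\<not> thesis"
  \<comment> \<open>The intersection of those among the first k basic sets that contain \<mu>: a
    decreasing neighbourhood base.\<close>
  define V where
    "V k = (weak_basic (concat (filter (\<lambda>ps. \<mu> \<in>
        weak_basic ps) (map from_nat [0..<k]))) :: 'a measure set)" for k
  have \<mu>V: "\<mu> \<in> V k" for k
    using \<mu> by (auto simp: V_def weak_basic_def)
  have V_sub: "V k \<subseteq> weak_basic ps" if "\<mu> \<in> weak_basic ps" "to_nat ps < k" for k ps
    unfolding V_def using that
        by (intro weak_basic_antimono) (force intro: image_eqI[of _ _ "to_nat ps"])
  have ex: "\<exists>n\<ge>N. \<exists>\<nu>\<in>V k. energy_on_probs n (Wn n) \<nu> < ereal w" for N k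
  proof (rule ccontr)
    assume "\<not> ?thesis"
    then have "\<And>n \<nu>. n \<ge> N \<Longrightarrow> \<nu> \<in> V k \<Longrightarrow> ereal w \<le> energy_on_probs n (Wn n) \<nu>"
      by (meson linorder_not_less)
    with contr that[of "V k" N] \<mu>V openin_weak_basic show False unfolding V_def by blast
  qed
  have "\<exists>s :: nat \<Rightarrow> nat \<times> 'a measure. \<forall>k. (snd (s k) \<in> V k \<and>
      energy_on_probs (fst (s k)) (Wn (fst (s k))) (snd (s k)) < ereal w)
      \<and> fst (s k) < fst (s (Suc k))"
  proof (rule dependent_nat_choice)
    show "\<exists>x. snd x \<in> V 0 \<and> energy_on_probs (fst x) (Wn (fst x)) (snd x) < ereal w"
      using ex[of 0 0] by auto
    show "\<exists>y. (snd y \<in> V (Suc k) \<and> energy_on_probs (fst y) (Wn (fst y)) (snd y) < ereal w) \<and>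
        fst x < fst y"
      for x :: "nat \<times> 'a measure" and k
      using ex[of "Suc (fst x)" "Suc k"] by (auto simp: Suc_le_eq)
  qed
  then obtain s :: "nat \<Rightarrow> nat \<times> 'a measure" where
    s: "\<And>k. snd (s k) \<in> V k" "\<And>k. energy_on_probs (fst (s k)) (Wn (fst (s k))) (snd (s k)) <
        ereal w"
      "\<And>k. fst (s k) < fst (s (Suc k))" by blast
  define r where "r k = fst (s k)" for k
  have r: "strict_mono r" unfolding r_def by (rule strict_monoI_Suc) (rule s(3))
  define \<nu> where "\<nu> n = (if n \<in> range r then snd (s (inv r n)) else \<mu>)" for n
  have \<nu>_r: "\<nu> (r k) = snd (s k)" for k
    using r by (simp add: \<nu>_def strict_mono_imp_inj_on)
  have VP: "V k \<subseteq> borel_probs" for k by (auto simp: V_def weak_basic_def)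
  have \<nu>_probs: "\<nu> n \<in> borel_probs" for n
    using s(1) VP \<mu> by (auto simp: \<nu>_def)
  have "limitin weak_topology \<nu> \<mu> sequentially"
    unfolding limitin_def
  proof (intro conjI allI impI)
    fix U assume U: "openin weak_topology U \<and> \<mu> \<in> U"
    then obtain ps where ps: "\<mu> \<in> weak_basic ps" "weak_basic ps \<subseteq> U" using weak_basic_nhd[of U \<mu>]
        by metis
    have "\<nu> n \<in> U" if n: "n \<ge> r (Suc (to_nat ps))" for n
    proof (cases "n \<in> range r")
      case True
      then obtain k where k: "n = r k" by blast
      then have "to_nat ps < k" using n r by (simp add: strict_mono_less_eq)
      then show ?thesis using s(1)[of k] V_sub[OF ps(1)] ps(2) k \<nu>_r by auto
    qed (use U in \<open>simp add: \<nu>_def\<close>)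
    then show "\<forall>\<^sub>F n in sequentially. \<nu> n \<in> U" unfolding eventually_sequentially by blast
  qed (use \<mu> in simp)
  then have "W \<mu> \<le> liminf (\<lambda>n. energy_on_probs n (Wn n) (\<nu> n))"
    using A1 \<nu>_probs unfolding lower_limit_assumption_def by blast
  then have "ereal w < liminf (\<lambda>n. energy_on_probs n (Wn n) (\<nu> n))" using w by simp
  then have "\<forall>\<^sub>F n in sequentially. ereal w < energy_on_probs n (Wn n) (\<nu> n)" by (rule less_LiminfD)
  then obtain N where "\<And>n. n \<ge> N \<Longrightarrow> ereal w < energy_on_probs n (Wn n) (\<nu> n)"
    unfolding eventually_sequentially by blast
  then have "ereal w < energy_on_probs (r N) (Wn (r N)) (\<nu> (r N))"
    using seq_suble[OF r, of N] by blast
  then show False using s(2)[of N] unfolding \<nu>_r unfolding r_def by simp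
qed

lemma energy_on_probs_empirical':
  fixes x :: "nat \<Rightarrow> 'a::polish_space"
  assumes "energy_sequence Wn" "n \<ge> 1" "x \<in> space (power_borel n)"
  shows "energy_on_probs n (Wn n) (empirical n x) = Wn n x"
  using assms by (intro energy_on_probs_empirical) (auto simp: energy_sequence_def)

lemma gibbs_measure_upper_bound:
  assumes \<pi>: "\<pi> \<in> borel_probs" and Wn: "energy_sequence Wn" and n: "n \<ge> 1" "0 < b n"
    and S: "S \<in> sets (power_borel n)" and w: "\<And>x. x \<in> S \<Longrightarrow> ereal w \<le> Wn n x"
  shows "emeasure (gibbs_measure \<pi> Wn b n) S \<le>
    ennreal (exp (- (real n * b n * w))) * emeasure (power_measure n \<pi>) S"
proof -
  have "emeasure (gibbs_measure \<pi> Wn b n) S \<le>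
      (\<integral>\<^sup>+x. ennreal (exp (- (real n * b n * w))) * indicator S x \<partial>power_measure n \<pi>)"
    unfolding emeasure_gibbs_measure[OF \<pi> Wn n(1) S]
  proof (intro nn_integral_mono)
    fix x
    show "exp_ereal (- (ereal (real n * b n) * Wn n x)) * indicator S x \<le>
        ennreal (exp (- (real n * b n * w))) * indicator S x"
    proof (cases "x \<in> S")
      case True
      have "ereal (real n * b n) * ereal w \<le> ereal (real n * b n) * Wn n x"
        using n w[OF True] by (intro ereal_mult_left_mono) auto
      then have "exp_ereal (- (ereal (real n * b n) * Wn n x)) \<le>
          exp_ereal (- (ereal (real n * b n) * ereal w))"
        by (intro exp_ereal_mono) (simp only: ereal_minus_le_minus)
      then show ?thesis by (intro mult_right_mono) simp_all
    qed simp
  qed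
  also have "\<dots> = ennreal (exp (- (real n * b n * w))) * emeasure (power_measure n \<pi>) S"
    using S \<pi> by (intro nn_integral_cmult_indicator) (simp add: sets_power_measure)
  finally show ?thesis .
qed

text \<open>The slack of the strict inequality is shared by the two summands. Infinite values need
  their own witnesses; for \<kappa> = 0 and y = \<infinity> the product is 0 and x alone carries the
  bound.\<close>

lemma ereal_less_plus_mult:
  fixes x y :: ereal
  assumes "ereal a < x + ereal \<kappa> * y" "0 \<le> \<kappa>" "x \<noteq> -\<infinity>" "0 \<le> y"
  obtains w d where "ereal w < x" "ereal d < y" "a < w + \<kappa> * d"
proof (cases x)
  case PInf
  show ?thesis
    using assms(4) PInf by (intro that[of "a + \<kappa> + 1" "-1"]) (auto intro: less_le_trans[of _ 0])
next
  case x: (real r)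
  show ?thesis
  proof (cases y)
    case PInf
    show ?thesis
    proof (cases "\<kappa> = 0")
      case True
      then have "a < r" using assms(1) x by (simp flip: zero_ereal_def)
      then show ?thesis using x PInf True by (intro that[of "(a + r) / 2" 0]) auto
    next
      case False
      then show ?thesis using x PInf assms(2)
        by (intro that[of "r - 1" "(a - r + 2) / \<kappa>"]) auto
    qed
  next
    case y: (real s)
    \<comment> \<open>Each summand gives up at most a third of the slack; dividing by \<kappa> + 1
      instead of \<kappa> covers \<kappa> = 0.\<close>
    define \<delta> where "\<delta> = r + \<kappa> * s - a"
    have "\<delta> > 0" using assms(1) x y by (simp add: \<delta>_def)
    have "\<kappa> * (\<delta> / (3 * (\<kappa> + 1))) \<le> \<delta> / 3"
      using assms(2) \<open>\<delta> > 0\<close> by (simp add: field_simps)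
    then have "a < (r - \<delta> / 3) + \<kappa> * (s - \<delta> / (3 * (\<kappa> + 1)))"
      using \<open>\<delta> > 0\<close> \<delta>_def unfolding right_diff_distrib by linarith
    then show ?thesis
      using x y \<open>\<delta> > 0\<close> assms(2) by (intro that[of "r - \<delta> / 3" "s - \<delta> / (3 * (\<kappa> + 1))"]) auto
  qed (use assms in auto)
qed (use assms in auto)

text \<open>Two open conditions are intersected: \<open>G1\<close> secures energy at least w, and
  \<open>G2\<close> forces a high average of a nearly optimal f, of
  \<open>\<pi>\<^sup>n\<close>-probability at most exp (- n d). As n = \<open>v\<^sub>n\<close> /
  \<open>b n\<close>, the exponents combine to w + d / \<open>b n\<close>.\<close>

lemma gibbs_measure_local_upper_bound:
  fixes \<pi> \<mu> :: "'a::polish_space measure"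
  assumes \<pi>: "\<pi> \<in> borel_probs" and \<mu>: "\<mu> \<in> borel_probs"
    and Wn: "energy_sequence Wn" and A1: "lower_limit_assumption Wn W"
    and b: "\<And>n. n \<ge> 1 \<Longrightarrow> 0 < b n" "(\<lambda>n. 1 / b n) \<longlonglongrightarrow> \<kappa>" and "0 \<le> \<kappa>" and W: "W \<mu> \<noteq> -\<infinity>"
    and a: "ereal a < W \<mu> + ereal \<kappa> * relative_entropy \<mu> \<pi>"
  obtains G where "openin weak_topology G" "\<mu> \<in> G"
    "\<forall>\<^sub>F n in sequentially. emeasure (gibbs_measure \<pi> Wn b n)
       (empirical_in n G) \<le> ennreal (exp (- (real n * b n * a)))"
proof -
  obtain w d where wd: "ereal w < W \<mu>" "ereal d < relative_entropy \<mu> \<pi>" "a < w + \<kappa> * d"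
    using ereal_less_plus_mult[OF a \<open>0 \<le> \<kappa>\<close> W relative_entropy_nonneg[OF \<mu> \<pi>]] by blast
  obtain G1 N where G1: "openin weak_topology G1" "\<mu> \<in> G1"
    and energy: "\<And>n \<nu>. n \<ge> N \<Longrightarrow> \<nu> \<in> G1 \<Longrightarrow> ereal w \<le> energy_on_probs n (Wn n) \<nu>"
    using lower_limit_local[OF A1 \<mu> wd(1)] by metis
  obtain f :: "'a \<Rightarrow> real" and B where f: "continuous_on UNIV f" "\<And>x. \<bar>f x\<bar> \<le> B"
    and var: "d < (\<integral>x. f x \<partial>\<mu>) - ln (\<integral>x. exp (f x) \<partial>\<pi>)"
    using variational_relative_entropy[OF \<mu> \<pi> wd(2)] by metis
  interpret \<pi>: prob_space \<pi> using \<pi> by (simp add: borel_probs_iff)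
  have f_meas [measurable]: "f \<in> borel_measurable borel" using f(1)
      by (rule borel_measurable_continuous_onI)
  define Z where "Z = (\<integral>x. exp (f x) \<partial>\<pi>)"
  have exp_int: "integrable \<pi> (\<lambda>x. exp (f x))" and "0 < Z"
    unfolding Z_def using integral_exp_bounded[OF \<pi> f_meas f(2)] by auto
  \<comment> \<open>Normalises the tilt: the \<pi>-integral of exp (f - c) becomes exp (- d), and
    \<mu> \<in> G2 is exactly the variational inequality.\<close>
  define c where "c = d + ln Z"
  define G2 where "G2 = {\<nu> \<in> borel_probs. (\<integral>x. f x \<partial>\<nu>) \<in> {c<..}}"
  have G2: "openin weak_topology G2"
    unfolding G2_def using f by (intro openin_weak_topology_integral) (auto simp: bounded_iff)
  have \<mu>G2: "\<mu> \<in> G2" using var \<mu> by (simp add: G2_def c_def Z_def)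
  have exp_c: "(\<integral>\<^sup>+x. ennreal (exp (f x - c)) \<partial>\<pi>) = ennreal (exp (- d))"
  proof -
    have "(\<integral>\<^sup>+x. ennreal (exp (f x - c)) \<partial>\<pi>) = ennreal (\<integral>x. exp (f x - c) \<partial>\<pi>)"
      using exp_int by (intro nn_integral_eq_integral) (auto simp: exp_diff)
    also have "(\<integral>x. exp (f x - c) \<partial>\<pi>) = Z / exp c" unfolding Z_def by (simp add: exp_diff)
    also have "Z / exp c = exp (- d)" using \<open>0 < Z\<close>
        by (simp add: c_def exp_add exp_minus field_simps)
    finally show ?thesis .
  qed
  have "(\<lambda>n. w + d * (1 / b n)) \<longlonglongrightarrow> w + d * \<kappa>" by (intro tendsto_intros b(2))
  then have "\<forall>\<^sub>F n in sequentially. a < w + d * (1 / b n)"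
    using wd(3) by (intro order_tendstoD(1)) (auto simp: mult.commute)
  then have "\<forall>\<^sub>F n in sequentially. emeasure (gibbs_measure \<pi> Wn b n)
       (empirical_in n (G1 \<inter> G2)) \<le> ennreal (exp (- (real n * b n * a)))"
    using eventually_ge_at_top[of "max 1 N"]
  proof eventually_elim
    case (elim n)
    then have n: "n \<ge> 1" "n \<ge> N" by auto
    let ?S = "empirical_in n (G1 \<inter> G2)"
    let ?T = "{x \<in> space (power_borel n). real n * c \<le> (\<Sum>i<n. f (x i))}"
    have S: "?S \<in> sets (power_borel n)"
      using n G1(1) G2 by (intro empirical_openin_measurable openin_Int) auto
    have "emeasure (gibbs_measure \<pi> Wn b n) ?S \<le>
        ennreal (exp (- (real n * b n * w))) * emeasure (power_measure n \<pi>) ?S"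
    proof (rule gibbs_measure_upper_bound[where b = b, OF \<pi> Wn n(1) b(1)[OF n(1)] S])
      fix x assume x: "x \<in> ?S"
      then show "ereal w \<le> Wn n x"
        using energy[OF n(2), of "empirical n x"] energy_on_probs_empirical'[OF Wn n(1), of x]
            by auto
    qed
    also have "\<dots> \<le> ennreal (exp (- (real n * b n * w))) * ennreal (exp (- d)) ^ n"
    proof (intro mult_left_mono)
      have "?S \<subseteq> ?T"
        using n(1) by (auto simp: G2_def integral_empirical field_simps)
      moreover have "?T \<in> sets (power_measure n \<pi>)"
        unfolding sets_power_measure[OF \<pi>] by measurable
      ultimately have "emeasure (power_measure n \<pi>) ?S \<le> emeasure (power_measure n \<pi>) ?T"
        by (intro emeasure_mono)
      also have "\<dots> \<le> ennreal (exp (- d)) ^ n"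
        using power_measure_Chernoff[OF \<pi> f_meas, of n c] by (simp only: exp_c)
      finally show "emeasure (power_measure n \<pi>) ?S \<le> ennreal (exp (- d)) ^ n" .
    qed simp
    also have "\<dots> = ennreal (exp (- (real n * b n * (w + d * (1 / b n)))))"
      using b(1)[OF n(1)] by (simp add: ennreal_power exp_of_nat_mult[symmetric] algebra_simps
          flip: ennreal_mult exp_add)
    also have "\<dots> \<le> ennreal (exp (- (real n * b n * a)))"
      using elim(1) n b(1)[OF n(1)] by (intro ennreal_leI) (auto intro!: mult_left_mono)
    finally show ?case .
  qed
  then show ?thesis
    using G1 G2 \<mu>G2 by (intro that[of "G1 \<inter> G2"]) auto
qed

section \<open>Exponential tightness and finite covers\<close>

abbreviation not_tight :: "nat \<Rightarrow> (nat \<Rightarrow> nat) \<Rightarrow> (nat \<Rightarrow> 'a::polish_space) set" where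
  "not_tight n N \<equiv>
     {x \<in> space (power_borel n). \<exists>k. (1/2)^k < measure (empirical n x) {y. N k < addr k y}}"

text \<open>A tilt of size \<open>t k\<close> on a tail set costs little under \<pi>, whose mass
  there is below \<open>exp (- t k)\<close>, but it is worth \<open>t k * (1/2)^k\<close> per sample
  point once more than \<open>(1/2)^k\<close> of the sample lies there. A union bound treats all
  scales together, so outside the event the empirical measure lies in one tight family.\<close>

lemma empirical_exponential_tightness:
  fixes \<pi> :: "'a::polish_space measure"
  assumes \<pi>: "\<pi> \<in> borel_probs" and "0 \<le> L"
  obtains N :: "nat \<Rightarrow> nat" where
    "\<And>n. n \<ge> 1 \<Longrightarrow> (not_tight n N :: (nat \<Rightarrow> 'a) set) \<in> sets (power_borel n)"
    "\<And>n. n \<ge> 1 \<Longrightarrow> emeasure (power_measure n \<pi>)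
      (not_tight n N) \<le> ennreal (exp (- (real n * L)))"
proof -
  interpret \<pi>: prob_space \<pi> using \<pi> by (simp add: borel_probs_iff)
  have sets: "sets \<pi> = sets borel" using \<pi> by (simp add: borel_probs_iff)
  define T where "T k N = {y::'a. N < addr k y}" for k N
  have T [measurable]: "T k N \<in> sets borel" for k N
    using measurable_sets[OF measurable_addr[of k], of "{N<..}"] by (simp add: T_def vimage_def)
  \<comment> \<open>so that the Chernoff exponent \<open>t k * (1/2)^k\<close> is \<open>L\<close> plus a term summable over \<open>k\<close>\<close>
  define t where "t k = 2 ^ k * (L + real k + 2)" for k
  have t_pos: "0 < t k" for k using \<open>0 \<le> L\<close> by (simp add: t_def)
  have "\<exists>N. measure \<pi> (T k N) < exp (- t k)" for k
  proof -
    have "range (T k) \<subseteq> sets \<pi>" unfolding sets by (rule image_subsetI) (rule T)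
    moreover have "decseq (T k)"
      unfolding decseq_def T_def by (intro allI impI subsetI) simp
    ultimately have "(\<lambda>N. measure \<pi> (T k N)) \<longlonglongrightarrow> measure \<pi> (\<Inter>N. T k N)"
      by (rule \<pi>.finite_Lim_measure_decseq)
    moreover have "(\<Inter>N. T k N) = {}" by (auto simp: T_def)
    ultimately have "(\<lambda>N. measure \<pi> (T k N)) \<longlonglongrightarrow> 0" by simp
    then have "\<forall>\<^sub>F N in sequentially. measure \<pi> (T k N) < exp (- t k)"
      by (intro order_tendstoD(2)) auto
    then show ?thesis unfolding eventually_sequentially by blast
  qed
  then obtain N where N: "\<And>k. measure \<pi> (T k (N k)) < exp (- t k)" by metis
  define A where "A n k = {x \<in> space (power_borel n). real n * (t k * (1/2)^k) \<le>
      (\<Sum>i<n. t k * indicator (T k (N k)) (x i))}"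
    for n k
  have A_sets [measurable]: "A n k \<in> sets (power_borel n)" for n k unfolding A_def by measurable
  have A_le: "emeasure (power_measure n \<pi>) (A n k) \<le> ennreal (exp (- (real n * L)) * (1/2)^Suc k)"
    if n: "n \<ge> 1" for n k
  proof -
    let ?e = "\<lambda>x. exp (t k * indicator (T k (N k)) x - t k * (1/2)^k)"
    have exp_split: "exp (u - s) = exp (- s) * exp u" for u s :: real
      by (simp flip: exp_add)
    have "(\<integral>\<^sup>+x. ennreal (?e x) \<partial>\<pi>) \<le>
        (\<integral>\<^sup>+x. ennreal (exp (- (t k * (1/2)^k))) *
            (1 + ennreal (exp (t k)) * indicator (T k (N k)) x) \<partial>\<pi>)"
    proof (intro nn_integral_mono)
      fix x
      have "exp (t k * indicator (T k (N k)) x) \<le> 1 + exp (t k) * indicator (T k (N k)) x"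
        by (auto simp: indicator_def)
      then have "exp (- (t k * (1/2)^k)) * exp (t k * indicator (T k (N k)) x) \<le>
          exp (- (t k * (1/2)^k)) * (1 + exp (t k) * indicator (T k (N k)) x)"
        by (intro mult_left_mono) auto
      then have "ennreal (?e x) \<le>
          ennreal (exp (- (t k * (1/2)^k)) * (1 + exp (t k) * indicator (T k (N k)) x))"
        unfolding exp_split by (rule ennreal_leI)
      also have "\<dots> = ennreal (exp (- (t k * (1/2)^k))) *
          (1 + ennreal (exp (t k)) * indicator (T k (N k)) x)"
        by (auto simp: indicator_def ennreal_mult ennreal_plus)
      finally show "ennreal (?e x) \<le>
          ennreal (exp (- (t k * (1/2)^k))) * (1 + ennreal (exp (t k)) * indicator (T k (N k)) x)" .
    qed
    also have "\<dots> = ennreal (exp (- (t k * (1/2)^k))) *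
        (1 + ennreal (exp (t k)) * emeasure \<pi> (T k (N k)))"
      using sets \<pi>.emeasure_space_1
          by (subst nn_integral_cmult, simp, subst nn_integral_add)
              (auto simp: nn_integral_cmult_indicator)
    also have "\<dots> = ennreal (exp (- (t k * (1/2)^k)) * (1 + exp (t k) * measure \<pi> (T k (N k))))"
      by (simp add: \<pi>.emeasure_eq_measure ennreal_mult ennreal_plus)
    also have "\<dots> \<le> ennreal (exp (- (L + real k + 1)))"
    proof (rule ennreal_leI)
      have "exp (t k) * measure \<pi> (T k (N k)) \<le> exp (t k) * exp (- t k)"
        using N[of k] by (intro mult_left_mono less_imp_le) auto
      \<comment> \<open>The factor is at most 1 + 1 \<le> exp 1 and uses up one unit of the exponent
        L + k + 2.\<close>
      then have "1 + exp (t k) * measure \<pi> (T k (N k)) \<le> exp 1"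
        using exp_ge_add_one_self[of "1::real"] by (simp flip: exp_add)
      moreover have "t k * (1/2)^k = L + real k + 2" by (simp add: t_def power_divide)
      ultimately have "exp (- (t k * (1/2)^k)) * (1 + exp (t k) * measure \<pi> (T k (N k))) \<le>
          exp (- (L + real k + 2)) * exp 1"
        by (intro mult_mono) auto
      then show "exp (- (t k * (1/2)^k)) * (1 + exp (t k) * measure \<pi> (T k (N k))) \<le>
          exp (- (L + real k + 1))"
        by (simp flip: exp_add)
    qed
    finally have le: "(\<integral>\<^sup>+x. ennreal (?e x) \<partial>\<pi>) \<le>
        ennreal (exp (- (L + real k + 1)))" .
    have "emeasure (power_measure n \<pi>) (A n k) \<le>
        (\<integral>\<^sup>+x. ennreal (?e x) \<partial>\<pi>) ^ n"
      unfolding A_def by (intro power_measure_Chernoff \<pi>) measurable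
    also have "\<dots> \<le> ennreal (exp (- (L + real k + 1))) ^ n"
      using le by (intro power_mono) auto
    also have "\<dots> = ennreal (exp (- (real n * L)) * exp (- (real n * (real k + 1))))"
      by (simp add: ennreal_power exp_of_nat_mult[symmetric] algebra_simps flip: exp_add)
    also have "\<dots> \<le> ennreal (exp (- (real n * L)) * (1/2)^Suc k)"
    proof (intro ennreal_leI mult_left_mono)
      \<comment> \<open>With n \<ge> 1 and exp (- 1) \<le> 1/2, scale k contributes at most the
        weight \<open>(1/2)^Suc k\<close>, and these weights sum to 1.\<close>
      have "1 * (real k + 1) \<le> real n * (real k + 1)" using n by (intro mult_right_mono) auto
      then have "- (real n * (real k + 1)) \<le> - 1 * real (Suc k)"
        unfolding of_nat_Suc mult_minus_left by (simp only: neg_le_iff_le mult_1 add.commute[of 1])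
      then have "exp (- (real n * (real k + 1))) \<le> exp (- 1 * real (Suc k))"
          by (rule iffD2[OF exp_le_cancel_iff])
      also have "\<dots> = exp (- 1) ^ Suc k" by (rule exp_of_nat2_mult)
      also have "\<dots> \<le> (1/2) ^ Suc k"
        using exp_ge_add_one_self[of "1::real"]
            by (intro power_mono) (auto simp: exp_minus field_simps)
      finally show "exp (- (real n * (real k + 1))) \<le> (1/2) ^ Suc k" .
    qed simp
    finally show ?thesis .
  qed
  define B where "B n = {x \<in> space (power_borel n). \<exists>k. (1/2)^k <
      measure (empirical n x) (T k (N k))}" for n
  have B_sets: "B n \<in> sets (power_borel n)"
    and B_sub: "B n \<subseteq> (\<Union>k. A n k)" if n: "n \<ge> 1" for n
  proof -
    have meas: "measure (empirical n x) (T k (N k)) = (\<Sum>i<n. indicator (T k (N k)) (x i)) /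
        real n" for x k
      using integral_empirical[OF n, of "indicator (T k (N k))" x] empirical_borel_probs[OF n, of x]
      by (simp add: borel_probs_space)
    have "B n = {x \<in> space (power_borel n). \<exists>k. (1/2)^k < (\<Sum>i<n. indicator (T k (N k)) (x i)) /
        real n}"
      unfolding B_def meas by simp
    also have "\<dots> \<in> sets (power_borel n)"
      by (intro sets.sets_Collect_countable_Ex) measurable
    finally show "B n \<in> sets (power_borel n)" .
    show "B n \<subseteq> (\<Union>k. A n k)"
    proof
      fix x assume "x \<in> B n"
      then obtain k where x: "x \<in> space (power_borel n)"
          and k: "(1/2)^k < (\<Sum>i<n. indicator (T k (N k)) (x i)) / real n"
        unfolding B_def meas by blast
      then have "real n * (1/2)^k \<le> (\<Sum>i<n. indicator (T k (N k)) (x i))"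
        using n by (simp add: field_simps)
      then have "t k * (real n * (1/2)^k) \<le> t k * (\<Sum>i<n. indicator (T k (N k)) (x i))"
        using t_pos[of k] by (intro mult_left_mono) auto
      then have "x \<in> A n k"
        using x by (simp only: A_def sum_distrib_left mem_Collect_eq) (simp add: ac_simps)
      then show "x \<in> (\<Union>k. A n k)" by blast
    qed
  qed
  have B_le: "emeasure (power_measure n \<pi>) (B n) \<le> ennreal (exp (- (real n * L)))" if n: "n \<ge> 1"
      for n
  proof -
    have "emeasure (power_measure n \<pi>) (B n) \<le> emeasure (power_measure n \<pi>) (\<Union>k. A n k)"
      by (rule emeasure_mono[OF B_sub[OF n]]) (unfold sets_power_measure[OF \<pi>], measurable)
    also have "\<dots> \<le> (\<Sum>k. emeasure (power_measure n \<pi>) (A n k))"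
      by (rule emeasure_subadditive_countably)
        (unfold sets_power_measure[OF \<pi>], rule image_subsetI, rule A_sets)
    also have "\<dots> \<le> (\<Sum>k. ennreal (exp (- (real n * L)) * (1/2)^Suc k))"
      by (rule suminf_le[OF A_le[OF n]]) simp_all
    also have "\<dots> = ennreal (exp (- (real n * L)) * 1)"
      by (intro suminf_ennreal_eq sums_mult power_half_series) simp
    finally show ?thesis by simp
  qed
  show ?thesis
    by (rule that[OF B_sets[unfolded B_def T_def] B_le[unfolded B_def T_def]])
qed

lemma closedin_limit:
  fixes C :: "'b set"
  assumes "closedin T C" "limitin T f l sequentially" "\<And>n. f n \<in> C"
  shows "l \<in> C"
proof (rule ccontr)
  assume "l \<notin> C"
  then have "l \<in> topspace T - C" "openin T (topspace T - C)"
    using assms by (auto simp: limitin_def)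
  then have "\<forall>\<^sub>F n in sequentially. f n \<in> topspace T - C"
    using assms(2) unfolding limitin_def by blast
  then obtain N where "\<And>n. n \<ge> N \<Longrightarrow> f n \<in> topspace T - C"
    unfolding eventually_sequentially by blast
  then show False using assms(3) by blast
qed

lemma empirical_closedin_measurable:
  fixes C :: "'a::polish_space measure set"
  assumes "n \<ge> 1" "closedin weak_topology C"
  shows "empirical_in n C \<in> sets (power_borel n)"
  using measurable_sets[OF measurable_empirical[OF assms(1)]
      closedin_borel_of_topology[OF assms(2)]]
  by (simp add: vimage_def Int_def conj_commute)

text \<open>The tail bounds make every sequence of such measures tight. If for each m some measure
  escaped the first m sets, a subsequential limit would lie in C, hence in some \<open>G j\<close>,
  which would then contain late terms of the subsequence.\<close>

lemma finitely_many_open_sets_cover: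
  fixes C :: "'a::polish_space measure set" and G :: "nat \<Rightarrow> 'a measure set"
  assumes C: "closedin weak_topology C" "C \<subseteq> (\<Union>j. G j)" and G: "\<And>j. openin weak_topology (G j)"
  obtains m where
    "\<And>\<nu>. \<nu> \<in> C \<Longrightarrow> \<forall>k. measure \<nu> {y. N k < addr k y} \<le> (1/2)^k \<Longrightarrow> \<nu> \<in> (\<Union>j<m. G j)"
proof (rule ccontr)
  assume contr: "\<not> thesis"
  have "\<exists>\<nu>. \<nu> \<in> C \<and> (\<forall>k. measure \<nu> {y. N k < addr k y} \<le> (1/2)^k) \<and> \<nu> \<notin> (\<Union>j<m. G j)" for m
  proof (rule ccontr)
    assume "\<not> ?thesis"
    then show False using contr that[of m] by blast
  qed
  then obtain \<nu> where \<nu>: "\<And>m. \<nu> m \<in> C" "\<And>m k. measure (\<nu> m) {y. N k < addr k y} \<le> (1/2)^k"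
    "\<And>m. \<nu> m \<notin> (\<Union>j<m. G j)" by metis
  have probs: "\<nu> m \<in> borel_probs" for m using \<nu>(1)[of m] closedin_subset[OF C(1)] by auto
  have tight: "\<exists>M. \<forall>n. measure (\<nu> n) {y. M < addr k y} \<le> e" if e: "0 < e" for k and e :: real
  proof -
    obtain j0 :: nat where j0: "(1/2)^j0 < e" using real_arch_pow_inv[of e "1/2"] e by auto
    \<comment> \<open>Fine enough for \<open>(1/2)^j\<close> to be below e, and at least k, so that
      \<open>addr_mono\<close> carries the tail bound from scale j over to scale k.\<close>
    define j where "j = max j0 k"
    have "measure (\<nu> n) {y. N j < addr k y} \<le> e" for n
    proof -
      interpret prob_space "\<nu> n" using probs by (simp add: borel_probs_iff)
      have sets: "sets (\<nu> n) = sets borel" using probs by (simp add: borel_probs_iff)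
      have "{y::'a. N j < addr j y} \<in> sets borel"
        using measurable_sets[OF measurable_addr[of j], of "{N j<..}"] by (simp add: vimage_def)
      moreover have "{y::'a. N j < addr k y} \<subseteq> {y. N j < addr j y}"
      proof (intro subsetI CollectI, elim CollectE)
        fix x :: 'a assume "N j < addr k x"
        also have "addr k x \<le> addr j x" by (rule addr_mono) (simp add: j_def)
        finally show "N j < addr j x" .
      qed
      ultimately have "prob {y. N j < addr k y} \<le> prob {y. N j < addr j y}"
        unfolding sets[symmetric] by (intro finite_measure_mono)
      also have "\<dots> \<le> (1/2)^j" by (rule \<nu>(2))
      also have "\<dots> \<le> (1/2)^j0" by (intro power_decreasing) (auto simp: j_def)
      finally show ?thesis using j0 by simp
    qed
    then show ?thesis by blast
  qed
  obtain r \<mu> where r: "strict_mono r" and lim: "limitin weak_topology (\<nu> \<circ> r) \<mu> sequentially"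
    using tight_convergent_subsequence[of \<nu>, OF probs tight] by metis
  have "\<mu> \<in> C" using C(1) lim by (rule closedin_limit) (simp add: \<nu>(1))
  then obtain j where "\<mu> \<in> G j" using C(2) by blast
  then have "\<forall>\<^sub>F n in sequentially. (\<nu> \<circ> r) n \<in> G j" using lim G[of j] unfolding limitin_def
      by blast
  then obtain n0 where n0: "\<And>n. n \<ge> n0 \<Longrightarrow> \<nu> (r n) \<in> G j" unfolding eventually_sequentially by auto
  have "j < r (max n0 (Suc j))"
    using seq_suble[OF r, of "max n0 (Suc j)"] by simp
  then show False using n0[of "max n0 (Suc j)"] \<nu>(3)[of "r (max n0 (Suc j))"] by auto
qed

text \<open>The constant K counts the finitely many neighbourhoods and the non-tight event; it is
  invisible on the exponential scale.\<close>

lemma gibbs_measure_closed_upper_bound_positive_temperature: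
  fixes \<pi> :: "'a::polish_space measure"
  assumes \<pi>: "\<pi> \<in> borel_probs" and Wn: "energy_sequence Wn" "stable_sequence Wn"
    and A1: "lower_limit_assumption Wn W"
    and b: "\<And>n. n \<ge> 1 \<Longrightarrow> 0 < b n" "(\<lambda>n. 1 / b n) \<longlonglongrightarrow> \<kappa>" and "0 < \<kappa>"
    and W: "\<forall>\<mu>\<in>borel_probs. W \<mu> \<noteq> -\<infinity>"
    and C: "closedin weak_topology C" "\<And>\<mu>. \<mu> \<in> C \<Longrightarrow> ereal a < W \<mu> + ereal \<kappa> * relative_entropy \<mu> \<pi>"
  obtains K where "0 < K" "\<forall>\<^sub>F n in sequentially. emeasure (gibbs_measure \<pi> Wn b n)
      (empirical_in n C) \<le> ennreal (K * exp (- (real n * b n * a)))"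
proof -
  define \<gamma> where "\<gamma> n S = emeasure (gibbs_measure \<pi> Wn b n) (empirical_in n S)" for n S
  define good where "good S \<longleftrightarrow>
      (\<forall>\<^sub>F n in sequentially. \<gamma> n S \<le> ennreal (exp (- (real n * b n * a))))" for S
  \<comment> \<open>All basic sets are enumerated and the unsuitable ones emptied, which gives a
    countable cover without selecting countably many centres.\<close>
  define G where "G j = (let S =
      weak_basic (from_nat j) :: 'a measure set in if good S then S else {})" for j
  have G_open: "openin weak_topology (G j)" for j
    by (simp add: G_def Let_def openin_weak_basic)
  have G_good: "good (G j)" for j
    by (auto simp: G_def Let_def good_def \<gamma>_def)
  have C_sub: "C \<subseteq> borel_probs" using closedin_subset[OF C(1)] by simp
  have cover: "C \<subseteq> (\<Union>j. G j)"
  proof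
    fix \<mu> assume "\<mu> \<in> C"
    then have \<mu>: "\<mu> \<in> borel_probs" using C_sub by blast
    obtain U where U: "openin weak_topology U" "\<mu> \<in> U"
      "\<forall>\<^sub>F n in sequentially. emeasure (gibbs_measure \<pi> Wn b n)
       (empirical_in n U) \<le> ennreal (exp (- (real n * b n * a)))"
      by (rule gibbs_measure_local_upper_bound[OF \<pi> \<mu> Wn(1) A1 _ b(2) less_imp_le[OF \<open>0 < \<kappa>\<close>]
            bspec[OF W \<mu>] C(2)[OF \<open>\<mu> \<in> C\<close>]]) (rule b(1), assumption, rule that)
    obtain ps where ps: "\<mu> \<in> weak_basic ps" "weak_basic ps \<subseteq> U" using weak_basic_nhd[OF U(1,2)]
        by blast
    have "good (weak_basic ps)"
      unfolding good_def using U(3) eventually_ge_at_top[of 1]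
    proof eventually_elim
      case (elim n)
      have "\<gamma> n (weak_basic ps) \<le> \<gamma> n U"
        unfolding \<gamma>_def
      proof (rule emeasure_mono)
        show "empirical_in n U \<in> sets (gibbs_measure \<pi> Wn b n)"
          unfolding sets_gibbs_measure[OF \<pi>] by (rule empirical_openin_measurable[OF elim(2) U(1)])
      qed (use ps(2) in blast)
      then show ?case using elim(1) unfolding \<gamma>_def by (rule order_trans)
    qed
    then have "\<mu> \<in> G (to_nat ps)" using ps(1) by (simp add: G_def Let_def)
    then show "\<mu> \<in> (\<Union>j. G j)" by blast
  qed
  obtain C0 where C0: "\<And>n x. n \<ge> 1 \<Longrightarrow> x \<in> space (power_borel n) \<Longrightarrow> ereal C0 \<le> Wn n x"
    using Wn(2) unfolding stable_sequence_def by blast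
  have "(\<lambda>n. inverse (1 / b n)) \<longlonglongrightarrow> inverse \<kappa>"
    using b(2) \<open>0 < \<kappa>\<close> by (intro tendsto_inverse) auto
  then have "(\<lambda>n. b n) \<longlonglongrightarrow> inverse \<kappa>" by simp
  then have b_bd: "\<forall>\<^sub>F n in sequentially. b n < inverse \<kappa> + 1"
    by (intro order_tendstoD(2)) auto
  \<comment> \<open>Eventually \<open>b n\<close> < inverse \<kappa> + 1, so L is at least
    \<open>b n * (a - C0)\<close>. Even with the energy bounded only by C0, the non-tight event then
    weighs at most \<open>exp (- (real n * b n * a))\<close>.\<close>
  define L where "L = (inverse \<kappa> + 1) * \<bar>a - C0\<bar>"
  have "0 \<le> L" using \<open>0 < \<kappa>\<close> by (simp add: L_def)
  obtain N where N: "\<And>n. n \<ge> 1 \<Longrightarrow> (not_tight n N :: (nat \<Rightarrow> 'a) set) \<in> sets (power_borel n)"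
    and N_le: "\<And>n. n \<ge> 1 \<Longrightarrow> emeasure (power_measure n \<pi>)
      (not_tight n N) \<le> ennreal (exp (- (real n * L)))"
    by (rule empirical_exponential_tightness[OF \<pi> \<open>0 \<le> L\<close>]) (rule that)
  define R where "R n = (not_tight n N :: (nat \<Rightarrow> 'a) set)" for n
  obtain m where m: "\<And>\<nu>. \<nu> \<in> C \<Longrightarrow> \<forall>k. measure \<nu> {y. N k < addr k y} \<le> (1/2)^k \<Longrightarrow> \<nu> \<in> (\<Union>j<m. G j)"
    by (rule finitely_many_open_sets_cover[where N = N, OF C(1) cover G_open]) (rule that)
  have "\<forall>\<^sub>F n in sequentially. \<forall>j\<in>{..<m}. \<gamma> n (G j) \<le> ennreal (exp (- (real n * b n * a)))"
    using G_good unfolding good_def by (intro eventually_ball_finite) auto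
  then have "\<forall>\<^sub>F n in sequentially. emeasure (gibbs_measure \<pi> Wn b n)
      (empirical_in n C) \<le> ennreal ((real m + 1) * exp (- (real n * b n * a)))"
    using b_bd eventually_ge_at_top[of 1]
  proof eventually_elim
    case (elim n)
    note n = elim(3)
    let ?S = "\<lambda>j. empirical_in n (G j)"
    have S: "?S j \<in> sets (gibbs_measure \<pi> Wn b n)" for j
      unfolding sets_gibbs_measure[OF \<pi>] by (rule empirical_openin_measurable[OF n G_open])
    have R: "R n \<in> sets (gibbs_measure \<pi> Wn b n)"
      unfolding sets_gibbs_measure[OF \<pi>] R_def by (rule N[OF n])
    have sub: "empirical_in n C \<subseteq> (\<Union>j<m. ?S j) \<union> R n"
    proof
      fix x assume x: "x \<in> empirical_in n C"
      show "x \<in> (\<Union>j<m. ?S j) \<union> R n"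
      proof (cases "x \<in> R n")
        case False
        then have "measure (empirical n x) {y. N k < addr k y} \<le> (1/2)^k" for k
          using x by (auto simp: R_def not_less)
        then show ?thesis using m[of "empirical n x"] x by auto
      qed simp
    qed
    have "emeasure (gibbs_measure \<pi> Wn b n) (empirical_in n C) \<le>
        emeasure (gibbs_measure \<pi> Wn b n) ((\<Union>j<m. ?S j) \<union> R n)"
      using S R by (intro emeasure_mono[OF sub] sets.Un sets.finite_UN) auto
    also have "\<dots> \<le> emeasure (gibbs_measure \<pi> Wn b n) (\<Union>j<m. ?S j) +
        emeasure (gibbs_measure \<pi> Wn b n) (R n)"
      using S R by (intro emeasure_subadditive sets.finite_UN) auto
    also have "\<dots> \<le> (\<Sum>j<m. ennreal (exp (- (real n * b n * a)))) +
        ennreal (exp (- (real n * b n * a)))"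
    proof (rule add_mono)
      have "emeasure (gibbs_measure \<pi> Wn b n) (\<Union>j<m. ?S j) \<le>
          (\<Sum>j<m. emeasure (gibbs_measure \<pi> Wn b n) (?S j))"
        using S by (intro emeasure_subadditive_finite image_subsetI) auto
      also have "\<dots> \<le> (\<Sum>j<m. ennreal (exp (- (real n * b n * a))))"
        using elim(1) unfolding \<gamma>_def by (intro sum_mono) blast
      finally show "emeasure (gibbs_measure \<pi> Wn b n) (\<Union>j<m. ?S j) \<le>
          (\<Sum>j<m. ennreal (exp (- (real n * b n * a))))" .
      have "emeasure (gibbs_measure \<pi> Wn b n) (R n) \<le>
          ennreal (exp (- (real n * b n * C0))) * emeasure (power_measure n \<pi>) (R n)"
        using C0[OF n] N[OF n] by (intro gibbs_measure_upper_bound \<pi> Wn n b(1)) (auto simp: R_def)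
      also have "\<dots> \<le> ennreal (exp (- (real n * b n * C0))) * ennreal (exp (- (real n * L)))"
        unfolding R_def using N_le[OF n] by (intro mult_left_mono) auto
      also have "\<dots> = ennreal (exp (- (real n * (b n * C0 + L))))"
        by (simp add: algebra_simps flip: ennreal_mult exp_add)
      also have "\<dots> \<le> ennreal (exp (- (real n * b n * a)))"
      proof -
        have "b n * (a - C0) \<le> b n * \<bar>a - C0\<bar>"
          using b(1)[OF n] by (intro mult_left_mono) auto
        also have "\<dots> \<le> L"
          unfolding L_def using elim(2) by (intro mult_right_mono) auto
        finally have "b n * a \<le> b n * C0 + L" by (simp add: algebra_simps)
        then have "real n * (b n * a) \<le> real n * (b n * C0 + L)" by (intro mult_left_mono) auto
        then show ?thesis by (intro ennreal_leI) (simp add: mult.assoc)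
      qed
      finally show "emeasure (gibbs_measure \<pi> Wn b n) (R n) \<le>
          ennreal (exp (- (real n * b n * a)))" .
    qed
    also have "\<dots> = ennreal ((real m + 1) * exp (- (real n * b n * a)))"
      by (simp add: ring_distribs ennreal_plus ennreal_mult ennreal_of_nat_eq_real_of_nat)
    finally show ?case .
  qed
  then show ?thesis by (intro that[of "real m + 1"]) auto
qed

text \<open>The energy alone decides: for large n every measure in C has energy at least a.
  Otherwise measures in C of energy below a would, by confinement, have a compact closure, still
  inside C; finitely many neighbourhoods with good energy would cover it and contain all the
  offenders.\<close>

lemma gibbs_measure_closed_upper_bound_zero_temperature:
  fixes \<pi> :: "'a::polish_space measure"
  assumes \<pi>: "\<pi> \<in> borel_probs" and Wn: "energy_sequence Wn" "confining_sequence Wn"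
    and A1: "lower_limit_assumption Wn W"
    and b: "\<And>n. n \<ge> 1 \<Longrightarrow> 0 < b n"
    and C: "closedin weak_topology C" "\<And>\<mu>. \<mu> \<in> C \<Longrightarrow> ereal a < W \<mu>"
  shows "\<forall>\<^sub>F n in sequentially. emeasure (gibbs_measure \<pi> Wn b n)
      (empirical_in n C) \<le> ennreal (exp (- (real n * b n * a)))"
proof -
  define good where "good S \<longleftrightarrow> (\<exists>N. \<forall>n\<ge>N. \<forall>\<nu>\<in>S. ereal a \<le> energy_on_probs n (Wn n) \<nu>)" for S
  define G where "G j = (let S =
      weak_basic (from_nat j) :: 'a measure set in if good S then S else {})" for j
  have G_open: "openin weak_topology (G j)" for j
    by (simp add: G_def Let_def openin_weak_basic)
  have G_good: "good (G j)" for j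
    by (auto simp: G_def Let_def good_def)
  have C_sub: "C \<subseteq> borel_probs" using closedin_subset[OF C(1)] by simp
  have cover: "C \<subseteq> (\<Union>j. G j)"
  proof
    fix \<mu> assume "\<mu> \<in> C"
    then have \<mu>: "\<mu> \<in> borel_probs" using C_sub by blast
    obtain U N where U: "openin weak_topology U" "\<mu> \<in> U"
      and N: "\<And>n \<nu>. n \<ge> N \<Longrightarrow> \<nu> \<in> U \<Longrightarrow> ereal a \<le> energy_on_probs n (Wn n) \<nu>"
      by (rule lower_limit_local[OF A1 \<mu> C(2)[OF \<open>\<mu> \<in> C\<close>]]) (rule that)
    obtain ps where ps: "\<mu> \<in> weak_basic ps" "weak_basic ps \<subseteq> U" using weak_basic_nhd[OF U] by blast
    have "good (weak_basic ps)" unfolding good_def using N ps(2) by blast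
    then have "\<mu> \<in> G (to_nat ps)" using ps(1) by (simp add: G_def Let_def)
    then show "\<mu> \<in> (\<Union>j. G j)" by blast
  qed
  \<comment> \<open>If this fails, the k-th offender can be taken outside the first k covering sets,
    with strictly increasing indices as confinement requires.\<close>
  have "\<exists>m N. \<forall>n\<ge>N. \<forall>\<nu>\<in>C. energy_on_probs n (Wn n) \<nu> < ereal a \<longrightarrow> \<nu> \<in> (\<Union>j<m. G j)"
  proof (rule ccontr)
    assume contr: "\<not> ?thesis"
    have ex: "\<exists>n\<ge>N. \<exists>\<nu>\<in>C. energy_on_probs n (Wn n) \<nu> < ereal a \<and> \<nu> \<notin> (\<Union>j<m. G j)" for m N
      using contr by blast
    have "\<exists>s :: nat \<Rightarrow> nat \<times> 'a measure. \<forall>k. (1 \<le> fst (s k) \<and> snd (s k) \<in> C \<and>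
        energy_on_probs (fst (s k)) (Wn (fst (s k))) (snd (s k)) <
            ereal a \<and> snd (s k) \<notin> (\<Union>j<k. G j))
        \<and> fst (s k) < fst (s (Suc k))"
    proof (rule dependent_nat_choice)
      show "\<exists>x. 1 \<le> fst x \<and> snd x \<in> C \<and> energy_on_probs (fst x) (Wn (fst x)) (snd x) < ereal a
          \<and> snd x \<notin> (\<Union>j<0. G j)"
        using ex[of 1 0] by auto
      show "\<exists>y. (1 \<le> fst y \<and> snd y \<in> C \<and> energy_on_probs (fst y) (Wn (fst y)) (snd y) < ereal a
          \<and> snd y \<notin> (\<Union>j<Suc k. G j)) \<and> fst x < fst y" for x :: "nat \<times> 'a measure" and k
      proof -
        obtain n \<nu> where "n \<ge> Suc (fst x)" "\<nu> \<in> C" "energy_on_probs n (Wn n) \<nu> < ereal a"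
          "\<nu> \<notin> (\<Union>j<Suc k. G j)" using ex[of "Suc (fst x)" "Suc k"] by blast
        then show ?thesis by (intro exI[of _ "(n, \<nu>)"]) (simp add: Suc_le_eq)
      qed
    qed
    then obtain s :: "nat \<Rightarrow> nat \<times> 'a measure" where
      s: "\<And>k. 1 \<le> fst (s k)" "\<And>k. snd (s k) \<in> C"
        "\<And>k. energy_on_probs (fst (s k)) (Wn (fst (s k))) (snd (s k)) < ereal a"
        "\<And>k. snd (s k) \<notin> (\<Union>j<k. G j)" "\<And>k. fst (s k) < fst (s (Suc k))" by blast
    define r where "r k = fst (s k)" for k
    define \<nu> where "\<nu> k = snd (s k)" for k
    have "strict_mono r" unfolding r_def by (rule strict_monoI_Suc) (rule s(5))
    moreover have "\<forall>j. 1 \<le> r j" using s(1) by (simp add: r_def)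
    moreover have \<nu>_probs: "\<forall>j. \<nu> j \<in> borel_probs" using s(2) C_sub by (auto simp: \<nu>_def)
    moreover have "\<exists>A::real. \<forall>j. energy_on_probs (r j) (Wn (r j)) (\<nu> j) \<le> ereal A"
      using s(3) less_imp_le unfolding r_def \<nu>_def by blast
    ultimately have comp: "compactin weak_topology (weak_topology closure_of range \<nu>)"
      using Wn(2) unfolding confining_sequence_def by blast
    have "weak_topology closure_of range \<nu> \<subseteq> C"
      using s(2) C(1) by (intro closure_of_minimal) (auto simp: \<nu>_def)
    then have "weak_topology closure_of range \<nu> \<subseteq> \<Union>(range G)" using cover by blast
    then obtain F where F: "finite F" "F \<subseteq> range G" "weak_topology closure_of range \<nu> \<subseteq> \<Union>F"
      using comp G_open unfolding compactin_def by (metis (no_types, lifting) imageE)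
    obtain J where J: "finite J" "F = G ` J" using finite_subset_image[OF F(1,2)] by auto
    obtain m where m: "J \<subseteq> {..<m}" using finite_nat_iff_bounded J(1) by blast
    have "range \<nu> \<subseteq> weak_topology closure_of range \<nu>"
      using \<nu>_probs by (intro closure_of_subset) auto
    then have "\<nu> m \<in> (\<Union>j<m. G j)" using F(3) J(2) m by blast
    then show False using s(4)[of m] by (simp add: \<nu>_def)
  qed
  then obtain m N where mN: "\<And>n \<nu>. n \<ge> N \<Longrightarrow> \<nu> \<in> C \<Longrightarrow> energy_on_probs n (Wn n) \<nu> < ereal a \<Longrightarrow>
      \<nu> \<in> (\<Union>j<m. G j)"
    by blast
  obtain N' where N': "\<And>j n \<nu>. n \<ge> N' j \<Longrightarrow> \<nu> \<in> G j \<Longrightarrow> ereal a \<le> energy_on_probs n (Wn n) \<nu>"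
    using G_good unfolding good_def by metis
  have "\<forall>\<^sub>F n in sequentially. \<forall>j\<in>{..<m}. N' j \<le> n"
    by (intro eventually_ball_finite ballI eventually_ge_at_top) simp
  then show ?thesis
    using eventually_ge_at_top[of "max 1 N"]
  proof eventually_elim
    case (elim n)
    then have n: "n \<ge> 1" "n \<ge> N" by auto
    have energy: "ereal a \<le> energy_on_probs n (Wn n) \<nu>" if "\<nu> \<in> C" for \<nu>
    proof (rule ccontr)
      assume *: "\<not> ?thesis"
      then have "\<nu> \<in> (\<Union>j<m. G j)" using mN[OF n(2) that] by simp
      then show False using * N' elim(1) by auto
    qed
    interpret P: prob_space "power_measure n \<pi>" by (rule prob_space_power_measure[OF \<pi>])
    have "emeasure (gibbs_measure \<pi> Wn b n) (empirical_in n C) \<le>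
        ennreal (exp (- (real n * b n * a))) * emeasure (power_measure n \<pi>) (empirical_in n C)"
    proof (rule gibbs_measure_upper_bound[where b = b, OF \<pi> Wn(1) n(1) b[OF n(1)]
        empirical_closedin_measurable[OF n(1) C(1)]])
      fix x assume x: "x \<in> empirical_in n C"
      then show "ereal a \<le> Wn n x"
        using energy[of "empirical n x"] energy_on_probs_empirical'[OF Wn(1) n(1), of x] by simp
    qed
    also have "\<dots> \<le> ennreal (exp (- (real n * b n * a))) * 1"
      by (intro mult_left_mono P.measure_le_1) simp
    finally show ?case by simp
  qed
qed

section \<open>The large deviation principle\<close>

lemma ln_ennreal_mono: "x \<le> y \<Longrightarrow> ln_ennreal x \<le> ln_ennreal y"
proof -
  assume "x \<le> y"
  then show ?thesis
    by (cases x; cases y) (auto simp: ln_ennreal_def top_unique)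
qed

lemma ln_ennreal_ennreal: "0 < r \<Longrightarrow> ln_ennreal (ennreal r) = ereal (ln r)"
  by (simp add: ln_ennreal_def)

text \<open>The two bounds for the whole space pin Z n between
  \<open>exp (- (v n * (m + e)))\<close> and \<open>K * exp (- (v n * (m - e)))\<close>, so dividing
  by Z n turns F into F - m. Constants K disappear because ln K / v n tends to 0.\<close>

lemma large_deviation_principleI:
  fixes v :: "nat \<Rightarrow> real" and \<gamma> :: "nat \<Rightarrow> 'b set \<Rightarrow> ennreal"
  assumes v: "\<And>n. n \<ge> 1 \<Longrightarrow> 0 < v n" "(\<lambda>n. 1 / v n) \<longlonglongrightarrow> 0"
    and lower: "\<And>A \<mu> l. openin T A \<Longrightarrow> \<mu> \<in> A \<Longrightarrow> F \<mu> < ereal l \<Longrightarrow>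
      \<forall>\<^sub>F n in sequentially. ennreal (exp (- (v n * l))) \<le> \<gamma> n A"
    and upper: "\<And>C a. closedin T C \<Longrightarrow> \<forall>\<mu>\<in>C. ereal a < F \<mu> \<Longrightarrow>
      \<exists>K>0. \<forall>\<^sub>F n in sequentially. \<gamma> n C \<le> ennreal (K * exp (- (v n * a)))"
    and Q: "\<And>n A. n \<ge> 1 \<Longrightarrow> openin T A \<or> closedin T A \<Longrightarrow>
      emeasure (Q n) A = (1 / \<gamma> n (topspace T)) * \<gamma> n A"
    and m: "(INF \<nu>\<in>topspace T. F \<nu>) = ereal m"
  shows "large_deviation_principle T v Q (\<lambda>\<mu>. F \<mu> - ereal m)"
proof -
  define Z where "Z n = \<gamma> n (topspace T)" for n
  have Z_lower: "\<forall>\<^sub>F n in sequentially. ennreal (exp (- (v n * (m + e)))) \<le> Z n" if "0 < e" for e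
  proof -
    have "(INF \<nu>\<in>topspace T. F \<nu>) < ereal (m + e)" using m that by simp
    then obtain \<mu> where "\<mu> \<in> topspace T" "F \<mu> < ereal (m + e)" by (auto simp: INF_less_iff)
    then show ?thesis unfolding Z_def by (intro lower) auto
  qed
  have Z_upper: "\<exists>K>0. \<forall>\<^sub>F n in sequentially. Z n \<le> ennreal (K * exp (- (v n * (m - e))))"
      if "0 < e" for e
    unfolding Z_def
  proof (intro upper ballI)
    fix \<mu> assume "\<mu> \<in> topspace T"
    then have "ereal m \<le> F \<mu>" unfolding m[symmetric] by (rule INF_lower)
    then show "ereal (m - e) < F \<mu>" using that by (cases "F \<mu>") auto
  qed simp
  have small: "\<forall>\<^sub>F n in sequentially. ln K / v n < e" if "0 < e" for K e :: real
  proof -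
    have "(\<lambda>n. ln K * (1 / v n)) \<longlonglongrightarrow> ln K * 0" by (intro tendsto_intros v(2))
    then show ?thesis using that by (intro order_tendstoD(2)) auto
  qed
  define X where "X n A = ereal (1 / v n) * ln_ennreal (emeasure (Q n) A)" for n A
  have "- (INF \<mu>\<in>A. F \<mu> - ereal m) \<le> liminf (\<lambda>n. X n A)" if A: "openin T A" for A
  proof -
    have "- liminf (\<lambda>n. X n A) \<le> F \<mu> - ereal m" if "\<mu> \<in> A" for \<mu>
    proof (rule ccontr)
      assume "\<not> ?thesis"
      then have "liminf (\<lambda>n. X n A) < - (F \<mu> - ereal m)"
        by (simp add: ereal_less_uminus_reorder not_le)
      then obtain t where t: "liminf (\<lambda>n. X n A) < ereal t" "ereal t < - (F \<mu> - ereal m)"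
        using ereal_dense2 by blast
      have "F \<mu> < ereal (m - t)" using t(2) by (cases "F \<mu>") auto
      then obtain l where l: "F \<mu> < ereal l" "l < m - t"
        using ereal_dense2 by (metis less_ereal.simps(1))
      \<comment> \<open>Half of the gap absorbs the error in Z n, the other half the term ln K / v
        n.\<close>
      define e where "e = (m - t - l) / 2"
      have "0 < e" using l(2) by (simp add: e_def)
      obtain K where K: "0 < K" "\<forall>\<^sub>F n in sequentially. Z n \<le> ennreal (K * exp (- (v n * (m - e))))"
        using Z_upper[OF \<open>0 < e\<close>] by blast
      have "\<forall>\<^sub>F n in sequentially. ereal t \<le> X n A"
        using K(2) Z_lower[OF \<open>0 < e\<close>] lower[OF A \<open>\<mu> \<in> A\<close> l(1)] small[OF \<open>0 < e\<close>, of K]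
            eventually_ge_at_top[of 1]
      proof eventually_elim
        case (elim n)
        define y where "y = exp (- (v n * l)) / (K * exp (- (v n * (m - e))))"
        have "0 < v n" using elim v(1) by simp
        obtain z where z: "Z n = ennreal z" "0 \<le> z"
          using elim(1) by (cases "Z n") (auto simp: top_unique)
        have "exp (- (v n * (m + e))) \<le> z" using elim(2) z by (simp add: ennreal_le_iff)
        then have "0 < z" by (rule less_le_trans[rotated]) simp
        have "z \<le> K * exp (- (v n * (m - e)))" using elim(1) z K(1) by (simp add: ennreal_le_iff)
        then have "y \<le> exp (- (v n * l)) / z"
          unfolding y_def using \<open>0 < z\<close> by (intro divide_left_mono) auto
        then have "ennreal y \<le> ennreal (exp (- (v n * l)) / z)" by (rule ennreal_leI)
        also have "\<dots> = (1 / Z n) * ennreal (exp (- (v n * l)))"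
          using z \<open>0 < z\<close> by (simp add: divide_ennreal flip: ennreal_1 ennreal_mult)
        also have "\<dots> \<le> (1 / Z n) * \<gamma> n A" by (intro mult_left_mono elim(3)) simp
        also have "\<dots> = emeasure (Q n) A" using Q[OF elim(5)] A by (simp add: Z_def)
        finally have "ereal (ln y) \<le> ln_ennreal (emeasure (Q n) A)"
          using ln_ennreal_mono[of "ennreal y"] K(1) by (simp add: ln_ennreal_ennreal y_def)
        then have "ereal (1 / v n) * ereal (ln y) \<le> X n A"
          unfolding X_def using \<open>0 < v n\<close> by (intro ereal_mult_left_mono) auto
        moreover have "ln y = v n * (m - e - l) - ln K"
          using K(1) by (simp add: y_def ln_div ln_mult algebra_simps)
        then have "(1 / v n) * ln y = m - e - l - ln K / v n"
          using \<open>0 < v n\<close> by (simp add: field_simps)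
        moreover have "t \<le> m - e - l - ln K / v n" using elim(4) unfolding e_def by argo
        ultimately show ?case by (simp add: order_trans[rotated])
      qed
      then have "ereal t \<le> liminf (\<lambda>n. X n A)" by (rule Liminf_bounded)
      then show False using t(1) by simp
    qed
    then have "- liminf (\<lambda>n. X n A) \<le> (INF \<mu>\<in>A. F \<mu> - ereal m)" by (rule INF_greatest)
    then show ?thesis by (simp add: ereal_uminus_le_reorder)
  qed
  moreover have "limsup (\<lambda>n. X n C) \<le> - (INF \<mu>\<in>C. F \<mu> - ereal m)" if C: "closedin T C" for C
  proof (rule ccontr)
    assume "\<not> ?thesis"
    then obtain t where t: "- (INF \<mu>\<in>C. F \<mu> - ereal m) < ereal t" "ereal t < limsup (\<lambda>n. X n C)"
      using ereal_dense2 by (metis not_le)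
    have "ereal (- t) < (INF \<mu>\<in>C. F \<mu> - ereal m)"
      using t(1) by (simp add: ereal_uminus_less_reorder)
    then obtain a where a: "- t < a" "ereal a < (INF \<mu>\<in>C. F \<mu> - ereal m)"
      using ereal_dense2 by (metis less_ereal.simps(1))
    have aF: "\<forall>\<mu>\<in>C. ereal (a + m) < F \<mu>"
    proof
      fix \<mu> assume "\<mu> \<in> C"
      then have "ereal a < F \<mu> - ereal m" using a(2) INF_lower less_le_trans by fast
      then show "ereal (a + m) < F \<mu>" by (cases "F \<mu>") auto
    qed
    obtain K where K: "0 < K" "\<forall>\<^sub>F n in sequentially. \<gamma> n C \<le> ennreal (K * exp (- (v n * (a + m))))"
      using upper[OF C aF] by blast
    define e where "e = (t + a) / 2"
    have "0 < e" using a(1) by (simp add: e_def)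
    \<comment> \<open>The upper bound on Z n enters here through its finiteness: it lets the
      quotient by Z n be computed in the reals.\<close>
    obtain K' where K': "0 < K'"
        "\<forall>\<^sub>F n in sequentially. Z n \<le> ennreal (K' * exp (- (v n * (m - e))))"
      using Z_upper[OF \<open>0 < e\<close>] by blast
    have "\<forall>\<^sub>F n in sequentially. X n C \<le> ereal t"
      using K(2) Z_lower[OF \<open>0 < e\<close>] K'(2) small[OF \<open>0 < e\<close>, of K] eventually_ge_at_top[of 1]
    proof eventually_elim
      case (elim n)
      define y where "y = K * exp (- (v n * (a + m))) / exp (- (v n * (m + e)))"
      have "0 < v n" using elim v(1) by simp
      obtain z where z: "Z n = ennreal z" "0 \<le> z"
        using elim(3) by (cases "Z n") (auto simp: top_unique)
      have z_ge: "exp (- (v n * (m + e))) \<le> z" using elim(2) z by (simp add: ennreal_le_iff)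
      then have "0 < z" by (rule less_le_trans[rotated]) simp
      have "emeasure (Q n) C = (1 / Z n) * \<gamma> n C" using Q[OF elim(5)] C by (simp add: Z_def)
      also have "\<dots> \<le> (1 / Z n) * ennreal (K * exp (- (v n * (a + m))))"
        by (intro mult_left_mono elim(1)) simp
      also have "\<dots> = ennreal (K * exp (- (v n * (a + m))) / z)"
        using z \<open>0 < z\<close> K(1) by (simp add: divide_ennreal flip: ennreal_1 ennreal_mult)
      also have "\<dots> \<le> ennreal y"
        unfolding y_def using z_ge K(1) \<open>0 < z\<close> by (intro ennreal_leI divide_left_mono) auto
      finally have "ln_ennreal (emeasure (Q n) C) \<le> ereal (ln y)"
        using ln_ennreal_mono[of _ "ennreal y"] K(1) by (simp add: ln_ennreal_ennreal y_def)
      then have "X n C \<le> ereal (1 / v n) * ereal (ln y)"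
        unfolding X_def using \<open>0 < v n\<close> by (intro ereal_mult_left_mono) auto
      moreover have "ln y = ln K - v n * (a - e)"
        using K(1) by (simp add: y_def ln_div ln_mult algebra_simps)
      then have "(1 / v n) * ln y = ln K / v n - a + e"
        using \<open>0 < v n\<close> by (simp add: field_simps)
      moreover have "ln K / v n - a + e \<le> t" using elim(4) unfolding e_def by argo
      ultimately show ?case by (simp add: order_trans)
    qed
    then have "limsup (\<lambda>n. X n C) \<le> ereal t" by (rule Limsup_bounded)
    then show False using t(2) by simp
  qed
  ultimately show ?thesis
    unfolding large_deviation_principle_def X_def by blast
qed

text \<open>Stability passes to all expectations and hence to their upper limit, which W dominates.
  The lower limit assumption cannot give this, as it bounds W from above.\<close>

lemma upper_limit_at_lower_bound:
  assumes \<mu>: "\<mu> \<in> borel_probs" and Wn: "energy_sequence Wn"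
    and C: "\<And>n x. n \<ge> 1 \<Longrightarrow> x \<in> space (power_borel n) \<Longrightarrow> ereal (- C) \<le> Wn n x" "0 \<le> C"
    and upper: "upper_limit_at Wn W \<mu>"
  shows "ereal (- C) \<le> W \<mu>"
proof -
  have "\<forall>\<^sub>F n in sequentially. ereal (- C) \<le> ereal_integral (power_measure n \<mu>) (Wn n)"
    using eventually_ge_at_top[of 1]
  proof eventually_elim
    case (elim n)
    have "Wn n \<in> borel_measurable (power_measure n \<mu>)"
      using energy_sequence_measurable[OF Wn elim] \<mu> by (simp add: measurable_power_measure)
    then have "ereal_integral (power_measure n \<mu>) (Wn n) =
        enn2ereal (\<integral>\<^sup>+x. e2ennreal (Wn n x + ereal C) \<partial>power_measure n \<mu>) - ereal C"
      using C(1)[OF elim] \<mu>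
      by (intro ereal_integral_shift prob_space_power_measure C(2))
          (simp_all add: space_power_measure)
    moreover have "0 \<le> enn2ereal (\<integral>\<^sup>+x. e2ennreal (Wn n x + ereal C) \<partial>power_measure n \<mu>)" by simp
    ultimately show ?case
      by (cases "enn2ereal (\<integral>\<^sup>+x. e2ennreal (Wn n x + ereal C) \<partial>power_measure n \<mu>)") auto
  qed
  then have "ereal (- C) \<le> limsup (\<lambda>n. ereal_integral (power_measure n \<mu>) (Wn n))"
    by (intro le_Limsup) auto
  also have "\<dots> \<le> W \<mu>" using upper by (simp add: upper_limit_at_def)
  finally show ?thesis .
qed

text \<open>Inversion is continuous on (0, \<infinity>], with 1 / \<infinity> = 0. The real number
  \<kappa> removes the case distinction on \<beta> from the local bounds.\<close>

lemma inverse_temperature_limit: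
  fixes \<beta> :: ereal
  assumes "0 < \<beta>" "(\<lambda>n. ereal (b n)) \<longlonglongrightarrow> \<beta>"
  obtains \<kappa> where "ereal \<kappa> = 1 / \<beta>" "(\<lambda>n. 1 / b n) \<longlonglongrightarrow> \<kappa>" "0 \<le> \<kappa>" "\<beta> < \<infinity> \<Longrightarrow> 0 < \<kappa>"
proof (cases \<beta>)
  case (real r)
  then have "b \<longlonglongrightarrow> r" "0 < r" using assms by auto
  then have "(\<lambda>n. 1 / b n) \<longlonglongrightarrow> 1 / r" by (intro tendsto_intros) auto
  then show ?thesis using real \<open>0 < r\<close> by (intro that[of "1 / r"]) (auto simp: one_ereal_def)
next
  case PInf
  then have "\<forall>\<^sub>F n in sequentially. c < b n" for c
    using assms(2) by (simp add: tendsto_PInfty)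
  then have "filterlim b at_top sequentially" by (simp add: filterlim_at_top_dense)
  then have "(\<lambda>n. inverse (b n)) \<longlonglongrightarrow> 0" by (rule tendsto_inverse_0_at_top)
  then show ?thesis using PInf
      by (intro that[of 0]) (auto simp: inverse_eq_divide zero_ereal_def[symmetric])
qed (use assms in auto)

text \<open>\<open>inf_finite\<close> excludes that F is \<infinity> everywhere. In
  \<open>ereal\<close> the difference \<infinity> - \<infinity> is \<infinity>, so the rate function
  would be \<infinity> throughout, and the upper bound would fail on the whole space, whose
  probability is 1.\<close>

theorem corollary1p3:
  fixes \<pi> :: "'a::polish_space measure"
    and Wn :: "nat \<Rightarrow> (nat \<Rightarrow> 'a) \<Rightarrow> ereal"
    and W :: "'a measure \<Rightarrow> ereal"
    and b :: "nat \<Rightarrow> real"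
    and \<beta> :: ereal
  assumes "\<pi> \<in> borel_probs"
    and "energy_sequence Wn"
    and "stable_sequence Wn"
    and "W \<in> borel_measurable (borel_of_topology weak_topology)"
    and "\<forall>\<mu>\<in>borel_probs. W \<mu> \<noteq> -\<infinity>"
    and "\<forall>n\<ge>1. b n > 0"
    and "0 < \<beta>"
    and "(\<lambda>n. ereal (b n)) \<longlonglongrightarrow> \<beta>"
    and "\<beta> < \<infinity> \<Longrightarrow> positive_temperature_limit Wn W"
    and "\<beta> = \<infinity> \<Longrightarrow> zero_temperature_limit \<pi> Wn W"
    and "\<beta> = \<infinity> \<Longrightarrow> confining_sequence Wn"
    and "\<forall>n\<ge>1. partition_function \<pi> Wn b n > 0"
    and inf_finite: "(INF \<nu>\<in>borel_probs. free_energy \<pi> W \<beta> \<nu>) < \<infinity>"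
  shows "large_deviation_principle weak_topology (\<lambda>n. real n * b n)
     (\<lambda>n. distr (gibbs_prob \<pi> Wn b n) (borel_of_topology weak_topology) (empirical n))
     (\<lambda>\<mu>. free_energy \<pi> W \<beta> \<mu> - (INF \<nu>\<in>borel_probs. free_energy \<pi> W \<beta> \<nu>))"
proof -
  note \<pi> = assms(1) and Wn = assms(2,3)
  obtain \<kappa> where \<kappa>: "ereal \<kappa> = 1 / \<beta>" "(\<lambda>n. 1 / b n) \<longlonglongrightarrow> \<kappa>" "0 \<le> \<kappa>" "\<beta> < \<infinity> \<Longrightarrow> 0 < \<kappa>"
    using inverse_temperature_limit[OF assms(7,8)] by blast
  define F where "F = free_energy \<pi> W \<beta>"
  have F: "F \<mu> = W \<mu> + ereal \<kappa> * relative_entropy \<mu> \<pi>" for \<mu>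
    by (simp add: F_def free_energy_def \<kappa>(1))
  have F_zero: "F \<mu> = W \<mu>" if "\<beta> = \<infinity>" for \<mu>
    using that by (simp add: F_def free_energy_def)
  have \<kappa>_zero: "\<kappa> = 0" if "\<beta> = \<infinity>" using \<kappa>(1) that by (simp add: zero_ereal_def)
  have b: "0 < b n" if "n \<ge> 1" for n using assms(6) that by simp
  have A1: "lower_limit_assumption Wn W"
    using assms(9,10) by (cases "\<beta> = \<infinity>")
        (auto simp: positive_temperature_limit_def zero_temperature_limit_def)
  obtain C0 where C0: "\<And>n x. n \<ge> 1 \<Longrightarrow> x \<in> space (power_borel n) \<Longrightarrow> ereal C0 \<le> Wn n x"
    using Wn(2) unfolding stable_sequence_def by blast
  define c where "c = \<bar>C0\<bar>"
  have c: "ereal (- c) \<le> Wn n x" if "n \<ge> 1" "x \<in> space (power_borel n)" for n x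
    using order_trans[OF _ C0[OF that], of "ereal (- c)"] by (simp add: c_def)
  have "0 \<le> c" by (simp add: c_def)
  have regularity: "\<exists>\<nu>. (\<forall>k. \<nu> k \<in> borel_probs \<and> relative_entropy (\<nu> k) \<pi> <
      \<infinity> \<and> upper_limit_at Wn W (\<nu> k)) \<and>
      limitin weak_topology \<nu> \<mu> sequentially \<and> limsup (\<lambda>k. W (\<nu> k)) \<le> W \<mu>"
    if "\<beta> = \<infinity>" "\<mu> \<in> borel_probs" "W \<mu> < \<infinity>" for \<mu>
    using assms(10)[OF that(1)] that
        unfolding zero_temperature_limit_def regularity_assumption_def by auto
  \<comment> \<open>At zero temperature the upper limit condition is available only at the
    approximating measures; their common lower bound reaches \<mu> through limsup W (\<nu> k) \<le>
    W \<mu>.\<close>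
  have W_ge: "ereal (- c) \<le> W \<mu>" if \<mu>: "\<mu> \<in> borel_probs" for \<mu>
  proof (cases "\<beta> < \<infinity>")
    case True
    then have "upper_limit_at Wn W \<mu>"
      using assms(9) \<mu> by (simp add: positive_temperature_limit_def upper_limit_assumption_def)
    then show ?thesis using \<mu> Wn(1) c \<open>0 \<le> c\<close> by (intro upper_limit_at_lower_bound)
  next
    case False
    then have "\<beta> = \<infinity>" by simp
    show ?thesis
    proof (cases "W \<mu> < \<infinity>")
      case True
      obtain \<nu> where \<nu>: "\<And>k. \<nu> k \<in> borel_probs" "\<And>k. upper_limit_at Wn W (\<nu> k)"
        "limsup (\<lambda>k. W (\<nu> k)) \<le> W \<mu>"
        using regularity[OF \<open>\<beta> = \<infinity>\<close> \<mu> True] by blast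
      have "ereal (- c) \<le> W (\<nu> k)" for k
        using \<nu>(1,2) Wn(1) c \<open>0 \<le> c\<close> by (intro upper_limit_at_lower_bound)
      then have "ereal (- c) \<le> limsup (\<lambda>k. W (\<nu> k))" by (intro le_Limsup) auto
      then show ?thesis using \<nu>(3) by simp
    qed simp
  qed
  have F_ge: "ereal (- c) \<le> F \<mu>" if "\<mu> \<in> borel_probs" for \<mu>
  proof -
    have "ereal (- c) + 0 \<le> W \<mu> + ereal \<kappa> * relative_entropy \<mu> \<pi>"
      using W_ge[OF that] relative_entropy_nonneg[OF that \<pi>] \<kappa>(3) by (intro add_mono) auto
    then show ?thesis by (simp add: F)
  qed
  have "ereal (- c) \<le> (INF \<nu>\<in>borel_probs. F \<nu>)" using F_ge by (intro INF_greatest)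
  then obtain m where m: "(INF \<nu>\<in>borel_probs. F \<nu>) = ereal m"
    using inf_finite unfolding F_def[symmetric] by (cases "INF \<nu>\<in>borel_probs. F \<nu>") auto
  define v where "v n = real n * b n" for n
  have v_pos: "0 < v n" if "n \<ge> 1" for n using b[OF that] that by (simp add: v_def)
  have "(\<lambda>n. (1 / real n) * (1 / b n)) \<longlonglongrightarrow> 0 * \<kappa>"
    by (intro tendsto_mult \<kappa>(2)) real_asymp
  then have v_lim: "(\<lambda>n. 1 / v n) \<longlonglongrightarrow> 0" by (simp add: v_def)
  define \<gamma> where "\<gamma> n A = emeasure (gibbs_measure \<pi> Wn b n) (empirical_in n A)" for n A
  have lower: "\<forall>\<^sub>F n in sequentially. ennreal (exp (- (v n * l))) \<le> \<gamma> n A"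
    if A: "openin weak_topology A" "\<mu> \<in> A" and l: "F \<mu> < ereal l" for A \<mu> l
  proof -
    have \<mu>: "\<mu> \<in> borel_probs" using openin_subset[OF A(1)] A(2) by auto
    show ?thesis
    proof (cases "\<beta> < \<infinity>")
      case True
      then have upper: "upper_limit_at Wn W \<mu>"
        using assms(9) \<mu> by (simp add: positive_temperature_limit_def upper_limit_assumption_def)
      \<comment> \<open>As \<kappa> > 0 and W \<mu> \<ge> -c, infinite entropy would make F \<mu>
        infinite.\<close>
      have "relative_entropy \<mu> \<pi> < \<infinity>"
        using l W_ge[OF \<mu>] \<kappa>(4)[OF True] unfolding F
        by (cases "relative_entropy \<mu> \<pi>"; cases "W \<mu>") auto
      then show ?thesis
        unfolding v_def \<gamma>_def using l unfolding F
        by (intro gibbs_measure_open_lower_bound[OF \<pi> Wn b \<kappa>(2) A _ upper])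
    next
      case False
      then have "\<beta> = \<infinity>" by simp
      have W_l: "W \<mu> < ereal l" using l by (simp add: F_zero[OF \<open>\<beta> = \<infinity>\<close>])
      then have "W \<mu> < \<infinity>" by auto
      obtain \<nu> where \<nu>: "\<And>k. relative_entropy (\<nu> k) \<pi> < \<infinity>" "\<And>k. upper_limit_at Wn W (\<nu> k)"
        "limitin weak_topology \<nu> \<mu> sequentially" "limsup (\<lambda>k. W (\<nu> k)) \<le> W \<mu>"
        using regularity[OF \<open>\<beta> = \<infinity>\<close> \<mu> \<open>W \<mu> < \<infinity>\<close>] by blast
      \<comment> \<open>The bound is established at some \<nu> k in A in place of \<mu>: its entropy
        is finite and its energy still below l.\<close>
      have "\<forall>\<^sub>F k in sequentially. W (\<nu> k) < ereal l"
        using \<nu>(4) W_l by (intro Limsup_lessD) auto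
      moreover have "\<forall>\<^sub>F k in sequentially. \<nu> k \<in> A"
        using \<nu>(3) A unfolding limitin_def by blast
      ultimately have "\<forall>\<^sub>F k in sequentially. W (\<nu> k) < ereal l \<and> \<nu> k \<in> A" by (rule eventually_conj)
      then obtain k where k: "W (\<nu> k) < ereal l" "\<nu> k \<in> A" unfolding eventually_sequentially
          by blast
      have "W (\<nu> k) + ereal \<kappa> * relative_entropy (\<nu> k) \<pi> < ereal l"
        using k(1) \<kappa>_zero[OF \<open>\<beta> = \<infinity>\<close>] by (simp flip: zero_ereal_def)
      then show ?thesis
        unfolding v_def \<gamma>_def
        by (intro gibbs_measure_open_lower_bound[OF \<pi> Wn b \<kappa>(2) A(1) k(2) \<nu>(1,2)])
    qed
  qed
  have upper: "\<exists>K>0. \<forall>\<^sub>F n in sequentially. \<gamma> n C \<le> ennreal (K * exp (- (v n * a)))"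
    if C: "closedin weak_topology C" "\<forall>\<mu>\<in>C. ereal a < F \<mu>" for C a
  proof (cases "\<beta> < \<infinity>")
    case True
    have a: "ereal a < W \<mu> + ereal \<kappa> * relative_entropy \<mu> \<pi>" if "\<mu> \<in> C" for \<mu>
      using C(2) that by (simp add: F)
    obtain K where "0 < K" "\<forall>\<^sub>F n in sequentially. emeasure (gibbs_measure \<pi> Wn b n)
      (empirical_in n C) \<le> ennreal (K * exp (- (real n * b n * a)))"
      by (rule gibbs_measure_closed_upper_bound_positive_temperature[OF \<pi> Wn A1 b \<kappa>(2)
          \<kappa>(4)[OF True] assms(5) C(1) a])
        (assumption | rule that)+
    then show ?thesis unfolding \<gamma>_def v_def by blast
  next
    case False
    then have "\<beta> = \<infinity>" by simp
    have a: "ereal a < W \<mu>" if "\<mu> \<in> C" for \<mu>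
      using C(2) that by (simp add: F_zero[OF \<open>\<beta> = \<infinity>\<close>])
    have "\<forall>\<^sub>F n in sequentially. \<gamma> n C \<le> ennreal (1 * exp (- (v n * a)))"
      unfolding \<gamma>_def v_def mult_1
      by (rule gibbs_measure_closed_upper_bound_zero_temperature[OF \<pi> Wn(1) assms(11)[OF \<open>\<beta> = \<infinity>\<close>]
          A1 b C(1) a])
    then show ?thesis by (intro exI[of _ 1]) simp
  qed
  have Q: "emeasure (distr (gibbs_prob \<pi> Wn b n) (borel_of_topology weak_topology) (empirical n)) A =
      (1 / \<gamma> n (topspace weak_topology)) * \<gamma> n A"
    if n: "n \<ge> 1" and A: "openin weak_topology A \<or> closedin weak_topology A" for n A
  proof -
    have sets: "sets (gibbs_prob \<pi> Wn b n) = sets (power_borel n)"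
      by (simp add: gibbs_prob_def sets_gibbs_measure[OF \<pi>])
    have space: "space (gibbs_prob \<pi> Wn b n) = space (power_borel n)"
      using sets by (rule sets_eq_imp_space_eq)
    have "empirical n \<in> measurable (gibbs_prob \<pi> Wn b n) (borel_of_topology (weak_topology :: 'a measure topology))"
      using measurable_empirical[OF n] by (simp add: measurable_cong_sets[OF sets refl])
    moreover have "A \<in> sets (borel_of_topology weak_topology)"
      using A openin_borel_of_topology closedin_borel_of_topology by blast
    ultimately have "emeasure (distr (gibbs_prob \<pi> Wn b n) (borel_of_topology weak_topology) (empirical n)) A =
        emeasure (gibbs_prob \<pi> Wn b n) (empirical n -` A \<inter> space (power_borel n))"
      by (simp add: emeasure_distr space)
    also have "empirical n -` A \<inter> space (power_borel n) = empirical_in n A" by auto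
    also have "emeasure (gibbs_prob \<pi> Wn b n) \<dots> = (1 / partition_function \<pi> Wn b n) * \<gamma> n A"
      by (simp add: gibbs_prob_def \<gamma>_def)
    also have "partition_function \<pi> Wn b n = \<gamma> n (topspace weak_topology)"
      by (simp add: partition_function_def \<gamma>_def space_gibbs_measure[OF \<pi>]
          empirical_borel_probs[OF n])
    finally show ?thesis .
  qed
  have m': "(INF \<nu>\<in>topspace weak_topology. F \<nu>) = ereal m" using m by simp
  have "large_deviation_principle weak_topology v
      (\<lambda>n. distr (gibbs_prob \<pi> Wn b n) (borel_of_topology weak_topology) (empirical n)) (\<lambda>\<mu>. F \<mu> -
          ereal m)"
    by (rule large_deviation_principleI[where \<gamma> = \<gamma>, OF v_pos v_lim lower upper Q m'])
  then show ?thesis unfolding v_def F_def m[unfolded F_def] .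
qed

end
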